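(* Let $f$ be a non-zero solution of a linear differential equation with coefficients in $\mathbb{C}(x)$, with Picard-Vessiot extension $K_f$ over $\mathbb{C}(x)$ containing $f$, and denote by $G_f$ the differential Galois group over $\mathbb{C}(x)$ of this equation. Let $f_1,\dots,f_k$ be non-zero solutions of linear differential equations with coefficients in $\mathbb{C}(x)$, with Picard-Vessiot extensions $K_{f_1},\dots,K_{f_k}$ over $\mathbb{C}(x)$ containing $f_1,\dots,f_k$ respectively. Assume that $f\in \mathbb{C}(x)(f_1,\dots,f_k)\setminus \mathbb{C}(x)$. If $G_f$ is non-commutative and has no normal algebraic subgroups other than itself and the trivial group, then there exists $i\in\{1,\dots,k\}$ such that $K_f\subset K_{f_i}$.
   Context: Linear differential equations are homogeneous, of the form $a_p y^{(p)}+\dots+a_0y=0$ with $a_i\in\mathbb{C}(x)$, $a_p\ne 0$, and are identified with their companion systems $Y'=BY$, $Y=(y,y',\dots,y^{(p-1)})^\top$. A Picard-Vessiot extension of $Y'=BY$ ($B$ a $p\times p$ matrix over $\mathbb{C}(x)$) over $\mathbb{C}(x)$ is a differential field extension $K/\mathbb{C}(x)$ with field of constants $\mathbb{C}$ such that there is $U\in \mathrm{GL}_p(K)$ with $U'=BU$ (a fundamental solution) and $K$ is generated over $\mathbb{C}(x)$ by the entries of $U$. All solutions and Picard-Vessiot extensions here are realized as fields of meromorphic functions on a common nonempty connected open subset of $\mathbb{C}$ (so all the fields $K_f,K_{f_1},\dots,K_{f_k}$ lie in one field of meromorphic functions, and the membership and the inclusion in the statement are understood there). The differential Galois group is the group of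 field automorphisms of $K$ fixing $\mathbb{C}(x)$ and commuting with the derivation; via $\sigma\mapsto U^{-1}\sigma(U)$ it is identified with a linear algebraic subgroup of $\mathrm{GL}_p(\mathbb{C})$, and "algebraic subgroup" means Zariski-closed subgroup (not necessarily connected). *)

theory Defs
  imports
    "HOL-Complex_Analysis.Complex_Analysis"
    "HOL-Algebra.Bij"
    "HOL-Algebra.Generated_Fields"
    "HOL-Library.Poly_Mapping"
    "Jordan_Normal_Form.Matrix"
begin

no_notation fls_nth (infixl \<open>$$\<close> 75)

subsection \<open>The differential field of meromorphic functions on a domain\<close>

text \<open>
  A meromorphic function on \<open>D\<close> is represented by its unique representative without removable
  singularities that vanishes at its poles and outside \<open>D\<close>, so that equality of elements of the
  field is equality in HOL. Every operation is the pointwise one followed by passing to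
  this representative.
\<close>

definition mero_repr :: "complex set \<Rightarrow> (complex \<Rightarrow> complex) \<Rightarrow> complex \<Rightarrow> complex" where
  "mero_repr D f = (\<lambda>z. if z \<in> D then remove_sings f z else 0)"

definition mero_field :: "complex set \<Rightarrow> (complex \<Rightarrow> complex) ring" where
  "mero_field D =
    \<lparr>carrier = {f. f nicely_meromorphic_on D \<and> (\<forall>z. z \<notin> D \<longrightarrow> f z = 0)},
     mult = \<lambda>f g. mero_repr D (\<lambda>z. f z * g z),
     one = mero_repr D (\<lambda>_. 1),
     zero = mero_repr D (\<lambda>_. 0),
     add = \<lambda>f g. mero_repr D (\<lambda>z. f z + g z)\<rparr>"

definition mero_const :: "complex set \<Rightarrow> complex \<Rightarrow> complex \<Rightarrow> complex" where
  "mero_const D c = mero_repr D (\<lambda>_. c)"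

definition mero_deriv :: "complex set \<Rightarrow> (complex \<Rightarrow> complex) \<Rightarrow> complex \<Rightarrow> complex" where
  "mero_deriv D f = mero_repr D (deriv f)"

text \<open>The field \<open>\<complex>(x)\<close>, embedded into the meromorphic functions on \<open>D\<close>.\<close>

definition rational_functions :: "complex set \<Rightarrow> (complex \<Rightarrow> complex) set" where
  "rational_functions D = {mero_repr D (\<lambda>z. poly P z / poly Q z) | P Q. Q \<noteq> 0}"

subsection \<open>Linear differential equations and their companion systems\<close>

text \<open>\<open>p\<close> is the order and \<open>a i\<close> is the coefficient of the \<open>i\<close>-th derivative.\<close>

definition linear_ode :: "complex set \<Rightarrow> nat \<Rightarrow> (nat \<Rightarrow> complex \<Rightarrow> complex) \<Rightarrow> bool" where
  "linear_ode D p a \<longleftrightarrow>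
    (\<forall>i\<le>p. a i \<in> rational_functions D) \<and> a p \<noteq> \<zero>\<^bsub>mero_field D\<^esub>"

definition ode_solution ::
    "complex set \<Rightarrow> nat \<Rightarrow> (nat \<Rightarrow> complex \<Rightarrow> complex) \<Rightarrow> (complex \<Rightarrow> complex) \<Rightarrow> bool" where
  "ode_solution D p a y \<longleftrightarrow> y \<in> carrier (mero_field D) \<and>
    (\<Oplus>\<^bsub>mero_field D\<^esub>i\<in>{..p}. a i \<otimes>\<^bsub>mero_field D\<^esub> (mero_deriv D ^^ i) y) = \<zero>\<^bsub>mero_field D\<^esub>"

definition companion_mat ::
    "complex set \<Rightarrow> nat \<Rightarrow> (nat \<Rightarrow> complex \<Rightarrow> complex) \<Rightarrow> (complex \<Rightarrow> complex) mat" where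
  "companion_mat D p a = mat p p (\<lambda>(i, j).
    if Suc i < p then (if j = Suc i then \<one>\<^bsub>mero_field D\<^esub> else \<zero>\<^bsub>mero_field D\<^esub>)
    else \<ominus>\<^bsub>mero_field D\<^esub> (a j \<otimes>\<^bsub>mero_field D\<^esub> inv\<^bsub>mero_field D\<^esub> (a p)))"

subsection \<open>Picard-Vessiot extensions and differential Galois groups\<close>

text \<open>
  The matrix operations of the Jordan Normal Form library are bound to type classes; here the
  entries are taken from a ring with explicit carrier.
\<close>

definition mat_monoid :: "('a, 'b) ring_scheme \<Rightarrow> nat \<Rightarrow> 'a mat monoid" where
  "mat_monoid R p =
    \<lparr>carrier = {A \<in> carrier_mat p p. elements_mat A \<subseteq> carrier R},
     mult = \<lambda>A B. mat p p (\<lambda>(i, j). \<Oplus>\<^bsub>R\<^esub>k\<in>{..<p}. A $$ (i, k) \<otimes>\<^bsub>R\<^esub> B $$ (k, j)),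
     one = mat p p (\<lambda>(i, j). if i = j then \<one>\<^bsub>R\<^esub> else \<zero>\<^bsub>R\<^esub>)\<rparr>"

text \<open>\<open>U \<in> GL\<^sub>p(K)\<close> and \<open>U' = B U\<close>.\<close>

definition fundamental_solution ::
    "complex set \<Rightarrow> nat \<Rightarrow> (complex \<Rightarrow> complex) mat \<Rightarrow> (complex \<Rightarrow> complex) set \<Rightarrow>
     (complex \<Rightarrow> complex) mat \<Rightarrow> bool" where
  "fundamental_solution D p B K U \<longleftrightarrow>
    U \<in> Units (mat_monoid (mero_field D\<lparr>carrier := K\<rparr>) p) \<and>
    map_mat (mero_deriv D) U = B \<otimes>\<^bsub>mat_monoid (mero_field D) p\<^esub> U"

definition picard_vessiot ::
    "complex set \<Rightarrow> nat \<Rightarrow> (complex \<Rightarrow> complex) mat \<Rightarrow> (complex \<Rightarrow> complex) set \<Rightarrow> bool" where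
  "picard_vessiot D p B K \<longleftrightarrow>
    B \<in> carrier_mat p p \<and> elements_mat B \<subseteq> rational_functions D \<and>
    subfield K (mero_field D) \<and> rational_functions D \<subseteq> K \<and>
    mero_deriv D ` K \<subseteq> K \<and>
    {c \<in> K. mero_deriv D c = \<zero>\<^bsub>mero_field D\<^esub>} = range (mero_const D) \<and>
    (\<exists>U. fundamental_solution D p B K U \<and>
      K = generate_field (mero_field D) (rational_functions D \<union> elements_mat U))"

text \<open>
  The elements of \<open>BijGroup K\<close> are extensional functions, so each automorphism of \<open>K\<close> occurs
  exactly once.
\<close>

definition diff_galois_group ::
    "complex set \<Rightarrow> (complex \<Rightarrow> complex) set \<Rightarrow> ((complex \<Rightarrow> complex) \<Rightarrow> complex \<Rightarrow> complex) monoid" where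
  "diff_galois_group D K = BijGroup K
    \<lparr>carrier := {\<sigma> \<in> Bij K.
       \<sigma> \<in> ring_iso (mero_field D\<lparr>carrier := K\<rparr>) (mero_field D\<lparr>carrier := K\<rparr>) \<and>
       (\<forall>r\<in>rational_functions D. \<sigma> r = r) \<and>
       (\<forall>y\<in>K. \<sigma> (mero_deriv D y) = mero_deriv D (\<sigma> y))}\<rparr>"

subsection \<open>Zariski-closed subgroups\<close>

text \<open>
  A polynomial over \<open>\<complex>\<close> in the variables \<open>X\<^sub>i\<^sub>j\<close> is an element of
  \<open>((nat \<times> nat) \<Rightarrow>\<^sub>0 nat) \<Rightarrow>\<^sub>0 complex\<close>: a finitely supported family of coefficients
  indexed by exponent vectors.
\<close>

definition mat_poly_eval :: "(((nat \<times> nat) \<Rightarrow>\<^sub>0 nat) \<Rightarrow>\<^sub>0 complex) \<Rightarrow> complex mat \<Rightarrow> complex" where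
  "mat_poly_eval P A =
    (\<Sum>m\<in>Poly_Mapping.keys P. Poly_Mapping.lookup P m *
      (\<Prod>ij\<in>Poly_Mapping.keys m. (A $$ ij) ^ Poly_Mapping.lookup m ij))"

definition mat_polys :: "nat \<Rightarrow> (((nat \<times> nat) \<Rightarrow>\<^sub>0 nat) \<Rightarrow>\<^sub>0 complex) set" where
  "mat_polys p = {P. \<forall>m\<in>Poly_Mapping.keys P. Poly_Mapping.keys m \<subseteq> {..<p} \<times> {..<p}}"

definition zariski_closed_GL :: "nat \<Rightarrow> complex mat set \<Rightarrow> bool" where
  "zariski_closed_GL p S \<longleftrightarrow> (\<exists>I\<subseteq>mat_polys p.
    S = {A \<in> carrier_mat p p. invertible_mat A \<and> (\<forall>P\<in>I. mat_poly_eval P A = 0)})"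

text \<open>The image of \<open>N\<close> in \<open>GL\<^sub>p(\<complex>)\<close> under \<open>\<sigma> \<mapsto> U\<^sup>-\<^sup>1 \<sigma>(U)\<close>.\<close>

definition galois_image ::
    "complex set \<Rightarrow> nat \<Rightarrow> (complex \<Rightarrow> complex) set \<Rightarrow> (complex \<Rightarrow> complex) mat \<Rightarrow>
     ((complex \<Rightarrow> complex) \<Rightarrow> complex \<Rightarrow> complex) set \<Rightarrow> complex mat set" where
  "galois_image D p K U N = (let M = mat_monoid (mero_field D\<lparr>carrier := K\<rparr>) p in
    {A \<in> carrier_mat p p. \<exists>\<sigma>\<in>N. map_mat (mero_const D) A = inv\<^bsub>M\<^esub> U \<otimes>\<^bsub>M\<^esub> map_mat \<sigma> U})"

definition algebraic_subgroup ::
    "complex set \<Rightarrow> nat \<Rightarrow> (complex \<Rightarrow> complex) set \<Rightarrow> (complex \<Rightarrow> complex) mat \<Rightarrow>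
     ((complex \<Rightarrow> complex) \<Rightarrow> complex \<Rightarrow> complex) set \<Rightarrow> bool" where
  "algebraic_subgroup D p K U N \<longleftrightarrow>
    subgroup N (diff_galois_group D K) \<and> zariski_closed_GL p (galois_image D p K U N)"

end

theory Submission
  imports Defs "HOL-Library.Function_Algebras" "HOL-Computational_Algebra.Fundamental_Theorem_Algebra"
begin

text \<open>Let \<open>L\<close> be the compositum of \<open>K\<^sub>f\<close> and the \<open>K\<^sub>i = K\<^bsub>f\<^sub>i\<^esub>\<close>, realised inside the Laurent series at a point of
  \<open>D\<close>. Restriction to \<open>K\<^sub>f\<close> maps the differential automorphisms of \<open>L\<close> over \<open>\<complex>(x)\<close> to a subgroup \<open>H\<close> of \<open>G\<^sub>f\<close>
  with fixed field \<open>\<complex>(x)\<close>, which is therefore Zariski dense. Let \<open>T\<^sub>i\<close> and \<open>S\<^sub>i\<close> be the images in \<open>G\<^sub>f\<close> of the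
  automorphisms that fix \<open>K\<^sub>i\<close>, respectively \<open>K\<^sub>1, \<dots>, K\<^sub>i\<close>. Elements of \<open>S\<^sub>k\<close> fix the whole orbit of \<open>f\<close>, so \<open>S\<^sub>k\<close>
  lies in a proper closed normal subgroup and is trivial. As \<open>S\<^sub>0 = H\<close> is not trivial, there is a last
  nontrivial \<open>S\<^sub>i\<^sub>-\<^sub>1\<close>. The commutators of \<open>S\<^sub>i\<^sub>-\<^sub>1\<close> and \<open>T\<^sub>i\<close> lie in \<open>S\<^sub>i\<close> and vanish. Centralizers of normal sets are
  closed and normal, so a nontrivial \<open>T\<^sub>i\<close> would make \<open>G\<^sub>f\<close> commutative. Hence \<open>T\<^sub>i\<close> is trivial, that is, all
  automorphisms of \<open>L\<close> over \<open>K\<^sub>i\<close> fix \<open>K\<^sub>f\<close>, and \<open>K\<^sub>f \<subseteq> K\<^sub>i\<close> because every element of \<open>L\<close> outside \<open>K\<^sub>i\<close> is moved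
  by some automorphism over \<open>K\<^sub>i\<close>.

  Such an automorphism is a specialization of the relations between the entries of a fundamental matrix, that
  is, a constant point of a differential ideal with coefficients in the field of Laurent series, and such
  points exist because \<open>\<complex>\<close> is uncountable and algebraically closed.\<close>

section \<open>Polynomial functions\<close>

text \<open>The images \<open>H\<close>, \<open>S i\<close> and \<open>T i\<close> are not known to
  be Zariski closed, and no closure is formed. Simplicity is applied only to fixers of stable sets
  and to centralizers of normal sets. A statement about \<open>H\<close> reaches the whole group
  when it can be written as the vanishing of a sum of terms k * g(r); such sums are controlled by
  the fixed field of \<open>H\<close> alone (\<open>artin_relation\<close>). A second obstacle is
  that a point over the complex numbers is wanted, while the relations have coefficients in a large
  field. With X = U Y the coordinates Y are constants, so the derivation acts on coefficients only
  and the relations span a differential ideal over the whole Laurent field. That z = P(U)/Q(U)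
  outside E can be moved then means that P - z Q is not nilpotent modulo this ideal. It comes down
  to z \<otimes> 1 - 1 \<otimes> z not being nilpotent over E; the tensor product is never built, an
  E-linear functional on the second factor takes its place.\<close>

lemma sum_fun_apply: "(\<Sum>m\<in>K. f m) x = (\<Sum>m\<in>K. f m x)"
  by (induction K rule: infinite_finite_induct) simp_all

text \<open>Stated for an indexed family: in the applications the vectors \<open>v i\<close> are not
  known to be distinct, and a repetition is itself a relation.\<close>

lemma (in vector_space) nontrivial_relation_in_span:
  assumes "finite T" "finite I" "card T < card I" and v: "\<And>i. i \<in> I \<Longrightarrow> v i \<in> span T"
  shows "\<exists>\<mu>. (\<exists>i\<in>I. \<mu> i \<noteq> 0) \<and> (\<Sum>i\<in>I. scale (\<mu> i) (v i)) = 0"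
proof (cases "inj_on v I")
  case True
  have "dependent (v ` I)"
  proof (rule ccontr)
    assume "\<not> dependent (v ` I)"
    then have "card (v ` I) \<le> card T"
      using independent_span_bound[of T "v ` I"] assms by auto
    then show False using True assms by (simp add: card_image)
  qed
  then obtain u where u: "\<exists>x\<in>v ` I. u x \<noteq> 0" "(\<Sum>x\<in>v ` I. scale (u x) x) = 0"
    using dependent_finite[of "v ` I"] assms(2) by auto
  show ?thesis
    by (rule exI[of _ "u \<circ> v"]) (use u True in \<open>auto simp: sum.reindex\<close>)
next
  case False
  then obtain i j where ij: "i \<in> I" "j \<in> I" "i \<noteq> j" "v i = v j"
    by (auto simp: inj_on_def)
  let ?\<mu> = "\<lambda>k. if k = i then 1 else if k = j then -1 else 0"
  have "(\<Sum>k\<in>I. scale (?\<mu> k) (v k)) = (\<Sum>k\<in>{i,j}. scale (?\<mu> k) (v k))"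
    by (rule sum.mono_neutral_right) (use assms ij in auto)
  also have "\<dots> = 0" using ij by simp
  finally show ?thesis using ij by (intro exI[of _ ?\<mu>]) auto
qed

text \<open>Polynomials are encoded as functions, so that substitution is composition. Over infinite
  fields nothing is lost (\<open>poly_funs_eq_0_if_grid\<close>). The coordinate functions
  \<open>y\<close> are a parameter because points over the field (\<open>polys\<close>) and points
  over the constants (\<open>const_polys\<close>) both occur.\<close>

inductive_set poly_funs :: "'a::comm_ring_1 set \<Rightarrow> 'v set \<Rightarrow> ('v \<Rightarrow> 'x \<Rightarrow> 'a) \<Rightarrow> ('x \<Rightarrow> 'a) set"
  for S J y where
  const: "s \<in> S \<Longrightarrow> (\<lambda>_. s) \<in> poly_funs S J y"
| var: "v \<in> J \<Longrightarrow> y v \<in> poly_funs S J y"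
| add: "f \<in> poly_funs S J y \<Longrightarrow> h \<in> poly_funs S J y \<Longrightarrow> (\<lambda>t. f t + h t) \<in> poly_funs S J y"
| mult: "f \<in> poly_funs S J y \<Longrightarrow> h \<in> poly_funs S J y \<Longrightarrow> (\<lambda>t. f t * h t) \<in> poly_funs S J y"

lemma poly_funs_mono: "f \<in> poly_funs S J y \<Longrightarrow> S \<subseteq> S' \<Longrightarrow> f \<in> poly_funs S' J y"
  by (induction rule: poly_funs.induct) (auto intro: poly_funs.intros)

lemma poly_funs_sum:
  assumes "0 \<in> S" "\<And>i. i \<in> I \<Longrightarrow> f i \<in> poly_funs S J y"
  shows "(\<lambda>t. \<Sum>i\<in>I. f i t) \<in> poly_funs S J y"
proof (cases "finite I")
  case True
  then show ?thesis using assms(2)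
    by (induction I) (auto intro: poly_funs.add poly_funs.const assms(1))
qed (auto intro: poly_funs.const assms(1))

lemma poly_funs_power:
  assumes "1 \<in> S" "f \<in> poly_funs S J y"
  shows "(\<lambda>t. f t ^ n) \<in> poly_funs S J y"
  by (induction n) (auto intro: poly_funs.intros assms)

lemma poly_funs_compose:
  assumes "f \<in> poly_funs S J y" "\<And>v. v \<in> J \<Longrightarrow> (\<lambda>s. y v (\<phi> s)) \<in> poly_funs S' J' y'" "S \<subseteq> S'"
  shows "(\<lambda>s. f (\<phi> s)) \<in> poly_funs S' J' y'"
  using assms(1) by (induction rule: poly_funs.induct) (use assms(2,3) in \<open>auto intro: poly_funs.intros\<close>)

lemma poly_funs_in:
  assumes "f \<in> poly_funs S J y" "\<And>v. v \<in> J \<Longrightarrow> y v t \<in> S"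
    "\<And>a b. a \<in> S \<Longrightarrow> b \<in> S \<Longrightarrow> a + b \<in> S" "\<And>a b. a \<in> S \<Longrightarrow> b \<in> S \<Longrightarrow> a * b \<in> S"
  shows "f t \<in> S"
  using assms(1) by (induction rule: poly_funs.induct) (use assms in auto)

lemma poly_funs_cong:
  assumes "f \<in> poly_funs S J y" "\<And>v. v \<in> J \<Longrightarrow> y v s = y v t"
  shows "f s = f t"
  using assms by (induction rule: poly_funs.induct) auto

section \<open>Spaces of polynomial functions of bounded degree\<close>

interpretation pw: vector_space "\<lambda>(a::'a::field) (f::'x \<Rightarrow> 'a) t. a * f t"
  by unfold_locales (auto simp: algebra_simps fun_eq_iff)

text \<open>Words in the coordinates take the place of exponent vectors, and the length bound keeps
  the set finite. The span is the space of polynomial functions of degree at most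
  \<open>d\<close>.\<close>

definition monoms :: "'v set \<Rightarrow> ('v \<Rightarrow> 'x \<Rightarrow> 'a::field) \<Rightarrow> nat \<Rightarrow> ('x \<Rightarrow> 'a) set" where
  "monoms J y d = (\<lambda>l t. prod_list (map (\<lambda>v. y v t) l)) ` {l. set l \<subseteq> J \<and> length l \<le> d}"

lemma finite_monoms: "finite J \<Longrightarrow> finite (monoms J y d)"
  unfolding monoms_def by (intro finite_imageI finite_lists_length_le)

lemma monoms_mono: "d \<le> e \<Longrightarrow> monoms J y d \<subseteq> monoms J y e"
  unfolding monoms_def by fastforce

lemma monoms_mult:
  "f \<in> monoms J y d \<Longrightarrow> h \<in> monoms J y e \<Longrightarrow> (\<lambda>t. f t * h t) \<in> monoms J y (d + e)"
  unfolding monoms_def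
proof clarsimp
  fix l m
  assume "set l \<subseteq> J" "length l \<le> d" "set m \<subseteq> J" "length m \<le> e"
  then show "(\<lambda>t. prod_list (map (\<lambda>v. y v t) l) * prod_list (map (\<lambda>v. y v t) m))
      \<in> (\<lambda>l t. prod_list (map (\<lambda>v. y v t) l)) ` {l. set l \<subseteq> J \<and> length l \<le> d + e}"
    by (intro image_eqI[of _ _ "l @ m"]) auto
qed

lemma span_monoms_mult:
  assumes f: "f \<in> pw.span (monoms J y d)" and h: "h \<in> pw.span (monoms J y e)"
  shows "(\<lambda>t. f t * h t) \<in> pw.span (monoms J y (d + e))"
proof -
  have 1: "(\<lambda>t. f t * h t) \<in> pw.span (monoms J y (d + e))" if f: "f \<in> monoms J y d" for f
    using h
  proof (induction h rule: pw.span_induct_alt)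
    case base
    then show ?case using pw.span_zero[of "monoms J y (d+e)"] by (simp add: zero_fun_def)
  next
    case (step c x z)
    have "(\<lambda>t. c * (f t * x t)) + (\<lambda>t. f t * z t) \<in> pw.span (monoms J y (d + e))"
      using step monoms_mult[OF f] by (intro pw.span_add pw.span_scale) (auto intro: pw.span_base)
    then show ?case by (simp add: plus_fun_def algebra_simps)
  qed
  show ?thesis using f
  proof (induction f rule: pw.span_induct_alt)
    case base
    then show ?case using pw.span_zero[of "monoms J y (d+e)"] by (simp add: zero_fun_def)
  next
    case (step c x z)
    have "(\<lambda>t. c * (x t * h t)) + (\<lambda>t. z t * h t) \<in> pw.span (monoms J y (d + e))"
      using step 1 by (intro pw.span_add pw.span_scale) auto
    then show ?case by (simp add: plus_fun_def algebra_simps)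
  qed
qed

lemma poly_funs_in_span_monoms:
  assumes "f \<in> poly_funs S J y"
  obtains d where "f \<in> pw.span (monoms J y d)"
proof -
  have "\<exists>d. f \<in> pw.span (monoms J y d)" using assms
  proof (induction rule: poly_funs.induct)
    case (const s)
    have "(\<lambda>_. 1) \<in> monoms J y 0" by (auto simp: monoms_def)
    from pw.span_scale[OF pw.span_base[OF this], of s] show ?case by auto
  next
    case (var v)
    then have "y v \<in> monoms J y 1" unfolding monoms_def by (intro image_eqI[of _ _ "[v]"]) auto
    then show ?case using pw.span_base by blast
  next
    case (add f h)
    then obtain d e where "f \<in> pw.span (monoms J y d)" "h \<in> pw.span (monoms J y e)" by auto
    then have "f + h \<in> pw.span (monoms J y (max d e))"
      using pw.span_mono[OF monoms_mono[of d "max d e" J y]] pw.span_mono[OF monoms_mono[of e "max d e" J y]]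
      by (intro pw.span_add) auto
    then show ?case by (auto simp: plus_fun_def)
  next
    case (mult f h)
    then show ?case using span_monoms_mult by blast
  qed
  then show ?thesis using that by blast
qed

lemma monoms_subset_poly_funs: "1 \<in> S \<Longrightarrow> monoms J y d \<subseteq> poly_funs S J y"
proof -
  assume 1: "1 \<in> S"
  have "(\<lambda>t. prod_list (map (\<lambda>v. y v t) l)) \<in> poly_funs S J y" if "set l \<subseteq> J" for l
    using that by (induction l) (auto intro: poly_funs.intros 1)
  then show ?thesis by (auto simp: monoms_def)
qed

lemma span_subset_poly_funs:
  assumes "f \<in> pw.span A" "A \<subseteq> poly_funs UNIV J y"
  shows "f \<in> poly_funs UNIV J y"
  using assms(1)
proof (induction f rule: pw.span_induct_alt)
  case base
  then show ?case using poly_funs.const[of 0 UNIV J y] by (simp add: zero_fun_def)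
next
  case (step c x z)
  then show ?case using assms(2) by (auto simp: plus_fun_def intro!: poly_funs.intros)
qed

text \<open>The coordinates are released from \<open>S\<close> one at a time: along one coordinate
  \<open>f\<close> is a univariate polynomial with infinitely many roots. It carries identities from
  constant points, or points over a subfield, to arbitrary points.\<close>

lemma poly_funs_eq_0_if_grid:
  fixes f :: "('v \<Rightarrow> 'a::field_char_0) \<Rightarrow> 'a"
  assumes f: "f \<in> poly_funs UNIV J (\<lambda>v x. x v)" and "finite J" "infinite S"
    and 0: "\<And>x. (\<And>v. v \<in> J \<Longrightarrow> x v \<in> S) \<Longrightarrow> f x = 0"
  shows "f x = 0"
proof -
  have uni: "\<exists>p. \<forall>t. f (x(v := t)) = poly p t" for v x
    using f
  proof (induction rule: poly_funs.induct)
    case (const s)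
    then show ?case by (intro exI[of _ "[:s:]"]) auto
  next
    case (var w)
    then show ?case
      by (cases "w = v") (auto intro: exI[of _ "[:0,1:]"] exI[of _ "[:x w:]"])
  next
    case (add f h)
    then show ?case by (metis poly_add)
  next
    case (mult f h)
    then show ?case by (metis poly_mult)
  qed
  \<comment> \<open>\<open>K\<close> collects the coordinates already released.\<close>
  have "(\<forall>v\<in>J - K. x v \<in> S) \<longrightarrow> f x = 0" if "finite K" for K x
    using that
  proof (induction K arbitrary: x rule: finite_induct)
    case empty
    then show ?case using 0 by auto
  next
    case (insert w K)
    show ?case
    proof
      assume x: "\<forall>v\<in>J - insert w K. x v \<in> S"
      obtain p where p: "\<And>t. f (x(w := t)) = poly p t" using uni by metis
      have "poly p t = 0" if "t \<in> S" for t
        using insert.IH[of "x(w := t)"] x that p[of t] by (auto simp: fun_upd_def)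
      then have "S \<subseteq> {t. poly p t = 0}" by auto
      then have "p = 0" using \<open>infinite S\<close> poly_roots_finite[of p] finite_subset by blast
      then show "f x = 0" using p[of "x w"] by simp
    qed
  qed
  from this[OF \<open>finite J\<close>] show ?thesis by auto
qed

section \<open>Constant points of differential ideals\<close>

text \<open>\<open>D_eq_0_iff\<close> makes the constants of the ambient field exactly the complex
  numbers; this is why two fundamental matrices of one system differ by a complex matrix.\<close>

locale diff_field =
  fixes D :: "'a::field_char_0 \<Rightarrow> 'a" and cst :: "complex \<Rightarrow> 'a"
  assumes D_add: "D (x + y) = D x + D y"
    and D_mult: "D (x * y) = D x * y + x * D y"
    and cst_add: "cst (a + b) = cst a + cst b"
    and cst_mult: "cst (a * b) = cst a * cst b"
    and cst_1: "cst 1 = 1"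
    and D_eq_0_iff: "D x = 0 \<longleftrightarrow> x \<in> range cst"
begin

lemma D_0 [simp]: "D 0 = 0"
  using D_add[of 0 0] by simp

lemma D_minus: "D (- x) = - D x"
  using D_add[of x "- x"] by (simp add: eq_neg_iff_add_eq_0 add.commute)

lemma D_diff: "D (x - y) = D x - D y"
  using D_add[of x "- y"] by (simp add: D_minus)

lemma D_sum: "D (sum f A) = (\<Sum>i\<in>A. D (f i))"
  by (induction A rule: infinite_finite_induct) (auto simp: D_add)

lemma D_cst [simp]: "D (cst c) = 0"
  by (simp add: D_eq_0_iff)

lemma D_1 [simp]: "D 1 = 0"
  using D_cst[of 1] by (simp add: cst_1)

lemma cst_0 [simp]: "cst 0 = 0"
  using cst_add[of 0 0] by simp

lemma cst_minus: "cst (- a) = - cst a"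
  using cst_add[of a "- a"] by (simp add: eq_neg_iff_add_eq_0 add.commute)

lemma cst_diff: "cst (a - b) = cst a - cst b"
  using cst_add[of a "- b"] by (simp add: cst_minus)

lemma cst_sum: "cst (sum f A) = (\<Sum>i\<in>A. cst (f i))"
  by (induction A rule: infinite_finite_induct) (auto simp: cst_add)

lemma cst_eq_0_iff [simp]: "cst a = 0 \<longleftrightarrow> a = 0"
proof
  assume "cst a = 0"
  then have "cst (a * inverse a) = 0" by (simp add: cst_mult)
  then show "a = 0" by (cases "a = 0") (auto simp: cst_1)
qed simp

lemma inj_cst: "inj cst"
  by (rule injI) (metis cst_diff cst_eq_0_iff eq_iff_diff_eq_0)

lemma cst_eq_iff [simp]: "cst a = cst b \<longleftrightarrow> a = b"
  using inj_cst by (auto simp: inj_def)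

lemma infinite_range_cst: "infinite (range cst)"
  using inj_cst finite_imageD infinite_UNIV_char_0 by blast

lemma D_power: "D (x ^ Suc n) = of_nat (Suc n) * x ^ n * D x"
proof (induction n)
  case (Suc n)
  have "D (x ^ Suc (Suc n)) = D x * x ^ Suc n + x * D (x ^ Suc n)"
    by (subst power_Suc) (simp only: D_mult)
  then show ?case unfolding Suc by (simp add: algebra_simps)
qed simp

lemma D_poly: "D (poly p x) = poly (map_poly D p) x + poly (pderiv p) x * D x"
  by (induction p) (auto simp: map_poly_pCons pderiv_pCons D_add D_mult algebra_simps)

lemma D_divide: "y \<noteq> 0 \<Longrightarrow> D (x / y) = (D x * y - x * D y) / y\<^sup>2"
proof -
  assume "y \<noteq> 0"
  then have "D x = D (x / y) * y + x / y * D y" using D_mult[of "x / y" y] by simp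
  then show ?thesis using \<open>y \<noteq> 0\<close> by (simp add: field_simps power2_eq_square)
qed

text \<open>The points \<open>Y\<close> consist of constants, so differentiating the values of such
  a function differentiates its coefficients only.\<close>

abbreviation const_polys :: "'v set \<Rightarrow> (('v \<Rightarrow> complex) \<Rightarrow> 'a) set" where
  "const_polys J \<equiv> poly_funs UNIV J (\<lambda>v Y. cst (Y v))"

lemma D_const_polys: "f \<in> const_polys J \<Longrightarrow> (\<lambda>t. D (f t)) \<in> const_polys J"
  by (induction rule: poly_funs.induct)
     (auto simp: D_add D_mult intro!: poly_funs.add poly_funs.mult intro: poly_funs.const)

definition diff_ideal :: "'v set \<Rightarrow> (('v \<Rightarrow> complex) \<Rightarrow> 'a) set \<Rightarrow> bool" where
  "diff_ideal J I \<longleftrightarrow> I \<subseteq> const_polys J \<and> (\<lambda>_. 0) \<in> I \<and>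
     (\<forall>f\<in>I. \<forall>h\<in>I. (\<lambda>t. f t + h t) \<in> I) \<and>
     (\<forall>r\<in>const_polys J. \<forall>f\<in>I. (\<lambda>t. r t * f t) \<in> I) \<and>
     (\<forall>f\<in>I. (\<lambda>t. D (f t)) \<in> I)"

lemma diff_idealD:
  assumes "diff_ideal J I"
  shows "f \<in> I \<Longrightarrow> f \<in> const_polys J" "(\<lambda>_. 0) \<in> I"
    "f \<in> I \<Longrightarrow> h \<in> I \<Longrightarrow> (\<lambda>t. f t + h t) \<in> I"
    "r \<in> const_polys J \<Longrightarrow> f \<in> I \<Longrightarrow> (\<lambda>t. r t * f t) \<in> I"
    "f \<in> I \<Longrightarrow> (\<lambda>t. D (f t)) \<in> I"
  using assms by (auto simp: diff_ideal_def)

end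

text \<open>After inverting \<open>g\<close> this is a maximal differential ideal. The exponent 0 in
  \<open>avoid\<close> makes \<open>M\<close> proper. The aim is \<open>point\<close>: a common zero
  of \<open>M\<close> over the constants at which \<open>g\<close> does not vanish.\<close>

locale max_diff_ideal = diff_field D cst
  for D :: "'a::field_char_0 \<Rightarrow> 'a" and cst :: "complex \<Rightarrow> 'a" +
  fixes J :: "'v set" and M :: "(('v \<Rightarrow> complex) \<Rightarrow> 'a) set" and g :: "('v \<Rightarrow> complex) \<Rightarrow> 'a"
  assumes finite_J: "finite J"
    and M: "diff_ideal J M"
    and g: "g \<in> const_polys J"
    and avoid: "\<And>n. (\<lambda>t. g t ^ n) \<notin> M"
    and maximal: "\<And>I. diff_ideal J I \<Longrightarrow> M \<subseteq> I \<Longrightarrow> (\<And>n. (\<lambda>t. g t ^ n) \<notin> I) \<Longrightarrow> I = M"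
begin

lemmas MD = diff_idealD[OF M]

lemma M_diff: "f \<in> M \<Longrightarrow> h \<in> M \<Longrightarrow> (\<lambda>t. f t - h t) \<in> M"
  using MD(3)[of f "\<lambda>t. -1 * h t"] MD(4)[of "\<lambda>_. -1" h, OF poly_funs.const] by simp

lemma M_sum: "(\<And>i. i \<in> A \<Longrightarrow> f i \<in> M) \<Longrightarrow> (\<lambda>t. \<Sum>i\<in>A. f i t) \<in> M"
  by (induction A rule: infinite_finite_induct) (auto intro: MD)

lemma g_power: "(\<lambda>t. g t ^ n) \<in> const_polys J"
  by (rule poly_funs_power) (auto intro: g)

text \<open>The elements that some power of \<open>g\<close> multiplies into \<open>M\<close> form a
  differential ideal, still without powers of \<open>g\<close>, so maximality identifies it with
  \<open>M\<close>.\<close>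

lemma saturated:
  assumes a: "a \<in> const_polys J" and n: "(\<lambda>t. g t ^ n * a t) \<in> M"
  shows "a \<in> M"
proof -
  let ?I = "{a \<in> const_polys J. \<exists>n. (\<lambda>t. g t ^ n * a t) \<in> M}"
  have "?I = M"
  proof (rule maximal)
    show "diff_ideal J ?I"
      unfolding diff_ideal_def
    proof (intro conjI ballI)
      show "(\<lambda>_. 0) \<in> ?I" using MD(2) by (auto intro: poly_funs.const)
    next
      fix f h assume "f \<in> ?I" "h \<in> ?I"
      then obtain m n where f: "f \<in> const_polys J" "(\<lambda>t. g t ^ m * f t) \<in> M"
        and h: "h \<in> const_polys J" "(\<lambda>t. g t ^ n * h t) \<in> M" by auto
      have "(\<lambda>t. g t ^ n * (g t ^ m * f t) + g t ^ m * (g t ^ n * h t)) \<in> M"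
        by (intro MD g_power f h)
      then have "(\<lambda>t. g t ^ (m + n) * (f t + h t)) \<in> M"
        by (simp add: algebra_simps power_add)
      then show "(\<lambda>t. f t + h t) \<in> ?I" using f h by (auto intro: poly_funs.add)
    next
      fix r f assume r: "r \<in> const_polys J" and "f \<in> ?I"
      then obtain m where f: "f \<in> const_polys J" "(\<lambda>t. g t ^ m * f t) \<in> M" by auto
      have "(\<lambda>t. r t * (g t ^ m * f t)) \<in> M" by (intro MD f r)
      then have "(\<lambda>t. g t ^ m * (r t * f t)) \<in> M" by (simp add: algebra_simps)
      then show "(\<lambda>t. r t * f t) \<in> ?I" using f r by (auto intro: poly_funs.mult)
    next
      fix f assume "f \<in> ?I"
      then obtain m where f: "f \<in> const_polys J" "(\<lambda>t. g t ^ m * f t) \<in> M" by auto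
      \<comment> \<open>The extra factor \<open>g\<close> makes up for the drop of the exponent in
        \<open>D (g ^ m)\<close>: the term \<open>g * D (g ^ m) * f\<close> is then a multiple of
        \<open>g ^ m * f\<close> and can be subtracted.\<close>
      have "(\<lambda>t. g t ^ 1 * D (g t ^ m * f t)) \<in> M" by (intro MD f g_power)
      moreover have "(\<lambda>t. D (g t ^ m) * (g t ^ 1 * f t)) \<in> M"
      proof (cases m)
        case 0
        then show ?thesis using MD(2) by simp
      next
        case (Suc k)
        have "(\<lambda>t. of_nat (Suc k) * D (g t)) \<in> const_polys J"
          by (intro poly_funs.mult poly_funs.const D_const_polys g) auto
        from MD(4)[OF this f(2)] show ?thesis
          unfolding Suc D_power by (simp add: algebra_simps)
      qed
      ultimately have "(\<lambda>t. g t ^ 1 * D (g t ^ m * f t) - D (g t ^ m) * (g t ^ 1 * f t)) \<in> M"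
        by (rule M_diff)
      then have "(\<lambda>t. g t ^ (Suc m) * D (f t)) \<in> M"
        by (simp add: D_mult algebra_simps)
      then show "(\<lambda>t. D (f t)) \<in> ?I" using f by (blast intro: D_const_polys)
    qed auto
    show "M \<subseteq> ?I" using MD(1) by (auto intro: exI[of _ 0])
    show "(\<lambda>t. g t ^ k) \<notin> ?I" for k
      using avoid by (auto simp flip: power_add)
  qed
  then show ?thesis using a n by auto
qed

text \<open>Because \<open>h\<close> is constant, \<open>M\<close> and \<open>h\<close> together
  generate a differential ideal. It is larger than \<open>M\<close>, so it contains a power of
  \<open>g\<close>: once \<open>g\<close> is inverted, \<open>h\<close> is invertible modulo
  \<open>M\<close>.\<close>

lemma unit_mod_constant:
  assumes h: "h \<in> const_polys J" "\<And>t. D (h t) = 0" and "h \<notin> M"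
  obtains n b where "b \<in> const_polys J" "(\<lambda>t. g t ^ n - h t * b t) \<in> M"
proof -
  let ?I = "{f \<in> const_polys J. \<exists>b\<in>const_polys J. (\<lambda>t. f t - h t * b t) \<in> M}"
  have "diff_ideal J ?I"
    unfolding diff_ideal_def
  proof (intro conjI ballI)
    show "(\<lambda>_. 0) \<in> ?I" using MD(2) poly_funs.const[of 0 UNIV J "\<lambda>v Y. cst (Y v)"]
      by (auto intro!: bexI[of _ "\<lambda>_. 0"])
  next
    fix f k assume "f \<in> ?I" "k \<in> ?I"
    then obtain b c where f: "f \<in> const_polys J" "b \<in> const_polys J" "(\<lambda>t. f t - h t * b t) \<in> M"
      and k: "k \<in> const_polys J" "c \<in> const_polys J" "(\<lambda>t. k t - h t * c t) \<in> M" by auto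
    have "(\<lambda>t. (f t - h t * b t) + (k t - h t * c t)) \<in> M" by (intro MD f k)
    then have "(\<lambda>t. (f t + k t) - h t * (b t + c t)) \<in> M" by (simp add: algebra_simps)
    moreover have "(\<lambda>t. b t + c t) \<in> const_polys J" "(\<lambda>t. f t + k t) \<in> const_polys J"
      using f k by (auto intro: poly_funs.add)
    ultimately show "(\<lambda>t. f t + k t) \<in> ?I" by (intro CollectI conjI bexI)
  next
    fix r f assume r: "r \<in> const_polys J" and "f \<in> ?I"
    then obtain b where f: "f \<in> const_polys J" "b \<in> const_polys J" "(\<lambda>t. f t - h t * b t) \<in> M"
      by auto
    have "(\<lambda>t. r t * (f t - h t * b t)) \<in> M" by (intro MD f r)
    then have "(\<lambda>t. r t * f t - h t * (r t * b t)) \<in> M" by (simp add: algebra_simps)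
    moreover have "(\<lambda>t. r t * b t) \<in> const_polys J" "(\<lambda>t. r t * f t) \<in> const_polys J"
      using f r by (auto intro: poly_funs.mult)
    ultimately show "(\<lambda>t. r t * f t) \<in> ?I" by (intro CollectI conjI bexI)
  next
    fix f assume "f \<in> ?I"
    then obtain b where f: "f \<in> const_polys J" "b \<in> const_polys J" "(\<lambda>t. f t - h t * b t) \<in> M"
      by auto
    have "(\<lambda>t. D (f t) - h t * D (b t)) \<in> M"
      using MD(5)[OF f(3)] by (simp add: D_diff D_mult h)
    then show "(\<lambda>t. D (f t)) \<in> ?I" using f
      by (intro CollectI conjI bexI[of _ "\<lambda>t. D (b t)"]) (auto intro: D_const_polys)
  qed auto
  moreover have "M \<subseteq> ?I" using MD(1) poly_funs.const[of 0 UNIV J "\<lambda>v Y. cst (Y v)"]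
    by (auto intro!: bexI[of _ "\<lambda>_. 0"])
  moreover have "h \<in> ?I" using h MD(2) poly_funs.const[of 1 UNIV J "\<lambda>v Y. cst (Y v)"]
    by (auto intro!: bexI[of _ "\<lambda>_. 1"])
  ultimately have ideal: "diff_ideal J ?I" and sub: "M \<subseteq> ?I" and hI: "h \<in> ?I" by blast+
  have "\<exists>n. (\<lambda>t. g t ^ n) \<in> ?I"
  proof (rule ccontr)
    assume "\<not> ?thesis"
    then have "?I = M" by (intro maximal ideal sub) blast
    then show False using hI \<open>h \<notin> M\<close> by (simp only:)
  qed
  then obtain n b where "b \<in> const_polys J" "(\<lambda>t. g t ^ n - h t * b t) \<in> M" by auto
  then show ?thesis by (rule that)
qed

text \<open>The inverse of \<open>h\<close> modulo \<open>M\<close>, up to a power of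
  \<open>g\<close>, cancels \<open>h\<close>; saturation removes the power.\<close>

lemma annihilator_at_constant:
  assumes h: "h \<in> const_polys J" "\<And>t. D (h t) = 0" "h \<notin> M"
    and a: "a \<in> const_polys J" "(\<lambda>t. h t * a t) \<in> M"
  shows "a \<in> M"
proof -
  obtain n b where b: "b \<in> const_polys J" "(\<lambda>t. g t ^ n - h t * b t) \<in> M"
    using unit_mod_constant h by blast
  have "(\<lambda>t. a t * (g t ^ n - h t * b t) + b t * (h t * a t)) \<in> M" by (intro MD a b)
  then have "(\<lambda>t. g t ^ n * a t) \<in> M" by (simp add: algebra_simps)
  then show ?thesis using saturated a by blast
qed

lemma poly_at_var: "v \<in> J \<Longrightarrow> (\<lambda>t. poly p (cst (t v))) \<in> const_polys J"
  by (induction p) (auto intro!: poly_funs.add poly_funs.mult poly_funs.const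
     intro: poly_funs.var[of v J "\<lambda>v Y. cst (Y v)"])

text \<open>This is where the uncountability of \<open>\<complex>\<close> enters: if no \<open>y - \<lambda>\<close> lies in \<open>M\<close>, then
  modulo \<open>M\<close> every \<open>y - \<lambda>\<close> divides a power of \<open>g\<close>, and the uncountably many quotients live in
  a space of countable dimension.\<close>

lemma var_algebraic:
  assumes v: "v \<in> J" and no: "\<And>c. (\<lambda>t. cst (t v) - cst c) \<notin> M"
  shows "\<exists>p. p \<noteq> 0 \<and> (\<lambda>t. poly p (cst (t v))) \<in> M"
proof -
  have lin: "(\<lambda>t. cst (t v) - cst c) \<in> const_polys J" for c
    using poly_at_var[OF v, of "[:- cst c, 1:]"] by simp
  \<comment> \<open>Here \<open>b\<close> is a quotient of \<open>g ^ n\<close> by the coordinate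
    minus \<open>c\<close> modulo \<open>M\<close>; the exponent and a degree bound are recorded for
    the pigeonhole argument.\<close>
  define quot where "quot c n d b \<longleftrightarrow> b \<in> pw.span (monoms J (\<lambda>v Y. cst (Y v)) d) \<and>
    (\<lambda>t. g t ^ n - (cst (t v) - cst c) * b t) \<in> M" for c n d b
  have "\<exists>n d b. quot c n d b" for c
  proof -
    obtain n b where b: "b \<in> const_polys J" "(\<lambda>t. g t ^ n - (cst (t v) - cst c) * b t) \<in> M"
      by (rule unit_mod_constant[OF lin _ no, of c]) (auto simp: D_diff)
    obtain d where "b \<in> pw.span (monoms J (\<lambda>v Y. cst (Y v)) d)"
      using poly_funs_in_span_monoms[OF b(1)] by blast
    then show ?thesis unfolding quot_def using b by blast
  qed
  then obtain n d b where "\<And>c. quot c (n c) (d c) (b c)" by metis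
  then have b: "\<And>c. b c \<in> pw.span (monoms J (\<lambda>v Y. cst (Y v)) (d c))"
    "\<And>c. (\<lambda>t. g t ^ n c - (cst (t v) - cst c) * b c t) \<in> M"
    by (simp_all add: quot_def)
  \<comment> \<open>Only countably many pairs \<open>(n c, d c)\<close> are available for
    uncountably many \<open>c\<close>. On an infinite fibre all quotients lie in one
    finite-dimensional space.\<close>
  have "\<exists>N e. infinite {c. n c = N \<and> d c = e}"
  proof (rule ccontr)
    assume "\<not> ?thesis"
    then have "countable (\<Union>(N, e)\<in>UNIV. {c. n c = N \<and> d c = e})"
      by (intro countable_UN) (auto intro: countable_finite)
    moreover have "(\<Union>(N, e)\<in>UNIV. {c. n c = N \<and> d c = e}) = UNIV" by auto
    ultimately show False using uncountable_UNIV_complex by simp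
  qed
  then obtain N e where inf: "infinite {c. n c = N \<and> d c = e}" by blast
  let ?T = "monoms J (\<lambda>v Y. cst (Y v)) e"
  obtain C where C: "C \<subseteq> {c. n c = N \<and> d c = e}" "finite C" "card C = Suc (card ?T)"
    using infinite_arbitrarily_large[OF inf] by blast
  have "\<exists>\<mu>. (\<exists>c\<in>C. \<mu> c \<noteq> 0) \<and> (\<Sum>c\<in>C. (\<lambda>t. \<mu> c * b c t)) = 0"
  proof (rule pw.nontrivial_relation_in_span)
    show "b c \<in> pw.span ?T" if "c \<in> C" for c
      using b(1)[of c] C(1) that by auto
  qed (use C finite_monoms[OF finite_J] in auto)
  then obtain \<mu> where \<mu>: "\<exists>c\<in>C. \<mu> c \<noteq> 0" "(\<Sum>c\<in>C. (\<lambda>t. \<mu> c * b c t)) = 0" by blast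
  have rel: "(\<Sum>c\<in>C. \<mu> c * b c t) = 0" for t
  proof -
    from sum_fun_apply[of "\<lambda>c t. \<mu> c * b c t" C t] show ?thesis by (simp only: \<mu>(2)) simp
  qed
  \<comment> \<open>The numerator of the sum of the fractions \<open>\<mu> c / (y - c)\<close>, with
    y the coordinate. At \<open>cst c0\<close> only the summand of \<open>c0\<close> survives, so
    \<open>p\<close> is not zero.\<close>
  define p where "p = (\<Sum>c\<in>C. Polynomial.smult (\<mu> c) (\<Prod>c'\<in>C - {c}. [:- cst c', 1:]))"
  obtain c0 where c0: "c0 \<in> C" "\<mu> c0 \<noteq> 0" using \<mu>(1) by blast
  have "poly p (cst c0) = (\<Sum>c\<in>C. \<mu> c * (\<Prod>c'\<in>C - {c}. cst c0 - cst c'))"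
    by (simp add: p_def poly_sum poly_prod)
  also have "\<dots> = (\<Sum>c\<in>{c0}. \<mu> c * (\<Prod>c'\<in>C - {c}. cst c0 - cst c'))"
    by (rule sum.mono_neutral_right) (use C c0 in auto)
  also have "\<dots> \<noteq> 0" using C c0 by auto
  finally have "p \<noteq> 0" by auto
  \<comment> \<open>Modulo \<open>M\<close> the quotient \<open>b c\<close> is
    \<open>g ^ N / (y - c)\<close>. The relation between the \<open>b c\<close>, cleared of
    denominators, therefore puts \<open>g ^ N * p(y)\<close> into \<open>M\<close>.\<close>
  have eq: "(\<Sum>c\<in>C. (\<mu> c * (\<Prod>c'\<in>C - {c}. cst (t v) - cst c')) * (g t ^ N - (cst (t v) - cst c) * b c t))
      = g t ^ N * poly p (cst (t v))" for t
  proof -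
    have "(\<Sum>c\<in>C. (\<mu> c * (\<Prod>c'\<in>C - {c}. cst (t v) - cst c')) * ((cst (t v) - cst c) * b c t))
        = (\<Sum>c\<in>C. (\<Prod>c'\<in>C. cst (t v) - cst c') * (\<mu> c * b c t))"
    proof (rule sum.cong[OF refl])
      fix c assume "c \<in> C"
      then have "(\<Prod>c'\<in>C. cst (t v) - cst c') = (cst (t v) - cst c) * (\<Prod>c'\<in>C - {c}. cst (t v) - cst c')"
        using C by (intro prod.remove)
      then show "(\<mu> c * (\<Prod>c'\<in>C - {c}. cst (t v) - cst c')) * ((cst (t v) - cst c) * b c t)
        = (\<Prod>c'\<in>C. cst (t v) - cst c') * (\<mu> c * b c t)" by (simp only: mult_ac)
    qed
    also have "\<dots> = 0" by (simp only: sum_distrib_left[symmetric] rel mult_zero_right)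
    finally have 0: "(\<Sum>c\<in>C. (\<mu> c * (\<Prod>c'\<in>C - {c}. cst (t v) - cst c')) * ((cst (t v) - cst c) * b c t)) = 0" .
    have "(\<Sum>c\<in>C. (\<mu> c * (\<Prod>c'\<in>C - {c}. cst (t v) - cst c')) * g t ^ N) = g t ^ N * poly p (cst (t v))"
      by (simp add: p_def poly_sum poly_prod sum_distrib_left mult_ac)
    then show ?thesis
      by (simp only: right_diff_distrib sum_subtractf 0 diff_0_right)
  qed
  have "(\<lambda>t. \<Sum>c\<in>C. (\<mu> c * (\<Prod>c'\<in>C - {c}. cst (t v) - cst c')) * (g t ^ N - (cst (t v) - cst c) * b c t)) \<in> M"
  proof (intro M_sum MD(4))
    fix c assume "c \<in> C"
    show "(\<lambda>t. g t ^ N - (cst (t v) - cst c) * b c t) \<in> M"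
      using b(2)[of c] C \<open>c \<in> C\<close> by auto
    show "(\<lambda>t. \<mu> c * (\<Prod>c'\<in>C - {c}. cst (t v) - cst c')) \<in> const_polys J"
      using poly_at_var[OF v, of "Polynomial.smult (\<mu> c) (\<Prod>c'\<in>C - {c}. [:- cst c', 1:])"]
      by (simp add: poly_prod)
  qed
  then have "(\<lambda>t. g t ^ N * poly p (cst (t v))) \<in> M" unfolding eq .
  then show ?thesis using saturated[OF poly_at_var[OF v]] \<open>p \<noteq> 0\<close> by blast
qed

text \<open>Otherwise the coordinate has a monic minimal polynomial modulo \<open>M\<close>. Its
  derivative has lower degree, so its coefficients are constants and it has a complex root. The
  linear factor at the root is a constant outside \<open>M\<close> and can be cancelled, against
  minimality.\<close>

lemma var_constant:
  assumes v: "v \<in> J"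
  shows "\<exists>c. (\<lambda>t. cst (t v) - cst c) \<in> M"
proof (rule ccontr)
  assume no: "\<not> ?thesis"
  define Q where "Q p \<longleftrightarrow> p \<noteq> 0 \<and> (\<lambda>t. poly p (cst (t v))) \<in> M" for p
  have "\<exists>p. Q p" using var_algebraic[OF v] no by (auto simp: Q_def)
  then obtain p0 where p0: "Q p0" and min0: "\<And>q. Q q \<Longrightarrow> degree p0 \<le> degree q"
    using arg_min_nat_lemma[of Q _ degree] by metis
  define p where "p = Polynomial.smult (inverse (lead_coeff p0)) p0"
  have "p0 \<noteq> 0" using p0 by (auto simp: Q_def)
  then have deg: "degree p = degree p0" and monic: "lead_coeff p = 1" by (auto simp: p_def)
  have pQ: "Q p" using p0 \<open>p0 \<noteq> 0\<close> MD(4)[of "\<lambda>_. inverse (lead_coeff p0)" "\<lambda>t. poly p0 (cst (t v))"]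
    by (auto simp: Q_def p_def intro: poly_funs.const)
  have min: "degree p \<le> degree q" if "Q q" for q using min0[OF that] deg by simp
  \<comment> \<open>The coordinate is constant, so only the coefficients are differentiated; the
    leading coefficient 1 disappears.\<close>
  have "(\<lambda>t. poly (map_poly D p) (cst (t v))) \<in> M"
    using pQ MD(5)[of "\<lambda>t. poly p (cst (t v))"] by (simp add: Q_def D_poly)
  moreover have "degree (map_poly D p) < degree p \<or> map_poly D p = 0"
  proof (cases "degree p = 0")
    case True
    then obtain a where "p = [:a:]" using degree_eq_zeroE by blast
    with monic have "p = [:1:]" by simp
    then show ?thesis by (simp add: map_poly_pCons)
  next
    case False
    have "poly.coeff (map_poly D p) i = 0" if "i \<ge> degree p" for i
      using that monic by (cases "i = degree p") (auto simp: coeff_map_poly coeff_eq_0)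
    then show ?thesis using False
      by (metis leading_coeff_0_iff not_less)
  qed
  ultimately have "map_poly D p = 0" using min[of "map_poly D p"] by (force simp: Q_def)
  then have "D (poly.coeff p i) = 0" for i using coeff_map_poly[of D p i] by simp
  then have "\<exists>c. poly.coeff p i = cst c" for i by (auto simp: D_eq_0_iff)
  then obtain c where c: "\<And>i. poly.coeff p i = cst (c i)" by metis
  define q where "q = (\<Sum>i\<le>degree p. Polynomial.monom (c i) i)"
  have coeff_q: "poly.coeff q i = c i" for i
    using c[of i] by (auto simp: q_def coeff_sum Polynomial.coeff_monom coeff_eq_0)
  have p_q: "p = map_poly cst q" by (rule poly_eqI) (simp add: coeff_map_poly coeff_q c)
  have "degree q = degree p"
    unfolding p_q by (rule degree_map_poly[symmetric]) simp
  have "degree p \<noteq> 0"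
  proof
    assume "degree p = 0"
    then obtain a where "p = [:a:]" using degree_eq_zeroE by blast
    with monic have "p = 1" by (simp add: one_pCons)
    then show False using pQ avoid[of 0] by (simp add: Q_def)
  qed
  then obtain z where "poly q z = 0"
    using alg_closed_imp_poly_has_root[of q] \<open>degree q = degree p\<close> by auto
  then have "poly p (cst z) = 0"
  proof -
    have "poly (map_poly cst q) (cst z) = cst (poly q z)" for q
      by (induction q) (auto simp: map_poly_pCons cst_add cst_mult)
    then show ?thesis using \<open>poly q z = 0\<close> p_q by simp
  qed
  then obtain r where r: "p = [:- cst z, 1:] * r" unfolding poly_eq_0_iff_dvd dvd_def by blast
  have "r \<noteq> 0" using r pQ by (auto simp: Q_def)
  have "(\<lambda>t. (cst (t v) - cst z) * poly r (cst (t v))) \<in> M"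
    using pQ r by (simp add: Q_def algebra_simps)
  then have "(\<lambda>t. poly r (cst (t v))) \<in> M"
  proof (rule annihilator_at_constant[rotated 4])
    show "(\<lambda>t. cst (t v) - cst z) \<in> const_polys J"
      using poly_at_var[OF v, of "[:- cst z, 1:]"] by simp
    show "(\<lambda>t. cst (t v) - cst z) \<notin> M" using no by blast
  qed (simp add: D_diff, rule poly_at_var[OF v])
  then have "Q r" using \<open>r \<noteq> 0\<close> by (simp add: Q_def)
  then show False using min[of r] degree_mult_eq[of "[:- cst z, 1:]" r] \<open>r \<noteq> 0\<close> unfolding r by simp
qed

text \<open>Modulo \<open>M\<close> every coordinate is a constant \<open>a v\<close>, so
  \<open>h - h a\<close> lies in \<open>M\<close> for each polynomial \<open>h\<close>. If some
  \<open>w\<close> in \<open>M\<close> had \<open>w a \<noteq> 0\<close>, a nonzero scalar and with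
  it \<open>g ^ 0\<close> would lie in \<open>M\<close>; if \<open>g a = 0\<close>, then
  \<open>g ^ 1\<close> would.\<close>

lemma point: "\<exists>a. (\<forall>w\<in>M. w a = 0) \<and> g a \<noteq> 0"
proof -
  obtain a where a: "\<And>v. v \<in> J \<Longrightarrow> (\<lambda>t. cst (t v) - cst (a v)) \<in> M"
    using var_constant by metis
  have ev: "(\<lambda>t. h t - h a) \<in> M" if "h \<in> const_polys J" for h
    using that
  proof (induction rule: poly_funs.induct)
    case (mult f h)
    have "(\<lambda>t. h t * (f t - f a)) \<in> M" by (rule MD(4)[OF mult.hyps(2) mult.IH(1)])
    moreover have "(\<lambda>t. f a * (h t - h a)) \<in> M"
      by (rule MD(4)[OF poly_funs.const mult.IH(2)]) simp
    ultimately have "(\<lambda>t. h t * (f t - f a) + f a * (h t - h a)) \<in> M" by (rule MD(3))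
    then show ?case by (simp add: algebra_simps)
  next
    case (add f h)
    have "(\<lambda>t. (f t - f a) + (h t - h a)) \<in> M" by (rule MD(3)[OF add.IH])
    then show ?case by (simp add: algebra_simps)
  qed (use a MD(2) in auto)
  have "w a = 0" if "w \<in> M" for w
  proof (rule ccontr)
    assume "w a \<noteq> 0"
    have "(\<lambda>t. inverse (w a) * (w t - (w t - w a))) \<in> M"
      using M_diff[OF that ev[OF MD(1)[OF that]]] by (intro MD(4) poly_funs.const) simp_all
    then show False using \<open>w a \<noteq> 0\<close> avoid[of 0] by simp
  qed
  moreover have "g a \<noteq> 0" using ev[OF g] avoid[of 1] by auto
  ultimately show ?thesis by blast
qed

end

text \<open>A Nullstellensatz for differential ideals: Zorn's lemma enlarges \<open>W\<close> to an
  ideal as in \<open>max_diff_ideal\<close>, and \<open>point\<close> applies.\<close>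

lemma (in diff_field) constant_point_exists:
  assumes "finite J" and W: "diff_ideal J W" and g: "g \<in> const_polys J"
    and avoid: "\<And>n. (\<lambda>t. g t ^ n) \<notin> W"
  shows "\<exists>a. (\<forall>w\<in>W. w a = 0) \<and> g a \<noteq> 0"
proof -
  define A where "A = {I. diff_ideal J I \<and> W \<subseteq> I \<and> (\<forall>n. (\<lambda>t. g t ^ n) \<notin> I)}"
  have AD: "diff_ideal J I" "W \<subseteq> I" "(\<lambda>t. g t ^ n) \<notin> I" if "I \<in> A" for I n
    using that by (auto simp: A_def)
  have AI: "I \<in> A" if "diff_ideal J I" "W \<subseteq> I" "\<And>n. (\<lambda>t. g t ^ n) \<notin> I" for I
    using that by (simp add: A_def)
  have "\<exists>M\<in>A. \<forall>X\<in>A. M \<subseteq> X \<longrightarrow> X = M"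
  proof (rule subset_Zorn_nonempty)
    show "A \<noteq> {}" using AI[of W] W avoid by auto
  next
    fix \<C> assume ne: "\<C> \<noteq> {}" and ch: "subset.chain A \<C>"
    have sub: "I \<in> A" if "I \<in> \<C>" for I
      using ch that by (auto simp: subset.chain_def)
    note ideal = diff_idealD[OF AD(1)[OF sub]]
    have two: "\<exists>I\<in>\<C>. f \<in> I \<and> h \<in> I" if fh: "f \<in> \<Union>\<C>" "h \<in> \<Union>\<C>" for f h
    proof -
      obtain I I' where I: "I \<in> \<C>" "I' \<in> \<C>" "f \<in> I" "h \<in> I'" using fh by auto
      moreover have "I \<subseteq> I' \<or> I' \<subseteq> I"
        using ch I(1,2) unfolding subset.chain_def by blast
      ultimately show ?thesis by (meson subsetD)
    qed
    have "diff_ideal J (\<Union>\<C>)"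
      unfolding diff_ideal_def
    proof (intro conjI ballI subsetI)
      show "f \<in> const_polys J" if "f \<in> \<Union>\<C>" for f using that ideal(1) by (meson UnionE)
      show "(\<lambda>_. 0) \<in> \<Union>\<C>" using ne ideal(2) by (meson UnionI ex_in_conv)
    next
      fix f h assume "f \<in> \<Union>\<C>" "h \<in> \<Union>\<C>"
      then obtain I where "I \<in> \<C>" "f \<in> I" "h \<in> I" using two by meson
      then show "(\<lambda>t. f t + h t) \<in> \<Union>\<C>" using ideal(3) by (meson UnionI)
    next
      fix r f assume r: "r \<in> const_polys J" and "f \<in> \<Union>\<C>"
      then obtain I where "I \<in> \<C>" "f \<in> I" by blast
      then show "(\<lambda>t. r t * f t) \<in> \<Union>\<C>" using ideal(4) r by (meson UnionI)
    next
      fix f assume "f \<in> \<Union>\<C>"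
      then obtain I where "I \<in> \<C>" "f \<in> I" by blast
      then show "(\<lambda>t. D (f t)) \<in> \<Union>\<C>" using ideal(5) by (meson UnionI)
    qed
    then show "\<Union>\<C> \<in> A"
    proof (rule AI)
      show "W \<subseteq> \<Union>\<C>" using ne AD(2)[OF sub] by auto
      show "(\<lambda>t. g t ^ n) \<notin> \<Union>\<C>" for n using AD(3)[OF sub] by (meson UnionE)
    qed
  qed
  then obtain M where Max: "M \<in> A" "\<forall>X\<in>A. M \<subseteq> X \<longrightarrow> X = M" by blast
  interpret max_diff_ideal D cst J M g
  proof unfold_locales
    show "I = M" if "diff_ideal J I" "M \<subseteq> I" "\<And>n. (\<lambda>t. g t ^ n) \<notin> I" for I
    proof (rule Max(2)[rule_format])
      show "I \<in> A" using that AD(2)[OF Max(1)] by (intro AI) auto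
    qed (fact that(2))
  qed (fact \<open>finite J\<close> g AD[OF Max(1)])+
  show ?thesis using point AD(2)[OF Max(1)] by blast
qed

section \<open>Linear functionals over a subfield\<close>

definition is_subfield :: "'a::field set \<Rightarrow> bool" where
  "is_subfield E \<longleftrightarrow> 0 \<in> E \<and> 1 \<in> E \<and> (\<forall>x\<in>E. \<forall>y\<in>E. x + y \<in> E) \<and>
     (\<forall>x\<in>E. \<forall>y\<in>E. x * y \<in> E) \<and> (\<forall>x\<in>E. - x \<in> E) \<and> (\<forall>x\<in>E. inverse x \<in> E)"

lemma is_subfieldD:
  assumes "is_subfield E"
  shows "0 \<in> E" "1 \<in> E" "x \<in> E \<Longrightarrow> y \<in> E \<Longrightarrow> x + y \<in> E" "x \<in> E \<Longrightarrow> y \<in> E \<Longrightarrow> x * y \<in> E"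
    "x \<in> E \<Longrightarrow> - x \<in> E" "x \<in> E \<Longrightarrow> inverse x \<in> E"
    "x \<in> E \<Longrightarrow> y \<in> E \<Longrightarrow> x - y \<in> E" "x \<in> E \<Longrightarrow> y \<in> E \<Longrightarrow> x / y \<in> E"
  using assms unfolding is_subfield_def diff_conv_add_uminus divide_inverse by metis+

lemma is_subfield_sum: "is_subfield E \<Longrightarrow> (\<And>i. i \<in> A \<Longrightarrow> f i \<in> E) \<Longrightarrow> sum f A \<in> E"
  by (induction A rule: infinite_finite_induct) (auto intro: is_subfieldD)

lemma is_subfield_power: "is_subfield E \<Longrightarrow> x \<in> E \<Longrightarrow> x ^ n \<in> E"
  by (induction n) (auto intro: is_subfieldD)

lemma is_subfield_of_nat: "is_subfield E \<Longrightarrow> of_nat n \<in> E"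
  by (induction n) (auto intro: is_subfieldD)

definition linear_functional :: "'a::field set \<Rightarrow> ('a \<Rightarrow> 'a) \<Rightarrow> bool" where
  "linear_functional E \<phi> \<longleftrightarrow> (\<forall>x y. \<phi> (x + y) = \<phi> x + \<phi> y) \<and>
     (\<forall>e\<in>E. \<forall>x. \<phi> (e * x) = e * \<phi> x) \<and> (\<forall>x. \<phi> x \<in> E)"

lemma linear_functionalD:
  assumes "linear_functional E \<phi>"
  shows "\<phi> (x + y) = \<phi> x + \<phi> y" "e \<in> E \<Longrightarrow> \<phi> (e * x) = e * \<phi> x" "\<phi> x \<in> E" "\<phi> 0 = 0"
    "\<phi> (sum f A) = (\<Sum>i\<in>A. \<phi> (f i))"
proof -
  show add: "\<phi> (x + y) = \<phi> x + \<phi> y" for x y using assms by (auto simp: linear_functional_def)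
  show "e \<in> E \<Longrightarrow> \<phi> (e * x) = e * \<phi> x" "\<phi> x \<in> E" using assms by (auto simp: linear_functional_def)
  show 0: "\<phi> 0 = 0" using add[of 0 0] by (metis add_0_right add_left_cancel)
  show "\<phi> (sum f A) = (\<Sum>i\<in>A. \<phi> (f i))"
    by (induction A rule: infinite_finite_induct) (auto simp: 0 add)
qed

text \<open>A maximal subspace containing \<open>V\<close> and avoiding \<open>t\<close> is a hyperplane.\<close>

lemma linear_functional_exists:
  fixes E V :: "'a::field set"
  assumes E: "is_subfield E"
    and V: "0 \<in> V" "\<And>x y. x \<in> V \<Longrightarrow> y \<in> V \<Longrightarrow> x + y \<in> V" "\<And>e x. e \<in> E \<Longrightarrow> x \<in> V \<Longrightarrow> e * x \<in> V"
    and t: "t \<notin> V"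
  obtains \<phi> where "linear_functional E \<phi>" "\<And>x. x \<in> V \<Longrightarrow> \<phi> x = 0" "\<phi> t = 1"
proof -
  note ED = is_subfieldD[OF E]
  define subsp where "subsp H \<longleftrightarrow> (\<forall>x\<in>H. \<forall>y\<in>H. x + y \<in> H) \<and> (\<forall>e\<in>E. \<forall>x\<in>H. e * x \<in> H)" for H
  define A where "A = {H. subsp H \<and> V \<subseteq> H \<and> t \<notin> H}"
  have "\<exists>H\<in>A. \<forall>X\<in>A. H \<subseteq> X \<longrightarrow> X = H"
  proof (rule subset_Zorn_nonempty)
    have "V \<in> A" unfolding A_def subsp_def using V t by blast
    then show "A \<noteq> {}" by blast
  next
    fix \<C> assume ne: "\<C> \<noteq> {}" and ch: "subset.chain A \<C>"
    have sub: "I \<in> A" if "I \<in> \<C>" for I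
      using ch that by (auto simp: subset.chain_def)
    have "x + y \<in> \<Union>\<C>" if xy: "x \<in> \<Union>\<C>" "y \<in> \<Union>\<C>" for x y
    proof -
      obtain I I' where I: "I \<in> \<C>" "I' \<in> \<C>" "x \<in> I" "y \<in> I'" using xy by auto
      have "I \<subseteq> I' \<or> I' \<subseteq> I"
        using ch I(1,2) unfolding subset.chain_def by blast
      then show ?thesis
      proof
        assume "I \<subseteq> I'"
        then have "x + y \<in> I'" using I sub[of I'] by (auto simp: A_def subsp_def)
        then show ?thesis using I by blast
      next
        assume "I' \<subseteq> I"
        then have "x + y \<in> I" using I sub[of I] by (auto simp: A_def subsp_def)
        then show ?thesis using I by blast
      qed
    qed
    moreover have "e * x \<in> \<Union>\<C>" if e: "e \<in> E" and x: "x \<in> \<Union>\<C>" for e x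
    proof -
      obtain I where I: "I \<in> \<C>" "x \<in> I" using x by auto
      then have "e * x \<in> I" using sub[of I] e by (auto simp: A_def subsp_def)
      then show ?thesis using I by blast
    qed
    moreover have "V \<subseteq> \<Union>\<C>" using ne sub unfolding A_def by blast
    moreover have "t \<notin> \<Union>\<C>" using sub unfolding A_def by blast
    ultimately show "\<Union>\<C> \<in> A" unfolding A_def subsp_def by blast
  qed
  then obtain H where HA: "H \<in> A" and max: "\<And>X. X \<in> A \<Longrightarrow> H \<subseteq> X \<Longrightarrow> X = H" by blast
  have H: "\<And>x y. x \<in> H \<Longrightarrow> y \<in> H \<Longrightarrow> x + y \<in> H" "\<And>e x. e \<in> E \<Longrightarrow> x \<in> H \<Longrightarrow> e * x \<in> H"
    "V \<subseteq> H" "t \<notin> H"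
    using HA unfolding A_def subsp_def by blast+
  have H0: "0 \<in> H" using H(3) V(1) by auto
  have Hneg: "- x \<in> H" if "x \<in> H" for x
    using H(2)[OF ED(5)[OF ED(2)] that] by simp
  \<comment> \<open>For \<open>x\<close> outside \<open>H\<close> the space \<open>H + E x\<close>
    is larger than \<open>H\<close>, so it contains \<open>t\<close>; that equation is solved for
    \<open>x\<close>. The coefficient of \<open>t\<close> found in this way becomes the value of the
    functional.\<close>
  have ex: "\<exists>e\<in>E. x - e * t \<in> H" for x
  proof (cases "x \<in> H")
    case True
    then show ?thesis using ED(1) by (auto intro!: bexI[of _ 0])
  next
    case False
    let ?X = "{h + e * x | h e. h \<in> H \<and> e \<in> E}"
    have "H \<subseteq> ?X" using ED(1) by force
    have "x \<in> ?X" using H0 ED(2) by force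
    then have "?X \<noteq> H" using False by blast
    have "subsp ?X"
      unfolding subsp_def
    proof (intro conjI ballI)
      fix a b assume "a \<in> ?X" "b \<in> ?X"
      then obtain h e h' e' where "a = h + e * x" "h \<in> H" "e \<in> E" "b = h' + e' * x" "h' \<in> H" "e' \<in> E"
        by auto
      then show "a + b \<in> ?X"
        by (intro CollectI exI[of _ "h + h'"] exI[of _ "e + e'"]) (auto simp: algebra_simps H ED)
    next
      fix c a assume "c \<in> E" "a \<in> ?X"
      then obtain h e where "a = h + e * x" "h \<in> H" "e \<in> E" by auto
      then show "c * a \<in> ?X" using \<open>c \<in> E\<close>
        by (intro CollectI exI[of _ "c * h"] exI[of _ "c * e"]) (auto simp: algebra_simps H ED)
    qed
    then have "t \<in> ?X"
      using max[of ?X] \<open>H \<subseteq> ?X\<close> \<open>?X \<noteq> H\<close> H(3) unfolding A_def by blast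
    then obtain h e where he: "t = h + e * x" "h \<in> H" "e \<in> E" by auto
    with H(4) have "e \<noteq> 0" by auto
    have "inverse e * - h \<in> H" by (intro H Hneg ED he)
    moreover have "x - inverse e * t = inverse e * - h"
      using he(1) \<open>e \<noteq> 0\<close> by (simp add: field_simps)
    ultimately show ?thesis using ED(6)[OF he(3)] by metis
  qed
  then obtain \<phi> where \<phi>: "\<And>x. \<phi> x \<in> E" "\<And>x. x - \<phi> x * t \<in> H" by metis
  have uniq: "e = \<phi> x" if "e \<in> E" "x - e * t \<in> H" for e x
  proof (rule ccontr)
    assume "e \<noteq> \<phi> x"
    have "(x - e * t) + - (x - \<phi> x * t) \<in> H" by (intro H(1) Hneg that \<phi>)
    then have "(\<phi> x - e) * t \<in> H" by (simp add: algebra_simps)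
    then have "inverse (\<phi> x - e) * ((\<phi> x - e) * t) \<in> H"
      by (rule H(2)[OF ED(6)[OF ED(7)[OF \<phi>(1) that(1)]]])
    then show False using H(4) \<open>e \<noteq> \<phi> x\<close> by (simp flip: mult.assoc)
  qed
  have "linear_functional E \<phi>"
    unfolding linear_functional_def
  proof (intro conjI allI ballI)
    fix x y
    have "(x - \<phi> x * t) + (y - \<phi> y * t) \<in> H" by (intro H(1) \<phi>)
    then show "\<phi> (x + y) = \<phi> x + \<phi> y"
      by (intro uniq[symmetric] ED \<phi>) (simp add: algebra_simps)
  next
    fix e x assume e: "e \<in> E"
    have "e * (x - \<phi> x * t) \<in> H" by (intro H(2) \<phi> e)
    then show "\<phi> (e * x) = e * \<phi> x"
      by (intro uniq[symmetric] ED \<phi> e) (simp add: algebra_simps)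
  qed (rule \<phi>)
  moreover have "\<phi> x = 0" if "x \<in> V" for x
    by (rule uniq[symmetric]) (use that H(3) ED in auto)
  moreover have "\<phi> t = 1"
    by (rule uniq[symmetric]) (use H0 ED in auto)
  ultimately show ?thesis using that by blast
qed

text \<open>The cofactor is carried through the induction, so that the root \<open>z\<close> can be
  split off from whichever factor has it.\<close>

lemma dvd_linear_power:
  fixes m :: "'a::field poly"
  assumes "m dvd [:- z, 1:] ^ N"
  shows "\<exists>c k. m = Polynomial.smult c ([:- z, 1:] ^ k)"
proof -
  obtain s where "m * s = [:- z, 1:] ^ N" using assms by (metis dvdE)
  then show ?thesis
  proof (induction N arbitrary: m s)
    case 0
    then have "m dvd 1" by (metis dvd_triv_left power_0)
    then obtain c where "m = [:c:]" by (metis is_unit_poly_iff)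
    then show ?case by (intro exI[of _ c] exI[of _ 0]) simp
  next
    case (Suc N)
    have "poly (m * s) z = 0" unfolding Suc.prems by simp
    then consider "poly m z = 0" | "poly s z = 0" by auto
    then show ?case
    proof cases
      case 1
      then obtain m' where m': "m = [:- z, 1:] * m'" unfolding poly_eq_0_iff_dvd dvd_def by blast
      have "[:- z, 1:] * (m' * s) = [:- z, 1:] * [:- z, 1:] ^ N"
        using Suc.prems unfolding m' by (simp only: mult.assoc power_Suc)
      then have "m' * s = [:- z, 1:] ^ N" by (subst (asm) mult_cancel_left) auto
      from Suc.IH[OF this] obtain c k where "m' = Polynomial.smult c ([:- z, 1:] ^ k)" by blast
      then have "m = Polynomial.smult c ([:- z, 1:] ^ Suc k)"
        unfolding m' by (simp only: mult_smult_right power_Suc)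
      then show ?thesis by blast
    next
      case 2
      then obtain s' where s': "s = [:- z, 1:] * s'" unfolding poly_eq_0_iff_dvd dvd_def by blast
      have "[:- z, 1:] * (m * s') = [:- z, 1:] * [:- z, 1:] ^ N"
        using Suc.prems unfolding s' by (simp only: mult_ac power_Suc)
      then have "m * s' = [:- z, 1:] ^ N" by (subst (asm) mult_cancel_left) auto
      from Suc.IH[OF this] show ?thesis .
    qed
  qed
qed

text \<open>In terms of tensor products: \<open>z \<otimes> 1 - 1 \<otimes> z\<close> is not nilpotent over \<open>E\<close>. If it were, then the minimal
  polynomial of \<open>z\<close> would be a power of \<open>T - z\<close>, and \<open>n z\<close> would be one of its coefficients.\<close>

lemma tensor_difference_not_nilpotent:
  fixes z :: "'a::field_char_0"
  assumes E: "is_subfield E" and z: "z \<notin> E"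
  obtains \<phi> where "linear_functional E \<phi>"
    "(\<Sum>k\<le>N. of_nat (N choose k) * (-1) ^ k * z ^ (N - k) * \<phi> (z ^ k)) \<noteq> 0"
proof -
  note result = that
  note ED = is_subfieldD[OF E]
  \<comment> \<open>The coefficients of \<open>F\<close> are those in the expansion of the
    \<open>N\<close>-th power of z \<otimes> 1 - 1 \<otimes> z. The variable stands for the second
    factor, on which \<open>\<phi>\<close> acts.\<close>
  define F where "F = [:z, -1:] ^ N"
  have degF: "degree F = N" unfolding F_def by simp
  have coeffF: "poly.coeff F k = of_nat (N choose k) * (-1) ^ k * z ^ (N - k)" for k
    by (cases "k \<le> N") (simp_all add: F_def coeff_linear_poly_power coeff_eq_0 degF[unfolded F_def])
  define V where "V n = {(\<Sum>j<n. e j * z ^ j) | e. \<forall>j. e j \<in> E}" for n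
  have V0: "0 \<in> V n" for n unfolding V_def using ED(1) by (intro CollectI exI[of _ "\<lambda>_. 0"]) auto
  have Vadd: "x + y \<in> V n" if xy: "x \<in> V n" "y \<in> V n" for x y n
  proof -
    from xy obtain e e' where "x = (\<Sum>j<n. e j * z ^ j)" "\<forall>j. e j \<in> E"
      "y = (\<Sum>j<n. e' j * z ^ j)" "\<forall>j. e' j \<in> E" unfolding V_def by blast
    then show ?thesis unfolding V_def
      by (intro CollectI exI[of _ "\<lambda>j. e j + e' j"]) (auto simp: sum.distrib algebra_simps ED)
  qed
  have Vscale: "c * x \<in> V n" if c: "c \<in> E" and x: "x \<in> V n" for c x n
  proof -
    from x obtain e where "x = (\<Sum>j<n. e j * z ^ j)" "\<forall>j. e j \<in> E" unfolding V_def by blast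
    then show ?thesis unfolding V_def using c
      by (intro CollectI exI[of _ "\<lambda>j. c * e j"]) (auto simp: sum_distrib_left mult.assoc ED)
  qed
  have Vpow: "z ^ j \<in> V n" if "j < n" for j n
  proof -
    have "z ^ j = (\<Sum>i<n. (if i = j then 1 else 0) * z ^ i)"
      using that by (simp add: if_distrib[of "\<lambda>x. x * _"] cong: if_cong)
    then show ?thesis unfolding V_def using ED(1,2)
      by (intro CollectI exI[of _ "\<lambda>i. if i = j then 1 else 0"]) auto
  qed
  \<comment> \<open>When \<open>z ^ N\<close> is independent of the lower powers over
    \<open>E\<close>, a functional killing these isolates the last summand.\<close>
  have fnl: thesis if nV: "z ^ N \<notin> V N"
  proof -
    obtain \<phi> where \<phi>: "linear_functional E \<phi>" "\<And>x. x \<in> V N \<Longrightarrow> \<phi> x = 0" "\<phi> (z ^ N) = 1"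
      using linear_functional_exists[OF E V0 Vadd Vscale nV] by blast
    have "(\<Sum>k\<le>N. of_nat (N choose k) * (-1) ^ k * z ^ (N - k) * \<phi> (z ^ k)) =
      (\<Sum>k\<in>{N}. of_nat (N choose k) * (-1) ^ k * z ^ (N - k) * \<phi> (z ^ k))"
      by (rule sum.mono_neutral_right) (use \<phi>(2)[OF Vpow] in auto)
    then show ?thesis using \<phi>(1,3) by (intro result[of \<phi>]) auto
  qed
  show thesis
  proof (cases "z ^ N \<in> V N")
    case False
    then show ?thesis by (rule fnl)
  next
    case True
    \<comment> \<open>\<open>n\<close> is the degree of \<open>z\<close> over
      \<open>E\<close>.\<close>
    define n where "n = (LEAST n. z ^ n \<in> V n)"
    have n: "z ^ n \<in> V n" unfolding n_def using True by (rule LeastI)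
    have n0: "n \<noteq> 0"
    proof
      assume "n = 0"
      then show False using n by (auto simp: V_def)
    qed
    have n1: "n \<noteq> 1"
    proof
      assume "n = 1"
      then show False using n z by (auto simp: V_def)
    qed
    have "z ^ (n - 1) \<notin> V (n - 1)"
      using not_less_Least[of "n - 1" "\<lambda>n. z ^ n \<in> V n"] n0 by (simp add: n_def)
    then obtain \<phi> where \<phi>: "linear_functional E \<phi>" "\<And>x. x \<in> V (n - 1) \<Longrightarrow> \<phi> x = 0" "\<phi> (z ^ (n - 1)) = 1"
      using linear_functional_exists[OF E V0 Vadd Vscale] by metis
    note \<phi>D = linear_functionalD[OF \<phi>(1)]
    obtain e where e: "z ^ n = (\<Sum>j<n. e j * z ^ j)" "\<And>j. e j \<in> E" using n unfolding V_def by blast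
    define m where "m = Polynomial.monom 1 n - (\<Sum>j<n. Polynomial.monom (e j) j)"
    have coeff_m: "poly.coeff m i = (if i = n then 1 else if i < n then - e i else 0)" for i
      by (auto simp: m_def coeff_sum Polynomial.coeff_monom)
    have deg_m: "degree m = n" by (rule antisym[OF degree_le le_degree]) (auto simp: coeff_m)
    have m_E: "poly.coeff m i \<in> E" for i using e(2) ED by (auto simp: coeff_m)
    have "poly m z = 0" by (simp add: m_def poly_monom poly_sum e(1))
    \<comment> \<open>\<open>\<psi> i G\<close> evaluates \<open>G\<close> in the second factor
      after a shift by \<open>i\<close>: \<open>\<phi>\<close> is applied to the powers of
      \<open>z\<close> and not to the coefficients. Multiples of \<open>m\<close> are killed because
      the coefficients of \<open>m\<close> lie in \<open>E\<close> and pass through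
      \<open>\<phi>\<close>.\<close>
    define \<psi> where "\<psi> i G = (\<Sum>k\<le>degree G. poly.coeff G k * \<phi> (z ^ (i + k)))" for i G
    have \<psi>_bound: "\<psi> i G = (\<Sum>k\<le>d. poly.coeff G k * \<phi> (z ^ (i + k)))" if "degree G \<le> d" for i G d
      unfolding \<psi>_def by (rule sum.mono_neutral_left) (use that in \<open>auto intro: coeff_eq_0\<close>)
    have \<psi>_add: "\<psi> i (G + H) = \<psi> i G + \<psi> i H" for i G H
    proof -
      let ?d = "max (degree G) (degree H)"
      have "degree (G + H) \<le> ?d" by (rule degree_add_le_max)
      then show ?thesis
        by (simp add: \<psi>_bound[of _ ?d] algebra_simps sum.distrib)
    qed
    have \<psi>_pCons: "\<psi> i (pCons a G) = a * \<phi> (z ^ i) + \<psi> (Suc i) G" for i a G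
    proof -
      have "\<psi> i (pCons a G) = (\<Sum>k\<le>Suc (degree G). poly.coeff (pCons a G) k * \<phi> (z ^ (i + k)))"
        by (rule \<psi>_bound) (simp add: degree_pCons_le)
      then show ?thesis by (simp add: sum.atMost_Suc_shift \<psi>_def del: sum.atMost_Suc)
    qed
    have \<psi>_smult: "\<psi> i (Polynomial.smult a G) = a * \<psi> i G" for i a G
    proof -
      have "\<psi> i (Polynomial.smult a G) = (\<Sum>k\<le>degree G. poly.coeff (Polynomial.smult a G) k * \<phi> (z ^ (i + k)))"
        by (rule \<psi>_bound) (simp add: degree_smult_le)
      then show ?thesis by (simp add: \<psi>_def sum_distrib_left mult.assoc)
    qed
    have \<psi>_m: "\<psi> i m = 0" for i
    proof -
      have "\<psi> i m = \<phi> (\<Sum>k\<le>degree m. poly.coeff m k * z ^ (i + k))"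
        unfolding \<psi>_def by (simp add: \<phi>D(5) \<phi>D(2) m_E)
      also have "(\<Sum>k\<le>degree m. poly.coeff m k * z ^ (i + k)) = z ^ i * poly m z"
        by (simp add: poly_altdef sum_distrib_left power_add mult_ac)
      finally show ?thesis using \<open>poly m z = 0\<close> \<phi>D(4) by simp
    qed
    have \<psi>_mult_m: "\<psi> i (m * S) = 0" for i S
    proof (induction S arbitrary: i)
      case (pCons a S)
      have "m * pCons a S = Polynomial.smult a m + pCons 0 (m * S)" by simp
      then show ?case using pCons by (simp only: \<psi>_add \<psi>_smult \<psi>_pCons \<psi>_m) simp
    qed (simp add: \<psi>_def)
    show thesis
    proof (rule ccontr)
      assume nothesis: "\<not> thesis"
      \<comment> \<open>\<open>\<phi>\<close> composed with multiplication by \<open>z ^ i\<close>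
        is again a functional; if it did not kill \<open>F\<close>, it would be the required
        one.\<close>
      have \<psi>F: "\<psi> i F = 0" for i
      proof (rule ccontr)
        assume "\<psi> i F \<noteq> 0"
        moreover have "linear_functional E (\<lambda>x. \<phi> (z ^ i * x))"
          using \<phi>D by (auto simp: linear_functional_def distrib_left mult.left_commute)
        ultimately have thesis
          by (intro result[of "\<lambda>x. \<phi> (z ^ i * x)"])
             (auto simp: \<psi>_def degF coeffF power_add)
        then show False using nothesis by simp
      qed
      define r where "r = F mod m"
      have "F = m * (F div m) + r" by (simp add: r_def)
      then have \<psi>r: "\<psi> i r = 0" for i using \<psi>F[of i] \<psi>_add[of i "m * (F div m)" r] \<psi>_mult_m by simp
      have "m \<noteq> 0" using deg_m n0 by auto
      have "r = 0"
      proof (rule ccontr)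
        assume "r \<noteq> 0"
        then have dr: "degree r < n" using degree_mod_less[OF \<open>m \<noteq> 0\<close>, of F] deg_m by (auto simp: r_def)
        \<comment> \<open>The shift moves the leading term of \<open>r\<close> to
          \<open>z ^ (n - 1)\<close>, where \<open>\<phi>\<close> is 1, and all other terms into
          \<open>V (n - 1)\<close>, where \<open>\<phi>\<close> vanishes.\<close>
        have "\<psi> (n - 1 - degree r) r = (\<Sum>k\<in>{degree r}. poly.coeff r k * \<phi> (z ^ (n - 1 - degree r + k)))"
          unfolding \<psi>_def
        proof (rule sum.mono_neutral_right)
          show "\<forall>k\<in>{..degree r} - {degree r}. poly.coeff r k * \<phi> (z ^ (n - 1 - degree r + k)) = 0"
          proof
            fix k assume "k \<in> {..degree r} - {degree r}"
            then have "n - 1 - degree r + k < n - 1" using dr by auto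
            from \<phi>(2)[OF Vpow[OF this]] show "poly.coeff r k * \<phi> (z ^ (n - 1 - degree r + k)) = 0" by simp
          qed
        qed auto
        also have "\<dots> = lead_coeff r" using dr \<phi>(3) by simp
        finally show False using \<psi>r \<open>r \<noteq> 0\<close> by simp
      qed
      then have "m dvd F" by (auto simp: r_def)
      also have "F = Polynomial.smult ((-1) ^ N) ([:- z, 1:] ^ N)"
        unfolding F_def smult_power[symmetric] by simp
      finally have "m dvd [:- z, 1:] ^ N" by (simp add: dvd_smult_iff)
      then obtain c k where ck: "m = Polynomial.smult c ([:- z, 1:] ^ k)" using dvd_linear_power by blast
      have "c \<noteq> 0" using ck \<open>m \<noteq> 0\<close> by auto
      then have "k = n" using deg_m unfolding ck by (simp add: degree_linear_power)
      have "c = 1" using coeff_m[of n] unfolding ck \<open>k = n\<close> by (simp add: coeff_linear_poly_power)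
      have "n - (n - 1) = 1" "n choose (n - 1) = n"
        using n0 binomial_symmetric[of "n - 1" n] by simp_all
      \<comment> \<open>This coefficient of the minimal polynomial puts \<open>n * z\<close> into
        \<open>E\<close>, and characteristic 0 allows the division by \<open>n\<close>.\<close>
      then have "poly.coeff ([:- z, 1:] ^ n) (n - 1) = - (of_nat n * z)"
        by (subst coeff_linear_poly_power) simp_all
      then have "poly.coeff m (n - 1) = - (of_nat n * z)"
        unfolding ck \<open>k = n\<close> \<open>c = 1\<close> by simp
      then have "of_nat n * z \<in> E" using ED(5)[OF m_E[of "n - 1"]] by simp
      then have "of_nat n * z / of_nat n \<in> E" using is_subfield_of_nat[OF E] ED(8) by blast
      moreover have "of_nat n * z / of_nat n = z" using n0 by simp
      ultimately show False using z by (simp only:)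
    qed
  qed
qed

section \<open>Fundamental matrices\<close>

lemma poly_funs_diff:
  assumes "is_subfield S" "f \<in> poly_funs S J y" "h \<in> poly_funs S J y"
  shows "(\<lambda>t. f t - h t) \<in> poly_funs S J y"
proof -
  have "(\<lambda>_. -1) \<in> poly_funs S J y" using is_subfieldD(2,5)[OF assms(1)] by (intro poly_funs.const) auto
  from poly_funs.add[OF assms(2) poly_funs.mult[OF this assms(3)]] show ?thesis by simp
qed

section \<open>Fields generated over a subfield\<close>

abbreviation polys :: "'a::comm_ring_1 set \<Rightarrow> 'v set \<Rightarrow> (('v \<Rightarrow> 'a) \<Rightarrow> 'a) set" where
  "polys S J \<equiv> poly_funs S J (\<lambda>v x. x v)"

lemma polys_var: "v \<in> J \<Longrightarrow> (\<lambda>x. x v) \<in> polys S J"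
  using poly_funs.var[of v J "\<lambda>v x. x v"] by simp

definition frac_field :: "'a::field set \<Rightarrow> 'v set \<Rightarrow> ('v \<Rightarrow> 'a) \<Rightarrow> 'a set" where
  "frac_field E J u = {P u / Q u | P Q. P \<in> polys E J \<and> Q \<in> polys E J \<and> Q u \<noteq> 0}"

lemma frac_fieldE:
  assumes "x \<in> frac_field E J u"
  obtains P Q where "P \<in> polys E J" "Q \<in> polys E J" "Q u \<noteq> 0" "x = P u / Q u"
  using assms unfolding frac_field_def by blast

lemma frac_fieldI:
  "P \<in> polys E J \<Longrightarrow> Q \<in> polys E J \<Longrightarrow> Q u \<noteq> 0 \<Longrightarrow> x = P u / Q u \<Longrightarrow> x \<in> frac_field E J u"
  unfolding frac_field_def by blast

lemma polys_in_frac_field: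
  assumes "is_subfield E" "P \<in> polys E J"
  shows "P u \<in> frac_field E J u"
  by (rule frac_fieldI[OF assms(2) poly_funs.const[OF is_subfieldD(2)[OF assms(1)]]]) auto

lemma frac_field_base: "is_subfield E \<Longrightarrow> E \<subseteq> frac_field E J u"
  using polys_in_frac_field[OF _ poly_funs.const] by auto

lemma frac_field_var: "is_subfield E \<Longrightarrow> v \<in> J \<Longrightarrow> u v \<in> frac_field E J u"
  using polys_in_frac_field[OF _ polys_var, of E v J u] by simp

lemma is_subfield_frac_field:
  assumes E: "is_subfield E"
  shows "is_subfield (frac_field E J u)"
  unfolding is_subfield_def
proof (intro conjI ballI)
  show 0: "0 \<in> frac_field E J u" "1 \<in> frac_field E J u"
    using frac_field_base[OF E] is_subfieldD(1,2)[OF E] by auto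
  fix x assume "x \<in> frac_field E J u"
  then obtain P Q where x: "P \<in> polys E J" "Q \<in> polys E J" "Q u \<noteq> 0" "x = P u / Q u"
    by (rule frac_fieldE)
  have "(\<lambda>x. (\<lambda>_. 0) x - P x) \<in> polys E J"
    by (intro poly_funs_diff[OF E] poly_funs.const is_subfieldD(1)[OF E] x)
  from frac_fieldI[OF this x(2,3) refl] show "- x \<in> frac_field E J u" using x by simp
  show "inverse x \<in> frac_field E J u"
  proof (cases "P u = 0")
    case True
    then show ?thesis using x 0 by simp
  next
    case False
    then show ?thesis by (intro frac_fieldI[of Q _ _ P]) (use x in auto)
  qed
  fix y assume "y \<in> frac_field E J u"
  then obtain P' Q' where y: "P' \<in> polys E J" "Q' \<in> polys E J" "Q' u \<noteq> 0" "y = P' u / Q' u"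
    by (rule frac_fieldE)
  have QQ: "(\<lambda>x. Q x * Q' x) \<in> polys E J" by (intro poly_funs.mult x y)
  show "x + y \<in> frac_field E J u"
  proof (rule frac_fieldI[OF _ QQ])
    show "(\<lambda>x. P x * Q' x + P' x * Q x) \<in> polys E J"
      by (intro poly_funs.add poly_funs.mult x y)
  qed (use x(3) y(3) in \<open>simp_all add: x(4) y(4) add_frac_eq\<close>)
  show "x * y \<in> frac_field E J u"
  proof (rule frac_fieldI[OF _ QQ])
    show "(\<lambda>x. P x * P' x) \<in> polys E J" by (intro poly_funs.mult x y)
  qed (use x(3) y(3) in \<open>simp_all add: x(4) y(4)\<close>)
qed

lemma poly_funs_in_subfield:
  assumes L: "is_subfield L" and "P \<in> polys E J" "E \<subseteq> L" "\<And>v. v \<in> J \<Longrightarrow> u v \<in> L"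
  shows "P u \<in> L"
  by (rule poly_funs_in[OF poly_funs_mono[OF assms(2,3)]]) (use assms(4) is_subfieldD[OF L] in auto)

lemma frac_field_subset:
  assumes "is_subfield L" "E \<subseteq> L" "\<And>v. v \<in> J \<Longrightarrow> u v \<in> L"
  shows "frac_field E J u \<subseteq> L"
proof
  fix x assume "x \<in> frac_field E J u"
  then obtain P Q where x: "P \<in> polys E J" "Q \<in> polys E J" "x = P u / Q u" by (auto elim: frac_fieldE)
  have "P u \<in> L" "Q u \<in> L"
    using poly_funs_in_subfield[OF assms(1) x(1) assms(2), of u]
      poly_funs_in_subfield[OF assms(1) x(2) assms(2), of u] assms(3) by blast+
  then show "x \<in> L" unfolding x by (rule is_subfieldD(8)[OF assms(1)])
qed

text \<open>Matrices are functions on pairs of indices from a set \<open>I\<close>, because the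
  block matrices of a compositum are indexed by tuples. Entries outside \<open>I \<times> I\<close>
  are arbitrary, so identities are stated on \<open>I \<times> I\<close> only.\<close>

definition mprod :: "'n set \<Rightarrow> ('n \<times> 'n \<Rightarrow> 'a::comm_ring_1) \<Rightarrow> ('n \<times> 'n \<Rightarrow> 'a) \<Rightarrow> 'n \<times> 'n \<Rightarrow> 'a" where
  "mprod I X Y = (\<lambda>(i, j). \<Sum>k\<in>I. X (i, k) * Y (k, j))"

definition mone :: "'n \<times> 'n \<Rightarrow> 'a::comm_ring_1" where
  "mone = (\<lambda>(i, j). if i = j then 1 else 0)"

lemma mprod_assoc: "mprod I (mprod I X Y) Z = mprod I X (mprod I Y Z)"
proof
  fix v :: "'a \<times> 'a" obtain i j where v: "v = (i, j)" by fastforce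
  have "(\<Sum>k\<in>I. \<Sum>l\<in>I. X (i, l) * Y (l, k) * Z (k, j)) = (\<Sum>l\<in>I. \<Sum>k\<in>I. X (i, l) * Y (l, k) * Z (k, j))"
    by (rule sum.swap)
  then show "mprod I (mprod I X Y) Z v = mprod I X (mprod I Y Z) v"
    by (simp add: mprod_def v sum_distrib_left sum_distrib_right mult.assoc)
qed

lemma mprod_cong:
  "(\<And>v. v \<in> I \<times> I \<Longrightarrow> X v = X' v) \<Longrightarrow> (\<And>v. v \<in> I \<times> I \<Longrightarrow> Y v = Y' v) \<Longrightarrow> v \<in> I \<times> I \<Longrightarrow>
    mprod I X Y v = mprod I X' Y' v"
  by (cases v) (auto simp: mprod_def)

lemma mprod_one_right: "finite I \<Longrightarrow> (\<And>v. v \<in> I \<times> I \<Longrightarrow> Y v = mone v) \<Longrightarrow> v \<in> I \<times> I \<Longrightarrow> mprod I X Y v = X v"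
  by (cases v) (auto simp: mprod_def mone_def if_distrib[of "\<lambda>x. _ * x"] cong: if_cong)

lemma mprod_one_left: "finite I \<Longrightarrow> (\<And>v. v \<in> I \<times> I \<Longrightarrow> Y v = mone v) \<Longrightarrow> v \<in> I \<times> I \<Longrightarrow> mprod I Y X v = X v"
  by (cases v) (auto simp: mprod_def mone_def if_distrib[of "\<lambda>x. x * _"] cong: if_cong)

lemma mprod_polys:
  assumes "0 \<in> S" "\<And>v. v \<in> I \<times> I \<Longrightarrow> (\<lambda>t. X t v) \<in> poly_funs S J y"
    "\<And>v. v \<in> I \<times> I \<Longrightarrow> (\<lambda>t. Y t v) \<in> poly_funs S J y" "v \<in> I \<times> I"
  shows "(\<lambda>t. mprod I (X t) (Y t) v) \<in> poly_funs S J y"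
proof -
  obtain i j where v: "v = (i, j)" "i \<in> I" "j \<in> I" using assms(4) by auto
  show ?thesis unfolding v mprod_def prod.case
    by (intro poly_funs_sum poly_funs.mult assms) (use v in auto)
qed

context diff_field begin

definition diff_subfield :: "'a set \<Rightarrow> bool" where
  "diff_subfield E \<longleftrightarrow> is_subfield E \<and> range cst \<subseteq> E \<and> D ` E \<subseteq> E"

text \<open>Only the values on \<open>L\<close> are constrained, so two automorphisms count as equal
  when they agree on \<open>L\<close>.\<close>

definition diff_aut :: "'a set \<Rightarrow> 'a set \<Rightarrow> ('a \<Rightarrow> 'a) \<Rightarrow> bool" where
  "diff_aut E L \<sigma> \<longleftrightarrow> bij_betw \<sigma> L L \<and> (\<forall>x\<in>L. \<forall>y\<in>L. \<sigma> (x + y) = \<sigma> x + \<sigma> y) \<and>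
     (\<forall>x\<in>L. \<forall>y\<in>L. \<sigma> (x * y) = \<sigma> x * \<sigma> y) \<and> (\<forall>x\<in>L. D (\<sigma> x) = \<sigma> (D x)) \<and> (\<forall>x\<in>E. \<sigma> x = x)"

lemma mprod_D: "D (mprod I X Y v) = mprod I (\<lambda>v. D (X v)) Y v + mprod I X (\<lambda>v. D (Y v)) v"
  by (cases v) (simp add: mprod_def D_sum D_mult sum.distrib)

end

text \<open>The inverse \<open>V\<close> is carried along as a parameter, which avoids
  determinants.\<close>

locale fundamental_matrix = diff_field D cst
  for D :: "'a::field_char_0 \<Rightarrow> 'a" and cst :: "complex \<Rightarrow> 'a" +
  fixes E :: "'a set" and I :: "'n set" and B U V :: "'n \<times> 'n \<Rightarrow> 'a"
  assumes E: "diff_subfield E" and finite_I: "finite I"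
    and B: "\<And>v. v \<in> I \<times> I \<Longrightarrow> B v \<in> E"
    and DU: "\<And>v. v \<in> I \<times> I \<Longrightarrow> D (U v) = mprod I B U v"
    and UV: "\<And>v. v \<in> I \<times> I \<Longrightarrow> mprod I U V v = mone v"
    and VU: "\<And>v. v \<in> I \<times> I \<Longrightarrow> mprod I V U v = mone v"
begin

abbreviation "J \<equiv> I \<times> I"

abbreviation "L \<equiv> frac_field E J U"

abbreviation cm :: "('n \<times> 'n \<Rightarrow> complex) \<Rightarrow> 'n \<times> 'n \<Rightarrow> 'a" where
  "cm A \<equiv> (\<lambda>v. cst (A v))"

lemma E_sub: "is_subfield E" and cst_E: "cst c \<in> E" and D_E: "x \<in> E \<Longrightarrow> D x \<in> E"
  using E by (auto simp: diff_subfield_def)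

lemmas ED = is_subfieldD[OF E_sub]

lemma finite_J: "finite J" using finite_I by simp

lemma infinite_E: "infinite E"
  using infinite_range_cst cst_E finite_subset[of "range cst" E] by blast

text \<open>One \<open>P'\<close> serves all solutions of the system at once, so the derivative
  computed at \<open>U\<close> is also known at \<open>U A\<close> for constant
  \<open>A\<close>.\<close>

lemma D_polys:
  assumes "P \<in> polys E J"
  shows "\<exists>P'\<in>polys E J. \<forall>x. (\<forall>v\<in>J. D (x v) = mprod I B x v) \<longrightarrow> D (P x) = P' x"
  using assms
proof (induction rule: poly_funs.induct)
  case (const s)
  then show ?case by (intro bexI[of _ "\<lambda>_. D s"] poly_funs.const) (auto intro: D_E)
next
  case (var v)
  have "(\<lambda>x. mprod I B x v) \<in> polys E J"
    by (intro mprod_polys poly_funs.const polys_var B ED var)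
  then show ?case using var by (intro bexI[of _ "\<lambda>x. mprod I B x v"]) auto
next
  case (add f h)
  then obtain f' h' where *: "f' \<in> polys E J" "h' \<in> polys E J"
    "\<forall>x. (\<forall>v\<in>J. D (x v) = mprod I B x v) \<longrightarrow> D (f x) = f' x"
    "\<forall>x. (\<forall>v\<in>J. D (x v) = mprod I B x v) \<longrightarrow> D (h x) = h' x" by blast
  show ?case
    by (rule bexI[of _ "\<lambda>x. f' x + h' x"]) (use * in \<open>auto simp: D_add intro: poly_funs.add\<close>)
next
  case (mult f h)
  then obtain f' h' where *: "f' \<in> polys E J" "h' \<in> polys E J"
    "\<forall>x. (\<forall>v\<in>J. D (x v) = mprod I B x v) \<longrightarrow> D (f x) = f' x"
    "\<forall>x. (\<forall>v\<in>J. D (x v) = mprod I B x v) \<longrightarrow> D (h x) = h' x" by blast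
  show ?case
  proof (rule bexI[of _ "\<lambda>x. f' x * h x + f x * h' x"])
    show "(\<lambda>x. f' x * h x + f x * h' x) \<in> polys E J"
      by (intro poly_funs.add poly_funs.mult * mult)
  qed (use * in \<open>auto simp: D_mult\<close>)
qed

lemma D_U_cm: "v \<in> J \<Longrightarrow> D (mprod I U (cm A) v) = mprod I B (mprod I U (cm A)) v"
proof -
  assume v: "v \<in> J"
  have "D (mprod I U (cm A) v) = mprod I (\<lambda>v. D (U v)) (cm A) v"
    unfolding mprod_D by (cases v) (simp add: mprod_def)
  also have "\<dots> = mprod I (mprod I B U) (cm A) v" by (rule mprod_cong) (auto simp: DU v)
  finally show ?thesis by (simp only: mprod_assoc)
qed

lemma D_V: "v \<in> J \<Longrightarrow> D (V v) = - mprod I V B v"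
proof -
  assume v: "v \<in> J"
  have 0: "mprod I (mprod I B U) V w + mprod I U (\<lambda>v. D (V v)) w = 0" if w: "w \<in> J" for w
  proof -
    have "D (mprod I U V w) = 0" unfolding UV[OF w] by (cases w) (auto simp: mone_def)
    moreover have "mprod I (\<lambda>v. D (U v)) V w = mprod I (mprod I B U) V w"
      by (rule mprod_cong) (auto simp: DU w)
    ultimately show ?thesis by (simp add: mprod_D)
  qed
  have "mprod I U (\<lambda>v. D (V v)) w = - B w" if w: "w \<in> J" for w
  proof -
    have "mprod I (mprod I B U) V w = B w"
      unfolding mprod_assoc by (rule mprod_one_right[OF finite_I UV w])
    then show ?thesis using 0[OF w] by (simp add: eq_neg_iff_add_eq_0 add.commute)
  qed
  then have "mprod I V (mprod I U (\<lambda>v. D (V v))) v = mprod I V (\<lambda>v. - B v) v"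
    by (intro mprod_cong v) auto
  moreover have "mprod I V (mprod I U (\<lambda>v. D (V v))) v = D (V v)"
    unfolding mprod_assoc[symmetric] by (rule mprod_one_left[OF finite_I VU v])
  ultimately show ?thesis by (cases v) (simp add: mprod_def sum_negf)
qed

lemma diff_subfield_L: "diff_subfield L"
  unfolding diff_subfield_def
proof (intro conjI)
  show sub: "is_subfield L" by (rule is_subfield_frac_field[OF E_sub])
  show "range cst \<subseteq> L" using frac_field_base[OF E_sub] cst_E by blast
  show "D ` L \<subseteq> L"
  proof
    fix y assume "y \<in> D ` L"
    then obtain P Q where y: "P \<in> polys E J" "Q \<in> polys E J" "Q U \<noteq> 0" "y = D (P U / Q U)"
      by (auto elim: frac_fieldE)
    obtain P' Q' where "P' \<in> polys E J" "D (P U) = P' U" "Q' \<in> polys E J" "D (Q U) = Q' U"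
      using D_polys[OF y(1)] D_polys[OF y(2)] DU by blast
    then have *: "D (P U) \<in> L" "D (Q U) \<in> L" "P U \<in> L" "Q U \<in> L"
      using polys_in_frac_field[OF E_sub, of _ J U] y by metis+
    show "y \<in> L" unfolding y(4) D_divide[OF y(3)] power2_eq_square
      by (intro is_subfieldD(4,7,8)[OF sub] *)
  qed
qed

text \<open>The ideal of relations between the entries of \<open>U\<close>, in the constant coordinates \<open>Y = U\<inverse> X\<close>
  and with coefficients extended to the whole field.\<close>

definition rels :: "(('n \<times> 'n \<Rightarrow> complex) \<Rightarrow> 'a) set" where
  "rels = {\<lambda>Y. P (mprod I U (cm Y)) | P. P \<in> polys E J \<and> P U = 0}"

lemma U_cm_polys: "v \<in> J \<Longrightarrow> (\<lambda>Y. mprod I U (cm Y) v) \<in> const_polys J"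
proof -
  assume v: "v \<in> J"
  have "(\<lambda>Y. cst (Y w)) \<in> const_polys J" if "w \<in> J" for w
    using poly_funs.var[OF that, of "\<lambda>v Y. cst (Y v)"] by simp
  then show ?thesis by (intro mprod_polys poly_funs.const v) auto
qed

lemma polys_U_cm: "P \<in> polys S J \<Longrightarrow> (\<lambda>Y. P (mprod I U (cm Y))) \<in> const_polys J"
  by (rule poly_funs_compose[where J = J and y = "\<lambda>v x. x v"]) (auto intro!: U_cm_polys)

lemma relsI: "P \<in> polys E J \<Longrightarrow> P U = 0 \<Longrightarrow> (\<lambda>Y. P (mprod I U (cm Y))) \<in> rels"
  unfolding rels_def by blast

text \<open>From Y = V X, the coordinate \<open>Y v\<close> is a combination of entries of X = U Y
  with scalars \<open>V (i, m)\<close>, and an entry of X times a relation is a relation.\<close>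

lemma var_mult_rels:
  assumes v: "v \<in> J" and w: "w \<in> pw.span rels"
  shows "(\<lambda>Y. cst (Y v) * w Y) \<in> pw.span rels"
  using w
proof (induction w rule: pw.span_induct_alt)
  case base
  then show ?case using pw.span_zero[of rels] by (simp add: zero_fun_def)
next
  case (step c x z)
  then obtain P where P: "P \<in> polys E J" "P U = 0" "x = (\<lambda>Y. P (mprod I U (cm Y)))"
    by (auto simp: rels_def)
  obtain i j where ij: "v = (i, j)" "i \<in> I" "j \<in> I" using v by auto
  have eq: "cst (Y v) = (\<Sum>m\<in>I. V (i, m) * mprod I U (cm Y) (m, j))" for Y
  proof -
    have "mprod I V (mprod I U (cm Y)) v = cm Y v"
      unfolding mprod_assoc[symmetric] by (rule mprod_one_left[OF finite_I VU v])
    then show ?thesis by (simp add: ij mprod_def)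
  qed
  have "(\<lambda>Y. mprod I U (cm Y) (m, j) * P (mprod I U (cm Y))) \<in> rels" if "m \<in> I" for m
  proof -
    have "(\<lambda>x. x (m, j) * P x) \<in> polys E J"
      by (intro poly_funs.mult polys_var P) (use that ij in auto)
    from relsI[OF this] show ?thesis using P by simp
  qed
  then have "(\<Sum>m\<in>I. (\<lambda>Y. V (i, m) * (mprod I U (cm Y) (m, j) * P (mprod I U (cm Y))))) \<in> pw.span rels"
    by (intro pw.span_sum pw.span_scale) (auto intro: pw.span_base)
  also have "(\<Sum>m\<in>I. (\<lambda>Y. V (i, m) * (mprod I U (cm Y) (m, j) * P (mprod I U (cm Y))))) = (\<lambda>Y. cst (Y v) * x Y)"
  proof
    fix Y
    show "(\<Sum>m\<in>I. (\<lambda>Y. V (i, m) * (mprod I U (cm Y) (m, j) * P (mprod I U (cm Y))))) Y = cst (Y v) * x Y"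
      by (simp add: sum_fun_apply eq P sum_distrib_right mult.assoc)
  qed
  finally have "(\<lambda>Y. c * (cst (Y v) * x Y)) + (\<lambda>Y. cst (Y v) * z Y) \<in> pw.span rels"
    using step by (intro pw.span_add pw.span_scale)
  then show ?case by (simp add: plus_fun_def algebra_simps)
qed

text \<open>Stability under \<open>D\<close> rests on \<open>D_polys\<close>: the derivative of the
  relation \<open>P\<close> along U Y is given by \<open>P'\<close>, and
  \<open>P' U = D (P U) = 0\<close> makes \<open>P'\<close> a relation as well.\<close>

lemma diff_ideal_rels: "diff_ideal J (pw.span rels)"
  unfolding diff_ideal_def
proof (intro conjI ballI subsetI)
  show "(\<lambda>_. 0) \<in> pw.span rels" using pw.span_zero[of rels] by (simp add: zero_fun_def)
next
  fix f assume "f \<in> pw.span rels"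
  then show "f \<in> const_polys J"
    by (rule span_subset_poly_funs) (auto simp: rels_def intro: polys_U_cm)
next
  fix f h assume "f \<in> pw.span rels" "h \<in> pw.span rels"
  then have "f + h \<in> pw.span rels" by (rule pw.span_add)
  then show "(\<lambda>t. f t + h t) \<in> pw.span rels" by (simp add: plus_fun_def)
next
  fix r f assume r: "r \<in> const_polys J" and f: "f \<in> pw.span rels"
  from r have "\<forall>f \<in> pw.span rels. (\<lambda>t. r t * f t) \<in> pw.span rels"
  proof (induction rule: poly_funs.induct)
    case (const s)
    then show ?case by (auto intro: pw.span_scale)
  next
    case (var v)
    then show ?case using var_mult_rels by blast
  next
    case (add r s)
    show ?case
    proof
      fix f assume "f \<in> pw.span rels"
      then have "(\<lambda>t. r t * f t) + (\<lambda>t. s t * f t) \<in> pw.span rels"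
        using add by (intro pw.span_add) auto
      then show "(\<lambda>t. (r t + s t) * f t) \<in> pw.span rels" by (simp add: plus_fun_def algebra_simps)
    qed
  next
    case (mult r s)
    show ?case
    proof
      fix f assume "f \<in> pw.span rels"
      then have "(\<lambda>t. s t * f t) \<in> pw.span rels" by (rule bspec[OF mult(4)])
      then have "(\<lambda>t. r t * (s t * f t)) \<in> pw.span rels" by (rule bspec[OF mult(3)])
      then show "(\<lambda>t. (r t * s t) * f t) \<in> pw.span rels" by (simp add: mult.assoc)
    qed
  qed
  then show "(\<lambda>t. r t * f t) \<in> pw.span rels" using f by blast
next
  fix f assume "f \<in> pw.span rels"
  then show "(\<lambda>t. D (f t)) \<in> pw.span rels"
  proof (induction f rule: pw.span_induct_alt)
    case base
    then show ?case using pw.span_zero[of rels] by (simp add: zero_fun_def)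
  next
    case (step c x z)
    then obtain P where P: "P \<in> polys E J" "P U = 0" "x = (\<lambda>Y. P (mprod I U (cm Y)))"
      by (auto simp: rels_def)
    obtain P' where P': "P' \<in> polys E J" "\<forall>x. (\<forall>v\<in>J. D (x v) = mprod I B x v) \<longrightarrow> D (P x) = P' x"
      using D_polys[OF P(1)] by blast
    have "P' U = 0" using P'(2) DU P(2) by force
    then have Dx: "(\<lambda>Y. D (x Y)) \<in> rels"
      using relsI[OF P'(1)] P'(2) D_U_cm by (simp add: P)
    have "(\<lambda>Y. D c * x Y) + ((\<lambda>Y. c * D (x Y)) + (\<lambda>Y. D (z Y))) \<in> pw.span rels"
      using step Dx by (intro pw.span_add pw.span_scale) (auto intro: pw.span_base)
    then show ?case by (simp add: plus_fun_def D_add D_mult algebra_simps)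
  qed
qed

text \<open>\<open>w\<close> is a sum of terms \<open>c * P\<close> with relations \<open>P\<close>.
  \<open>H\<close> is this sum as a polynomial in X, and \<open>H'\<close> has
  \<open>\<phi> c\<close> in place of \<open>c\<close>. At points over \<open>E\<close> the values
  of \<open>P\<close> lie in \<open>E\<close>, so \<open>\<phi>\<close> passes through to
  \<open>c\<close>.\<close>

lemma functional_on_rels:
  assumes \<phi>: "linear_functional E \<phi>" and w: "w \<in> pw.span rels"
  obtains H H' where "H \<in> polys UNIV J" "\<And>Y. w Y = H (mprod I U (cm Y))"
    "H' \<in> polys E J" "H' U = 0" "\<And>x. (\<And>v. v \<in> J \<Longrightarrow> x v \<in> E) \<Longrightarrow> \<phi> (H x) = H' x"
proof -
  note \<phi>D = linear_functionalD[OF \<phi>]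
  have "\<exists>H H'. H \<in> polys UNIV J \<and> (\<forall>Y. w Y = H (mprod I U (cm Y))) \<and>
    H' \<in> polys E J \<and> H' U = 0 \<and> (\<forall>x. (\<forall>v\<in>J. x v \<in> E) \<longrightarrow> \<phi> (H x) = H' x)"
    using w
  proof (induction w rule: pw.span_induct_alt)
    case base
    show ?case
      by (rule exI[of _ "\<lambda>_. 0"], rule exI[of _ "\<lambda>_. 0"]) (auto intro: poly_funs.const ED \<phi>D)
  next
    case (step c x z)
    then obtain P where P: "P \<in> polys E J" "P U = 0" "x = (\<lambda>Y. P (mprod I U (cm Y)))"
      by (auto simp: rels_def)
    from step obtain H H' where H: "H \<in> polys UNIV J" "\<forall>Y. z Y = H (mprod I U (cm Y))"
      "H' \<in> polys E J" "H' U = 0" "\<forall>x. (\<forall>v\<in>J. x v \<in> E) \<longrightarrow> \<phi> (H x) = H' x" by blast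
    show ?case
    proof (rule exI[of _ "\<lambda>x. c * P x + H x"], rule exI[of _ "\<lambda>x. \<phi> c * P x + H' x"], intro conjI allI impI)
      show "(\<lambda>x. c * P x + H x) \<in> polys UNIV J"
        by (intro poly_funs.add poly_funs.mult poly_funs.const H poly_funs_mono[OF P(1)]) auto
      show "(\<lambda>x. \<phi> c * P x + H' x) \<in> polys E J"
        by (intro poly_funs.add poly_funs.mult poly_funs.const H P \<phi>D)
      show "\<phi> (c * P x + H x) = \<phi> c * P x + H' x" if x: "\<forall>v\<in>J. x v \<in> E" for x
      proof -
        have "P x \<in> E" by (rule poly_funs_in_subfield[OF E_sub P(1)]) (use x in auto)
        then have "\<phi> (P x * c) = P x * \<phi> c" by (rule \<phi>D)
        then show ?thesis using H(5) x by (simp add: \<phi>D mult.commute)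
      qed
    qed (use P H in auto)
  qed
  then show ?thesis using that by blast
qed

text \<open>With \<open>z = P U / Q U\<close>, the point sought is a zero of all relations at which
  \<open>P - z Q\<close> does not vanish. It exists unless a power of \<open>P - z Q\<close> lies in
  the span of the relations, and applying a functional to the coefficients would then contradict
  \<open>tensor_difference_not_nilpotent\<close>.\<close>

lemma specialization_exists:
  assumes P: "P \<in> polys E J" and Q: "Q \<in> polys E J" "Q U \<noteq> 0" and z: "P U / Q U \<notin> E"
  shows "\<exists>A. (\<forall>R\<in>polys E J. R U = 0 \<longrightarrow> R (mprod I U (cm A)) = 0) \<and>
    P (mprod I U (cm A)) \<noteq> P U / Q U * Q (mprod I U (cm A))"
proof -
  define z where "z = P U / Q U"
  have PQ: "P U = z * Q U" using Q(2) by (simp add: z_def)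
  define g where "g Y = P (mprod I U (cm Y)) - z * Q (mprod I U (cm Y))" for Y
  have G: "(\<lambda>x. P x - z * Q x) \<in> polys UNIV J"
    by (intro poly_funs_diff poly_funs.mult poly_funs.const poly_funs_mono[OF P] poly_funs_mono[OF Q(1)])
       (auto simp: is_subfield_def)
  then have g: "g \<in> const_polys J" unfolding g_def by (rule polys_U_cm)
  have avoid: "(\<lambda>Y. g Y ^ N) \<notin> pw.span rels" for N
  proof
    assume w: "(\<lambda>Y. g Y ^ N) \<in> pw.span rels"
    obtain \<phi> where \<phi>: "linear_functional E \<phi>"
      "(\<Sum>k\<le>N. of_nat (N choose k) * (-1) ^ k * z ^ (N - k) * \<phi> (z ^ k)) \<noteq> 0"
      using tensor_difference_not_nilpotent[OF E_sub, of z N] z unfolding z_def by blast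
    note \<phi>D = linear_functionalD[OF \<phi>(1)]
    obtain H H' where H: "H \<in> polys UNIV J" "\<And>Y. g Y ^ N = H (mprod I U (cm Y))"
      "H' \<in> polys E J" "H' U = 0" "\<And>x. (\<And>v. v \<in> J \<Longrightarrow> x v \<in> E) \<Longrightarrow> \<phi> (H x) = H' x"
      using functional_on_rels[OF \<phi>(1) w] by blast
    let ?f = "\<lambda>x. (P x - z * Q x) ^ N - H x"
    have f: "?f \<in> polys UNIV J"
      by (intro poly_funs_diff poly_funs_power G H) (auto simp: is_subfield_def)
    then have fU: "(\<lambda>y. ?f (mprod I U y)) \<in> polys UNIV J"
      by (rule poly_funs_compose) (auto intro!: mprod_polys poly_funs.const polys_var)
    \<comment> \<open>The identity is known for constant matrices only; a grid of constants suffices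
      for all \<open>y\<close>.\<close>
    have f0: "?f (mprod I U y) = 0" for y
    proof (rule poly_funs_eq_0_if_grid[OF fU finite_J infinite_range_cst])
      fix x assume x: "\<And>v. v \<in> J \<Longrightarrow> x v \<in> range cst"
      define Y where "Y v = (SOME c. x v = cst c)" for v
      have Y: "x v = cst (Y v)" if "v \<in> J" for v
        unfolding Y_def by (rule someI_ex) (use x[OF that] in auto)
      have "?f (mprod I U x) = ?f (mprod I U (cm Y))"
        by (rule poly_funs_cong[OF f]) (auto intro!: mprod_cong Y)
      also have "\<dots> = 0" using H(2)[of Y] by (simp add: g_def)
      finally show "?f (mprod I U x) = 0" .
    qed
    \<comment> \<open>Every \<open>x\<close> is \<open>U y\<close> with
      \<open>y = V x\<close>.\<close>
    have f0': "?f x = 0" for x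
    proof -
      have "?f x = ?f (mprod I U (mprod I V x))"
        by (rule poly_funs_cong[OF f])
           (auto simp flip: mprod_assoc intro!: mprod_one_left[OF finite_I UV, symmetric])
      then show ?thesis using f0 by simp
    qed
    \<comment> \<open>The expansion of \<open>(P - z Q) ^ N\<close> with \<open>\<phi>\<close>
      applied to the powers of \<open>z\<close>.\<close>
    let ?G' = "\<lambda>x. \<Sum>k\<le>N. of_nat (N choose k) * (-1) ^ k * \<phi> (z ^ k) * (Q x ^ k * P x ^ (N - k))"
    have G': "?G' \<in> polys E J"
    proof (intro poly_funs_sum poly_funs.mult poly_funs_power P Q ED)
      fix k show "(\<lambda>x. of_nat (N choose k)) \<in> polys E J"
        by (intro poly_funs.const is_subfield_of_nat E_sub)
      show "(\<lambda>x. \<phi> (z ^ k)) \<in> polys E J" by (intro poly_funs.const \<phi>D)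
      show "(\<lambda>x. -1) \<in> polys E J" by (intro poly_funs.const ED)
    qed
    have eq: "?G' x = H' x" if x: "\<And>v. v \<in> J \<Longrightarrow> x v \<in> E" for x
    proof -
      have PQE: "P x \<in> E" "Q x \<in> E" using poly_funs_in_subfield[OF E_sub] P Q(1) x by blast+
      have "H x = (- (z * Q x) + P x) ^ N" using f0'[of x] by simp
      also have "\<dots> = (\<Sum>k\<le>N. of_nat (N choose k) * (- (z * Q x)) ^ k * P x ^ (N - k))"
        by (rule binomial_ring)
      also have "\<dots> = (\<Sum>k\<le>N. (of_nat (N choose k) * (-1) ^ k * (Q x ^ k * P x ^ (N - k))) * z ^ k)"
        by (intro sum.cong refl) (simp add: power_mult_distrib power_minus[of "z * Q x"] mult_ac)
      finally have "\<phi> (H x) = (\<Sum>k\<le>N. \<phi> ((of_nat (N choose k) * (-1) ^ k * (Q x ^ k * P x ^ (N - k))) * z ^ k))"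
        by (simp only: \<phi>D(5))
      also have "\<dots> = ?G' x"
      proof (intro sum.cong refl)
        fix k
        have "of_nat (N choose k) * (-1) ^ k * (Q x ^ k * P x ^ (N - k)) \<in> E"
          by (intro ED is_subfield_of_nat is_subfield_power E_sub PQE)
        from \<phi>D(2)[OF this, of "z ^ k"]
        show "\<phi> ((of_nat (N choose k) * (-1) ^ k * (Q x ^ k * P x ^ (N - k))) * z ^ k) =
          of_nat (N choose k) * (-1) ^ k * \<phi> (z ^ k) * (Q x ^ k * P x ^ (N - k))"
          by (simp add: mult_ac)
      qed
      finally show ?thesis using H(5)[OF x] by simp
    qed
    have "(\<lambda>x. ?G' x - H' x) \<in> polys UNIV J"
      by (intro poly_funs_diff poly_funs_mono[OF G'] poly_funs_mono[OF H(3)]) (auto simp: is_subfield_def)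
    \<comment> \<open>The identity holds at points over the infinite field \<open>E\<close>, hence
      at \<open>U\<close>. There \<open>H'\<close> vanishes, while \<open>?G'\<close> is
      \<open>Q U ^ N\<close> times the nonzero sum.\<close>
    from poly_funs_eq_0_if_grid[OF this finite_J infinite_E, of U] eq
    have "?G' U = H' U" by simp
    moreover have "?G' U = Q U ^ N * (\<Sum>k\<le>N. of_nat (N choose k) * (-1) ^ k * z ^ (N - k) * \<phi> (z ^ k))"
      unfolding sum_distrib_left
    proof (intro sum.cong refl)
      fix k assume "k \<in> {..N}"
      then have "Q U ^ N = Q U ^ k * Q U ^ (N - k)" by (simp flip: power_add)
      then show "of_nat (N choose k) * (-1) ^ k * \<phi> (z ^ k) * (Q U ^ k * P U ^ (N - k)) =
        Q U ^ N * (of_nat (N choose k) * (-1) ^ k * z ^ (N - k) * \<phi> (z ^ k))"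
        by (simp add: PQ power_mult_distrib mult_ac)
    qed
    ultimately show False using \<phi>(2) H(4) Q(2) by simp
  qed
  have "\<exists>A. (\<forall>w\<in>pw.span rels. w A = 0) \<and> g A \<noteq> 0"
    by (rule constant_point_exists[OF finite_J diff_ideal_rels g avoid])
  then obtain A where A: "\<forall>w\<in>pw.span rels. w A = 0" "g A \<noteq> 0" by (elim exE conjE)
  show ?thesis
  proof (intro exI[of _ A] conjI ballI impI)
    show "R (mprod I U (cm A)) = 0" if "R \<in> polys E J" "R U = 0" for R
      by (rule bspec[OF A(1) pw.span_base[OF relsI[OF that]]])
    show "P (mprod I U (cm A)) \<noteq> P U / Q U * Q (mprod I U (cm A))"
      using A(2) by (simp add: g_def z_def)
  qed
qed

subsection \<open>Automorphisms\<close>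

text \<open>By \<open>D_V\<close> the derivative of \<open>V x\<close> is
  \<open>- V B x + V B x = 0\<close>, so its entries are complex constants.\<close>

lemma constant_quotient:
  assumes x: "\<And>v. v \<in> J \<Longrightarrow> D (x v) = mprod I B x v"
  shows "\<exists>A. \<forall>v\<in>J. x v = mprod I U (cm A) v \<and> mprod I V x v = cst (A v)"
proof -
  have "D (mprod I V x v) = 0" if v: "v \<in> J" for v
  proof -
    have "mprod I (\<lambda>v. D (V v)) x v = mprod I (\<lambda>v. - mprod I V B v) x v"
      by (rule mprod_cong) (auto simp: D_V v)
    also have "\<dots> = - mprod I (mprod I V B) x v" by (cases v) (simp add: mprod_def sum_negf)
    finally have "mprod I (\<lambda>v. D (V v)) x v = - mprod I V (mprod I B x) v" by (simp only: mprod_assoc)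
    moreover have "mprod I V (\<lambda>v. D (x v)) v = mprod I V (mprod I B x) v"
      by (rule mprod_cong) (auto simp: x v)
    ultimately show ?thesis by (simp add: mprod_D)
  qed
  then have "\<exists>c. mprod I V x v = cst c" if "v \<in> J" for v using that by (auto simp: D_eq_0_iff)
  then obtain A where A: "\<And>v. v \<in> J \<Longrightarrow> mprod I V x v = cst (A v)" by metis
  have "x v = mprod I U (cm A) v" if v: "v \<in> J" for v
  proof -
    have "mprod I U (cm A) v = mprod I U (mprod I V x) v"
      by (rule mprod_cong) (auto simp: A v)
    also have "\<dots> = x v" unfolding mprod_assoc[symmetric] by (rule mprod_one_left[OF finite_I UV v])
    finally show ?thesis by simp
  qed
  with A show ?thesis by (intro exI[of _ A]) simp
qed

lemma mprod_cm_E: "P \<in> polys E J \<Longrightarrow> (\<lambda>x. P (mprod I x (cm A))) \<in> polys E J"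
  by (rule poly_funs_compose[where J = J and y = "\<lambda>v x. x v"])
     (auto intro!: mprod_polys polys_var poly_funs.const cst_E ED)

text \<open>The entries of X A are linear forms in those of X, so the substitution does not raise
  the degree; \<open>specialization_injective\<close> can therefore count dimensions.\<close>

lemma linear_substitution_span_monoms:
  assumes "f \<in> pw.span (monoms J (\<lambda>v x. x v) d)"
  shows "(\<lambda>x. f (mprod I x (cm A))) \<in> pw.span (monoms J (\<lambda>v x. x v) d)"
proof -
  let ?M = "monoms J (\<lambda>v (x :: 'n \<times> 'n \<Rightarrow> 'a). x v)"
  have lin: "(\<lambda>x. mprod I x (cm A) v) \<in> pw.span (?M 1)" if "v \<in> J" for v
  proof -
    obtain i j where v: "v = (i, j)" "i \<in> I" "j \<in> I" using \<open>v \<in> J\<close> by auto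
    have "(\<lambda>x. x (i, k)) \<in> ?M 1" if "k \<in> I" for k
      unfolding monoms_def by (rule image_eqI[of _ _ "[(i, k)]"]) (use that v in auto)
    then have "(\<Sum>k\<in>I. (\<lambda>x. cst (A (k, j)) * x (i, k))) \<in> pw.span (?M 1)"
      by (intro pw.span_sum pw.span_scale) (auto intro: pw.span_base)
    also have "(\<Sum>k\<in>I. (\<lambda>x. cst (A (k, j)) * x (i, k))) = (\<lambda>x. mprod I x (cm A) v)"
    proof
      fix x :: "'n \<times> 'n \<Rightarrow> 'a"
      show "(\<Sum>k\<in>I. (\<lambda>x. cst (A (k, j)) * x (i, k))) x = mprod I x (cm A) v"
        by (simp add: sum_fun_apply v mprod_def mult.commute)
    qed
    finally show ?thesis .
  qed
  have mon: "(\<lambda>x. prod_list (map (\<lambda>v. mprod I x (cm A) v) l)) \<in> pw.span (?M (length l))"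
    if "set l \<subseteq> J" for l
    using that
  proof (induction l)
    case Nil
    have "(\<lambda>_. 1) \<in> ?M 0" by (auto simp: monoms_def)
    then show ?case by (simp add: pw.span_base)
  next
    case (Cons v l)
    then show ?case using span_monoms_mult[OF lin[of v] Cons.IH] by simp
  qed
  show ?thesis using assms
  proof (induction f rule: pw.span_induct_alt)
    case base
    then show ?case using pw.span_zero[of "?M d"] by (simp add: zero_fun_def)
  next
    case (step c m z)
    then obtain l where l: "m = (\<lambda>x. prod_list (map (\<lambda>v. x v) l))" "set l \<subseteq> J" "length l \<le> d"
      by (auto simp: monoms_def)
    have "(\<lambda>x. m (mprod I x (cm A))) \<in> pw.span (?M d)"
      using mon[OF l(2)] pw.span_mono[OF monoms_mono[OF l(3)], of J "\<lambda>v x. x v"] unfolding l(1) by blast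
    then have "(\<lambda>x. c * m (mprod I x (cm A))) + (\<lambda>x. z (mprod I x (cm A))) \<in> pw.span (?M d)"
      using step by (intro pw.span_add pw.span_scale)
    then show ?case by (simp add: plus_fun_def)
  qed
qed

text \<open>In degree at most \<open>d\<close> the substitution \<open>X \<mapsto> X A\<close> is an injective linear endomorphism of the
  finite-dimensional space of relations, hence surjective.\<close>

lemma specialization_injective:
  assumes AA': "\<And>v. v \<in> J \<Longrightarrow> mprod I (cm A) (cm A') v = mone v"
    and A'A: "\<And>v. v \<in> J \<Longrightarrow> mprod I (cm A') (cm A) v = mone v"
    and rel: "\<And>R. R \<in> polys E J \<Longrightarrow> R U = 0 \<Longrightarrow> R (mprod I U (cm A)) = 0"
    and P: "P \<in> polys E J" "P (mprod I U (cm A)) = 0"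
  shows "P U = 0"
proof -
  let ?\<rho> = "\<lambda>f x. f (mprod I x (cm A))"
  define q where "q = {R \<in> polys E J. R U = 0}"
  obtain d where d: "P \<in> pw.span (monoms J (\<lambda>v x. x v) d)" by (rule poly_funs_in_span_monoms[OF P(1)])
  define M where "M = monoms J (\<lambda>v (x :: 'n \<times> 'n \<Rightarrow> 'a). x v) d"
  \<comment> \<open>Spans are taken over the ambient field; \<open>S\<close> consists of the
    combinations of relations that have degree at most \<open>d\<close>.\<close>
  define S where "S = {f \<in> pw.span M. f \<in> pw.span q}"
  have \<rho>q: "?\<rho> R \<in> q" if "R \<in> q" for R
    using that mprod_cm_E rel unfolding q_def by blast
  have \<rho>_span_q: "?\<rho> f \<in> pw.span q" if "f \<in> pw.span q" for f
    using that
  proof (induction f rule: pw.span_induct_alt)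
    case base
    then show ?case using pw.span_zero[of q] by (simp add: zero_fun_def)
  next
    case (step c m z)
    then have "(\<lambda>x. c * ?\<rho> m x) + ?\<rho> z \<in> pw.span q"
      by (intro pw.span_add pw.span_scale) (auto intro: pw.span_base \<rho>q)
    then show ?case by (simp add: plus_fun_def)
  qed
  have \<rho>S: "?\<rho> f \<in> S" if "f \<in> S" for f
    using that linear_substitution_span_monoms \<rho>_span_q unfolding S_def M_def by blast
  have \<rho>_inj: "f = 0" if f: "f \<in> pw.span M" and 0: "?\<rho> f = 0" for f
  proof
    fix x
    have fp: "f \<in> polys UNIV J"
      by (rule span_subset_poly_funs[OF f]) (simp add: M_def monoms_subset_poly_funs)
    have "f x = f (mprod I (mprod I x (cm A')) (cm A))"
      by (rule poly_funs_cong[OF fp]) (auto simp: mprod_assoc intro!: mprod_one_right[OF finite_I A'A, symmetric])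
    also have "\<dots> = 0" using fun_cong[OF 0, of "mprod I x (cm A')"] by simp
    finally show "f x = 0 x" by simp
  qed
  obtain Bs where Bs: "Bs \<subseteq> S" "pw.independent Bs" "S \<subseteq> pw.span Bs"
    by (rule pw.maximal_independent_subset)
  have finM: "finite M" unfolding M_def by (rule finite_monoms[OF finite_J])
  have "Bs \<subseteq> pw.span M" using Bs(1) by (auto simp: S_def)
  then have finBs: "finite Bs" using pw.independent_span_bound[OF finM Bs(2)] by blast
  \<comment> \<open>Otherwise \<open>P\<close> extends a basis of \<open>S\<close> to a larger
    independent set, which the injective substitution maps into \<open>S\<close>.\<close>
  have "P \<in> S"
  proof (rule ccontr)
    assume "P \<notin> S"
    have PM: "P \<in> pw.span M" using d by (simp add: M_def)
    have subspS: "pw.span Bs \<subseteq> S"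
    proof
      fix f assume f: "f \<in> pw.span Bs"
      have "pw.span Bs \<subseteq> pw.span (pw.span M)" "pw.span Bs \<subseteq> pw.span (pw.span q)"
        using Bs(1) by (intro pw.span_mono; auto simp: S_def)+
      then show "f \<in> S" using f unfolding pw.span_span S_def by blast
    qed
    then have "P \<notin> pw.span Bs" using \<open>P \<notin> S\<close> by blast
    then have ind: "pw.independent (insert P Bs)" "P \<notin> Bs"
      using Bs(2) pw.independent_insert[of P Bs] pw.span_base[of P Bs] by auto
    have "?\<rho> P \<in> q" using P mprod_cm_E[OF P(1)] by (auto simp: q_def)
    then have "?\<rho> P \<in> S"
      using linear_substitution_span_monoms[OF d] pw.span_base[of "?\<rho> P" q] by (simp add: S_def M_def)
    then have \<rho>Bs: "?\<rho> f \<in> pw.span Bs" if "f \<in> insert P Bs" for f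
      using that \<rho>S Bs(1,3) by blast
    have "\<exists>\<mu>. (\<exists>f\<in>insert P Bs. \<mu> f \<noteq> 0) \<and> (\<Sum>f\<in>insert P Bs. (\<lambda>t. \<mu> f * ?\<rho> f t)) = 0"
      by (rule pw.nontrivial_relation_in_span[OF finBs]) (use finBs ind(2) \<rho>Bs in simp_all)
    then obtain \<mu> where \<mu>: "\<exists>f\<in>insert P Bs. \<mu> f \<noteq> 0" "(\<Sum>f\<in>insert P Bs. (\<lambda>t. \<mu> f * ?\<rho> f t)) = 0"
      by (elim exE conjE)
    let ?f = "\<Sum>f\<in>insert P Bs. (\<lambda>t. \<mu> f * f t)"
    have "?\<rho> ?f = (\<Sum>f\<in>insert P Bs. (\<lambda>t. \<mu> f * ?\<rho> f t))"
      by (rule ext, subst sum_fun_apply, subst sum_fun_apply, rule refl)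
    then have f0: "?\<rho> ?f = 0" using \<mu>(2) by (simp only:)
    have "?f \<in> pw.span M"
    proof (rule pw.span_sum)
      fix f assume "f \<in> insert P Bs"
      then have "f \<in> pw.span M" using PM \<open>Bs \<subseteq> pw.span M\<close> by blast
      then show "(\<lambda>t. \<mu> f * f t) \<in> pw.span M" by (rule pw.span_scale)
    qed
    then have "?f = 0" using f0 by (rule \<rho>_inj)
    with \<mu>(1) have "pw.dependent (insert P Bs)"
      unfolding pw.dependent_finite[OF finite.insertI[OF finBs]] by (intro exI[of _ \<mu>] conjI)
    with ind(1) show False by (rule notE)
  qed
  \<comment> \<open>Evaluation at \<open>U\<close> is linear and kills \<open>q\<close>, so lying in
    the span over the larger field is enough.\<close>
  have "f U = 0" if "f \<in> pw.span q" for f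
    using that by (induction f rule: pw.span_induct_alt) (auto simp: q_def)
  then show ?thesis using \<open>P \<in> S\<close> by (simp add: S_def)
qed

text \<open>\<open>P U / Q U\<close> is sent to \<open>P (U A) / Q (U A)\<close>. By
  \<open>rel\<close> this is well defined, by \<open>specialization_injective\<close> it is
  injective and no denominator vanishes, \<open>A'\<close> provides preimages, and
  \<open>U A\<close> solves the same system, so \<open>D\<close> is respected.\<close>

lemma automorphism_of_specialization:
  assumes AA': "\<And>v. v \<in> J \<Longrightarrow> mprod I (cm A) (cm A') v = mone v"
    and A'A: "\<And>v. v \<in> J \<Longrightarrow> mprod I (cm A') (cm A) v = mone v"
    and rel: "\<And>R. R \<in> polys E J \<Longrightarrow> R U = 0 \<Longrightarrow> R (mprod I U (cm A)) = 0"
  shows "\<exists>\<sigma>. diff_aut E L \<sigma> \<and> (\<forall>P\<in>polys E J. \<sigma> (P U) = P (mprod I U (cm A)))"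
proof -
  let ?W = "mprod I U (cm A)"
  have inj: "P U = 0" if "P \<in> polys E J" "P ?W = 0" for P
    by (rule specialization_injective[where A = A and A' = A']) (fact AA' A'A rel that)+
  \<comment> \<open>An arbitrary choice of numerator and denominator; the statement named
    \<open>\<sigma>\<close> below shows that the value does not depend on it.\<close>
  define num where "num x = (SOME PQ. fst PQ \<in> polys E J \<and> snd PQ \<in> polys E J \<and> snd PQ U \<noteq> 0 \<and> x = fst PQ U / snd PQ U)" for x
  define \<sigma> where "\<sigma> x = fst (num x) ?W / snd (num x) ?W" for x
  have nz: "Q ?W \<noteq> 0" if "Q \<in> polys E J" "Q U \<noteq> 0" for Q
    using inj[OF that(1)] that(2) by blast
  have \<sigma>: "\<sigma> (P U / Q U) = P ?W / Q ?W" if PQ: "P \<in> polys E J" "Q \<in> polys E J" "Q U \<noteq> 0" for P Q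
  proof -
    define P' where "P' = fst (num (P U / Q U))"
    define Q' where "Q' = snd (num (P U / Q U))"
    have "P' \<in> polys E J \<and> Q' \<in> polys E J \<and> Q' U \<noteq> 0 \<and> P U / Q U = P' U / Q' U"
      unfolding P'_def Q'_def num_def by (rule someI[where x = "(P, Q)"]) (use PQ in auto)
    then have *: "P' \<in> polys E J" "Q' \<in> polys E J" "Q' U \<noteq> 0" "P U * Q' U - P' U * Q U = 0"
      using PQ(3) by (auto simp: field_simps)
    have "(\<lambda>x. P x * Q' x - P' x * Q x) \<in> polys E J"
      by (intro poly_funs_diff poly_funs.mult E_sub PQ *)
    from rel[OF this *(4)] have "P ?W * Q' ?W = P' ?W * Q ?W" by simp
    then have "P' ?W / Q' ?W = P ?W / Q ?W"
      using nz[OF PQ(2,3)] nz[OF *(2,3)] by (simp add: field_simps)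
    then show ?thesis by (simp add: \<sigma>_def P'_def Q'_def)
  qed
  have one: "(\<lambda>_. 1) \<in> polys E J" by (intro poly_funs.const ED)
  have \<sigma>P: "\<sigma> (P U) = P ?W" if "P \<in> polys E J" for P
    using \<sigma>[OF that one] by simp
  have "diff_aut E L \<sigma>"
    unfolding diff_aut_def
  proof (intro conjI ballI)
    fix x y assume "x \<in> L" "y \<in> L"
    then obtain P Q P' Q' where x: "P \<in> polys E J" "Q \<in> polys E J" "Q U \<noteq> 0" "x = P U / Q U"
      and y: "P' \<in> polys E J" "Q' \<in> polys E J" "Q' U \<noteq> 0" "y = P' U / Q' U"
      by (elim frac_fieldE)
    have QQ: "(\<lambda>x. Q x * Q' x) \<in> polys E J" "Q U * Q' U \<noteq> 0"
      using x y by (auto intro: poly_funs.mult)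
    have "(\<lambda>x. P x * Q' x + P' x * Q x) \<in> polys E J" by (intro poly_funs.add poly_funs.mult x y)
    from \<sigma>[OF this QQ] show "\<sigma> (x + y) = \<sigma> x + \<sigma> y"
      using x(3) y(3) nz[OF x(2,3)] nz[OF y(2,3)] by (simp add: x(4) y(4) \<sigma>[OF x(1-3)] \<sigma>[OF y(1-3)] add_frac_eq)
    have "(\<lambda>x. P x * P' x) \<in> polys E J" by (intro poly_funs.mult x y)
    from \<sigma>[OF this QQ] show "\<sigma> (x * y) = \<sigma> x * \<sigma> y"
      by (simp add: x(4) y(4) \<sigma>[OF x(1-3)] \<sigma>[OF y(1-3)])
  next
    fix x assume "x \<in> L"
    then obtain P Q where x: "P \<in> polys E J" "Q \<in> polys E J" "Q U \<noteq> 0" "x = P U / Q U"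
      by (elim frac_fieldE)
    obtain P' Q' where P': "P' \<in> polys E J" "\<forall>x. (\<forall>v\<in>J. D (x v) = mprod I B x v) \<longrightarrow> D (P x) = P' x"
      and Q': "Q' \<in> polys E J" "\<forall>x. (\<forall>v\<in>J. D (x v) = mprod I B x v) \<longrightarrow> D (Q x) = Q' x"
      using D_polys[OF x(1)] D_polys[OF x(2)] by blast
    have QQ: "(\<lambda>x. (Q x)\<^sup>2) \<in> polys E J" "(Q U)\<^sup>2 \<noteq> 0"
      using x by (auto intro!: poly_funs_power ED)
    have PQ: "(\<lambda>x. P' x * Q x - P x * Q' x) \<in> polys E J"
      by (intro poly_funs_diff E_sub poly_funs.mult x P' Q')
    have "D x = (P' U * Q U - P U * Q' U) / (Q U)\<^sup>2"
      using P'(2) Q'(2) DU by (simp add: x(4) D_divide[OF x(3)])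
    moreover have "D (\<sigma> x) = (P' ?W * Q ?W - P ?W * Q' ?W) / (Q ?W)\<^sup>2"
      using P'(2) Q'(2) D_U_cm by (simp add: x(4) \<sigma>[OF x(1-3)] D_divide[OF nz[OF x(2,3)]])
    ultimately show "D (\<sigma> x) = \<sigma> (D x)" using \<sigma>[OF PQ QQ] by simp
  next
    fix x assume "x \<in> E"
    then show "\<sigma> x = x" using \<sigma>P[OF poly_funs.const] by simp
  next
    show "bij_betw \<sigma> L L"
      unfolding bij_betw_def
    proof
      show "inj_on \<sigma> L"
      proof (rule inj_onI)
        fix x y assume "x \<in> L" "y \<in> L" and eq: "\<sigma> x = \<sigma> y"
        then obtain P Q P' Q' where x: "P \<in> polys E J" "Q \<in> polys E J" "Q U \<noteq> 0" "x = P U / Q U"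
          and y: "P' \<in> polys E J" "Q' \<in> polys E J" "Q' U \<noteq> 0" "y = P' U / Q' U"
          by (elim frac_fieldE)
        have "P ?W * Q' ?W - P' ?W * Q ?W = 0"
          using eq nz[OF x(2,3)] nz[OF y(2,3)]
          by (simp add: x(4) y(4) \<sigma>[OF x(1-3)] \<sigma>[OF y(1-3)] field_simps)
        moreover have "(\<lambda>x. P x * Q' x - P' x * Q x) \<in> polys E J"
          by (intro poly_funs_diff poly_funs.mult E_sub x y)
        ultimately have "P U * Q' U - P' U * Q U = 0" using inj by blast
        then show "x = y" using x(3) y(3) by (simp add: x(4) y(4) field_simps)
      qed
      have into: "\<sigma> x \<in> L" if xL: "x \<in> L" for x
      proof -
        obtain P Q where x: "P \<in> polys E J" "Q \<in> polys E J" "Q U \<noteq> 0" "x = P U / Q U"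
          using xL by (elim frac_fieldE)
        show ?thesis unfolding x(4) \<sigma>[OF x(1-3)]
        proof (rule frac_fieldI)
          show "(\<lambda>x. P (mprod I x (cm A))) \<in> polys E J" "(\<lambda>x. Q (mprod I x (cm A))) \<in> polys E J"
            by (intro mprod_cm_E x)+
        qed (use nz[OF x(2,3)] in simp_all)
      qed
      have onto: "x \<in> \<sigma> ` L" if xL: "x \<in> L" for x
      proof -
        obtain P Q where x: "P \<in> polys E J" "Q \<in> polys E J" "Q U \<noteq> 0" "x = P U / Q U"
          using xL by (elim frac_fieldE)
        \<comment> \<open>Preimages arise by substituting X A' for X, which the specialization at U
          A undoes.\<close>
        have undo: "R (mprod I ?W (cm A')) = R U" if "R \<in> polys E J" for R
          by (rule poly_funs_cong[OF that]) (auto simp: mprod_assoc intro!: mprod_one_right[OF finite_I AA'])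
        have P': "(\<lambda>x. P (mprod I x (cm A'))) \<in> polys E J" and Q': "(\<lambda>x. Q (mprod I x (cm A'))) \<in> polys E J"
          by (intro mprod_cm_E x)+
        have Q0: "Q (mprod I U (cm A')) \<noteq> 0"
        proof
          assume "Q (mprod I U (cm A')) = 0"
          from rel[OF Q' this] show False using undo[OF x(2)] x(3) by simp
        qed
        have eq: "\<sigma> (P (mprod I U (cm A')) / Q (mprod I U (cm A'))) = x"
          using \<sigma>[OF P' Q' Q0] undo[OF x(1)] undo[OF x(2)] by (simp add: x(4))
        have "P (mprod I U (cm A')) / Q (mprod I U (cm A')) \<in> L"
        proof (rule frac_fieldI)
          show "(\<lambda>x. P (mprod I x (cm A'))) \<in> polys E J" "(\<lambda>x. Q (mprod I x (cm A'))) \<in> polys E J"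
            by (fact P' Q')+
        qed (fact Q0 refl)+
        with eq show ?thesis by (metis image_eqI)
      qed
      show "\<sigma> ` L = L" using into onto by blast
    qed
  qed
  then show ?thesis using \<sigma>P by (intro exI[of _ \<sigma>] conjI ballI)
qed

text \<open>The matrix \<open>A\<close> from \<open>specialization_exists\<close> could be singular.
  As the entries of \<open>V\<close> are polynomials in \<open>U\<close>, the equations U V = V U =
  1 become relations, survive the specialization and make \<open>A\<close> invertible.\<close>

theorem automorphism_moving:
  assumes V: "\<And>v. v \<in> J \<Longrightarrow> \<exists>P\<in>polys E J. P U = V v"
    and z: "z \<in> L" "z \<notin> E"
  shows "\<exists>\<sigma>. diff_aut E L \<sigma> \<and> \<sigma> z \<noteq> z"
proof -
  obtain P Q where PQ: "P \<in> polys E J" "Q \<in> polys E J" "Q U \<noteq> 0" "z = P U / Q U"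
    using z(1) by (rule frac_fieldE)
  have "P U / Q U \<notin> E" using z(2) PQ(4) by simp
  from specialization_exists[OF PQ(1-3) this]
  obtain A where rel': "\<forall>R\<in>polys E J. R U = 0 \<longrightarrow> R (mprod I U (cm A)) = 0"
    and ne': "P (mprod I U (cm A)) \<noteq> P U / Q U * Q (mprod I U (cm A))"
    by (elim exE conjE)
  have rel: "R (mprod I U (cm A)) = 0" if "R \<in> polys E J" "R U = 0" for R
    by (rule bspec[OF rel' that(1), THEN mp, OF that(2)])
  have ne: "P (mprod I U (cm A)) \<noteq> z * Q (mprod I U (cm A))" using ne' PQ(4) by simp
  let ?W = "mprod I U (cm A)"
  obtain R where R: "\<And>v. v \<in> J \<Longrightarrow> R v \<in> polys E J" "\<And>v. v \<in> J \<Longrightarrow> R v U = V v"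
    using V by metis
  define V' where "V' v = R v ?W" for v
  have one: "(\<lambda>_. mone v) \<in> polys E J" for v :: "'n \<times> 'n"
    by (rule poly_funs.const) (cases v; simp add: mone_def ED(1,2))
  have WV': "mprod I ?W V' v = mone v" if v: "v \<in> J" for v
  proof -
    have "(\<lambda>x. mprod I x (\<lambda>v. R v x) v) \<in> polys E J" by (intro mprod_polys polys_var R(1) ED(1) v)
    then have 1: "(\<lambda>x. mprod I x (\<lambda>v. R v x) v - mone v) \<in> polys E J"
      by (rule poly_funs_diff[OF E_sub _ one])
    have "mprod I U (\<lambda>v. R v U) v = mprod I U V v" by (rule mprod_cong) (auto simp: R(2) v)
    then have "mprod I U (\<lambda>v. R v U) v - mone v = 0" using UV[OF v] by simp
    from rel[OF 1 this] show ?thesis by (simp add: V'_def[abs_def])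
  qed
  have V'W: "mprod I V' ?W v = mone v" if v: "v \<in> J" for v
  proof -
    have "(\<lambda>x. mprod I (\<lambda>v. R v x) x v) \<in> polys E J" by (intro mprod_polys polys_var R(1) ED(1) v)
    then have 1: "(\<lambda>x. mprod I (\<lambda>v. R v x) x v - mone v) \<in> polys E J"
      by (rule poly_funs_diff[OF E_sub _ one])
    have "mprod I (\<lambda>v. R v U) U v = mprod I V U v" by (rule mprod_cong) (auto simp: R(2) v)
    then have "mprod I (\<lambda>v. R v U) U v - mone v = 0" using VU[OF v] by simp
    from rel[OF 1 this] show ?thesis by (simp add: V'_def[abs_def])
  qed
  \<comment> \<open>\<open>V'\<close> inverts U A, so \<open>V' U\<close> inverts \<open>A\<close>;
    its derivative vanishes because that of \<open>A\<close> does.\<close>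
  let ?A' = "mprod I V' U"
  have A1: "mprod I (cm A) ?A' v = mone v" if v: "v \<in> J" for v
  proof -
    have "mprod I U (mprod I (cm A) V') w = mone w" if w: "w \<in> J" for w
      using WV'[OF w] by (simp only: mprod_assoc)
    then have "mprod I V (mprod I U (mprod I (cm A) V')) w = V w" if "w \<in> J" for w
      using that by (intro mprod_one_right finite_I)
    moreover have "mprod I V (mprod I U (mprod I (cm A) V')) w = mprod I (cm A) V' w" if "w \<in> J" for w
      unfolding mprod_assoc[of I V, symmetric] using that by (intro mprod_one_left finite_I VU)
    ultimately have "mprod I (mprod I (cm A) V') U v = mprod I V U v"
      by (intro mprod_cong v) auto
    then show ?thesis by (simp add: mprod_assoc VU[OF v])
  qed
  have A2: "mprod I ?A' (cm A) v = mone v" if v: "v \<in> J" for v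
    using V'W[OF v] by (simp only: mprod_assoc)
  have "D (?A' v) = 0" if v: "v \<in> J" for v
  proof -
    have "mprod I (\<lambda>w. D (?A' w)) (cm A) w = 0" if w: "w \<in> J" for w
    proof -
      have "D (mprod I ?A' (cm A) w) = 0" unfolding A2[OF w] by (cases w) (simp add: mone_def)
      moreover have "mprod I ?A' (\<lambda>v. D (cst (A v))) w = 0" by (cases w) (simp add: mprod_def)
      ultimately show ?thesis by (simp add: mprod_D)
    qed
    then have "mprod I (mprod I (\<lambda>w. D (?A' w)) (cm A)) ?A' v = mprod I (\<lambda>_. 0) ?A' v"
      by (intro mprod_cong v) auto
    moreover have "mprod I (mprod I (\<lambda>w. D (?A' w)) (cm A)) ?A' v = D (?A' v)"
      unfolding mprod_assoc[of I _ "cm A"] by (rule mprod_one_right[OF finite_I A1 v])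
    ultimately show ?thesis by (cases v) (simp add: mprod_def)
  qed
  then have "\<exists>c. ?A' v = cst c" if "v \<in> J" for v using that by (auto simp: D_eq_0_iff)
  then obtain A' where A': "\<And>v. v \<in> J \<Longrightarrow> ?A' v = cst (A' v)" by metis
  have "mprod I (cm A) (cm A') v = mprod I (cm A) ?A' v" "mprod I (cm A') (cm A) v = mprod I ?A' (cm A) v"
    if "v \<in> J" for v
    by (rule mprod_cong[OF _ _ that]; simp add: A')+
  then have AA': "\<And>v. v \<in> J \<Longrightarrow> mprod I (cm A) (cm A') v = mone v"
    and A'A: "\<And>v. v \<in> J \<Longrightarrow> mprod I (cm A') (cm A) v = mone v"
    using A1 A2 by simp_all
  have "\<exists>\<sigma>. diff_aut E L \<sigma> \<and> (\<forall>P\<in>polys E J. \<sigma> (P U) = P ?W)"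
    by (rule automorphism_of_specialization[where A = A and A' = A']) (fact AA' A'A rel)+
  then obtain \<sigma> where \<sigma>: "diff_aut E L \<sigma>" "\<forall>P\<in>polys E J. \<sigma> (P U) = P ?W" by (elim exE conjE)
  have "\<sigma> z \<noteq> z"
  proof
    assume eq: "\<sigma> z = z"
    have "z * Q U = P U" using PQ(3,4) by simp
    moreover have "\<sigma> (z * Q U) = \<sigma> z * \<sigma> (Q U)"
      using \<sigma>(1) z(1) polys_in_frac_field[OF E_sub PQ(2), of U] unfolding diff_aut_def by blast
    ultimately show False using ne bspec[OF \<sigma>(2) PQ(1)] bspec[OF \<sigma>(2) PQ(2)] eq by simp
  qed
  with \<sigma>(1) show ?thesis by blast
qed

end

context diff_field begin

lemma diff_autD:
  assumes "diff_aut E L \<sigma>" "is_subfield L"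
  shows "x \<in> L \<Longrightarrow> \<sigma> x \<in> L" "x \<in> L \<Longrightarrow> y \<in> L \<Longrightarrow> \<sigma> (x + y) = \<sigma> x + \<sigma> y"
    "x \<in> L \<Longrightarrow> y \<in> L \<Longrightarrow> \<sigma> (x * y) = \<sigma> x * \<sigma> y" "x \<in> L \<Longrightarrow> D (\<sigma> x) = \<sigma> (D x)" "x \<in> E \<Longrightarrow> \<sigma> x = x"
    "\<sigma> 0 = 0" "\<sigma> 1 = 1" "x \<in> L \<Longrightarrow> y \<in> L \<Longrightarrow> \<sigma> x = \<sigma> y \<Longrightarrow> x = y" "x \<in> L \<Longrightarrow> \<exists>y\<in>L. \<sigma> y = x"
    "x \<in> L \<Longrightarrow> \<sigma> (- x) = - \<sigma> x" "x \<in> L \<Longrightarrow> \<sigma> (inverse x) = inverse (\<sigma> x)"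
    "x \<in> L \<Longrightarrow> y \<in> L \<Longrightarrow> \<sigma> (x / y) = \<sigma> x / \<sigma> y"
    "(\<And>i. i \<in> A \<Longrightarrow> f i \<in> L) \<Longrightarrow> \<sigma> (sum f A) = (\<Sum>i\<in>A. \<sigma> (f i))"
proof -
  note LD = is_subfieldD[OF assms(2)]
  show into: "x \<in> L \<Longrightarrow> \<sigma> x \<in> L" for x using assms(1) unfolding diff_aut_def bij_betw_def by blast
  show add: "x \<in> L \<Longrightarrow> y \<in> L \<Longrightarrow> \<sigma> (x + y) = \<sigma> x + \<sigma> y"
    and mult: "x \<in> L \<Longrightarrow> y \<in> L \<Longrightarrow> \<sigma> (x * y) = \<sigma> x * \<sigma> y"
    and "x \<in> L \<Longrightarrow> D (\<sigma> x) = \<sigma> (D x)" "x \<in> E \<Longrightarrow> \<sigma> x = x" for x y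
    using assms(1) unfolding diff_aut_def by blast+
  show inj: "x \<in> L \<Longrightarrow> y \<in> L \<Longrightarrow> \<sigma> x = \<sigma> y \<Longrightarrow> x = y" for x y
    using assms(1) unfolding diff_aut_def bij_betw_def inj_on_def by blast
  have "\<sigma> ` L = L" using assms(1) unfolding diff_aut_def bij_betw_def by blast
  then show "x \<in> L \<Longrightarrow> \<exists>y\<in>L. \<sigma> y = x" for x by (metis imageE)
  show zero: "\<sigma> 0 = 0" using add[OF LD(1) LD(1)] by simp
  have "\<sigma> 1 * \<sigma> 1 = \<sigma> 1" using mult[OF LD(2) LD(2)] by simp
  moreover have "\<sigma> 1 \<noteq> 0" using inj[OF LD(2) LD(1)] zero by auto
  ultimately show one: "\<sigma> 1 = 1" by simp
  show neg: "x \<in> L \<Longrightarrow> \<sigma> (- x) = - \<sigma> x" for x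
    using add[of x "- x"] LD(5) zero by (simp add: eq_neg_iff_add_eq_0 add.commute)
  show inve: "x \<in> L \<Longrightarrow> \<sigma> (inverse x) = inverse (\<sigma> x)" for x
    using mult[of x "inverse x"] LD(6) one zero by (cases "x = 0") (auto intro: inverse_unique[symmetric])
  show "x \<in> L \<Longrightarrow> y \<in> L \<Longrightarrow> \<sigma> (x / y) = \<sigma> x / \<sigma> y" for x y
    using mult[of x "inverse y"] inve[of y] LD(6) by (simp add: divide_inverse)
  show "(\<And>i. i \<in> A \<Longrightarrow> f i \<in> L) \<Longrightarrow> \<sigma> (sum f A) = (\<Sum>i\<in>A. \<sigma> (f i))"
    by (induction A rule: infinite_finite_induct) (auto simp: zero add is_subfield_sum[OF assms(2)])
qed

lemma diff_aut_poly:
  assumes \<sigma>: "diff_aut E L \<sigma>" and L: "is_subfield L" and "E \<subseteq> L" and P: "P \<in> polys E J"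
    and u: "\<And>v. v \<in> J \<Longrightarrow> u v \<in> L"
  shows "\<sigma> (P u) = P (\<lambda>v. \<sigma> (u v))"
  using P
proof (induction rule: poly_funs.induct)
  case (add f h)
  then show ?case using poly_funs_in_subfield[OF L _ \<open>E \<subseteq> L\<close>, of _ J u] u
    by (simp add: diff_autD(2)[OF \<sigma> L])
next
  case (mult f h)
  then show ?case using poly_funs_in_subfield[OF L _ \<open>E \<subseteq> L\<close>, of _ J u] u
    by (simp add: diff_autD(3)[OF \<sigma> L])
qed (simp_all add: diff_autD(5)[OF \<sigma> L])

lemma diff_aut_mprod:
  assumes \<sigma>: "diff_aut E L \<sigma>" and L: "is_subfield L"
    and X: "\<And>v. v \<in> I \<times> I \<Longrightarrow> X v \<in> L" and Y: "\<And>v. v \<in> I \<times> I \<Longrightarrow> Y v \<in> L" and v: "v \<in> I \<times> I"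
  shows "\<sigma> (mprod I X Y v) = mprod I (\<lambda>v. \<sigma> (X v)) (\<lambda>v. \<sigma> (Y v)) v"
proof -
  obtain i j where ij: "v = (i, j)" "i \<in> I" "j \<in> I" using v by auto
  have XY: "X (i, k) \<in> L" "Y (k, j) \<in> L" if "k \<in> I" for k using X Y ij that by auto
  have "\<sigma> (\<Sum>k\<in>I. X (i, k) * Y (k, j)) = (\<Sum>k\<in>I. \<sigma> (X (i, k) * Y (k, j)))"
    by (rule diff_autD(13)[OF \<sigma> L]) (intro is_subfieldD(4)[OF L] XY)
  also have "\<dots> = (\<Sum>k\<in>I. \<sigma> (X (i, k)) * \<sigma> (Y (k, j)))"
    by (intro sum.cong refl diff_autD(3)[OF \<sigma> L] XY)
  finally show ?thesis by (simp add: mprod_def ij)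
qed

end

section \<open>Groups of differential automorphisms\<close>

text \<open>The group is abstract and the action a parameter, because the elements of
  \<open>diff_galois_group\<close> act on meromorphic functions while \<open>L\<close> consists of
  Laurent series.\<close>

locale galois_action = fundamental_matrix D cst E I B U V + G: group G
  for D :: "'a::field_char_0 \<Rightarrow> 'a" and cst :: "complex \<Rightarrow> 'a"
    and E I and B U V :: "'n \<times> 'n \<Rightarrow> 'a" and G :: "('g, 'm) monoid_scheme" (structure) +
  fixes act :: "'g \<Rightarrow> 'a \<Rightarrow> 'a"
  assumes V_L: "v \<in> I \<times> I \<Longrightarrow> V v \<in> frac_field E (I \<times> I) U"
    and act: "g \<in> carrier G \<Longrightarrow> diff_aut E L (act g)"
    and act_mult: "g \<in> carrier G \<Longrightarrow> h \<in> carrier G \<Longrightarrow> x \<in> L \<Longrightarrow> act (g \<otimes> h) x = act g (act h x)"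
    and faithful: "g \<in> carrier G \<Longrightarrow> h \<in> carrier G \<Longrightarrow> (\<And>x. x \<in> L \<Longrightarrow> act g x = act h x) \<Longrightarrow> g = h"
begin

lemma L_sub: "is_subfield L"
  using diff_subfield_L by (simp add: diff_subfield_def)

lemmas LD = is_subfieldD[OF L_sub]
lemmas actD = diff_autD[OF act L_sub]

lemma E_L: "E \<subseteq> L" by (rule frac_field_base[OF E_sub])
lemma U_L: "v \<in> J \<Longrightarrow> U v \<in> L" by (rule frac_field_var[OF E_sub])

lemma act_one: "x \<in> L \<Longrightarrow> act \<one> x = x"
proof -
  assume x: "x \<in> L"
  have "act \<one> (act \<one> x) = act \<one> x" using act_mult[of \<one> \<one> x] x by simp
  then show ?thesis using actD(8)[OF G.one_closed actD(1)[OF G.one_closed x] x] by simp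
qed

lemma act_inv: "g \<in> carrier G \<Longrightarrow> x \<in> L \<Longrightarrow> act g (act (inv g) x) = x"
  "g \<in> carrier G \<Longrightarrow> x \<in> L \<Longrightarrow> act (inv g) (act g x) = x"
  using act_mult[of g "inv g" x] act_mult[of "inv g" g x] act_one by simp_all

text \<open>Density of \<open>H\<close> without topology, by Artin's argument on the length of a
  relation. One coefficient is normalized to 1; applying \<open>t\<close> from \<open>H\<close> and
  subtracting gives a relation with fewer terms, to which induction applies. If all these
  differences vanish, the coefficients are fixed by \<open>H\<close>.\<close>

lemma artin_relation:
  assumes H: "subgroup H G" and fixed: "\<And>x. x \<in> L \<Longrightarrow> (\<And>h. h \<in> H \<Longrightarrow> act h x = x) \<Longrightarrow> x \<in> E"
    and "finite A" "\<And>i. i \<in> A \<Longrightarrow> k i \<in> L" "\<And>i. i \<in> A \<Longrightarrow> r i \<in> L"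
    and "\<And>h. h \<in> H \<Longrightarrow> (\<Sum>i\<in>A. k i * act h (r i)) = 0" and "g \<in> carrier G"
  shows "(\<Sum>i\<in>A. k i * act g (r i)) = 0"
  using assms(3-7)
proof (induction "card A" arbitrary: A k g rule: less_induct)
  case less
  note HG = subgroup.mem_carrier[OF H]
  have IH: "(\<Sum>i\<in>A. l i * act g (r i)) = 0"
    if l: "\<And>i. i \<in> A \<Longrightarrow> l i \<in> L" "\<And>h. h \<in> H \<Longrightarrow> (\<Sum>i\<in>A. l i * act h (r i)) = 0"
      and i0: "i0 \<in> A" "l i0 = 0" and g: "g \<in> carrier G" for l i0 g
  proof -
    have eq: "(\<Sum>i\<in>A. l i * act h (r i)) = (\<Sum>i\<in>A - {i0}. l i * act h (r i))" for h
      by (rule sum.mono_neutral_right) (use less.prems(1) i0 in auto)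
    have "card (A - {i0}) < card A" using less.prems(1) i0(1) by (rule card_Diff1_less)
    from less.hyps[OF this, of l g] show ?thesis
      using l less.prems(1,3) g eq by simp
  qed
  show ?case
  proof (cases "\<exists>i0\<in>A. k i0 = 0")
    case True
    then show ?thesis using IH[of k _ g] less.prems by blast
  next
    case False
    show ?thesis
    proof (cases "A = {}")
      case False
      then obtain i1 where i1: "i1 \<in> A" by blast
      then have k1: "k i1 \<noteq> 0" "k i1 \<in> L" using \<open>\<not> (\<exists>i0\<in>A. k i0 = 0)\<close> less.prems by auto
      define k' where "k' i = k i / k i1" for i
      have k'L: "k' i \<in> L" if "i \<in> A" for i
        unfolding k'_def by (intro LD less.prems k1 that)
      have scale: "(\<Sum>i\<in>A. k i * act h (r i)) = k i1 * (\<Sum>i\<in>A. k' i * act h (r i))" for h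
        using k1(1) by (simp add: k'_def sum_distrib_left)
      have k'H: "(\<Sum>i\<in>A. k' i * act h (r i)) = 0" if "h \<in> H" for h
        using less.prems(4)[OF that] scale[of h] k1(1) by simp
      define c where "c t i = act t (k' i) - k' i" for t i
      have cL: "c t i \<in> L" if "t \<in> H" "i \<in> A" for t i
        unfolding c_def by (intro LD actD(1) HG k'L that)
      \<comment> \<open>The automorphism \<open>t\<close> is applied to the relation at
        \<open>inv t \<otimes> h\<close>.\<close>
      have tH: "(\<Sum>i\<in>A. act t (k' i) * act h (r i)) = 0" if t: "t \<in> H" and h: "h \<in> H" for t h
      proof -
        have m: "inv t \<otimes> h \<in> H" by (intro subgroup.m_closed[OF H] subgroup.m_inv_closed[OF H] t h)
        have "act t (\<Sum>i\<in>A. k' i * act (inv t \<otimes> h) (r i)) = (\<Sum>i\<in>A. act t (k' i * act (inv t \<otimes> h) (r i)))"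
          by (rule actD(13)[OF HG[OF t]]) (intro LD(4) k'L actD(1) HG m less.prems(3))
        also have "\<dots> = (\<Sum>i\<in>A. act t (k' i) * act h (r i))"
        proof (rule sum.cong[OF refl])
          fix i assume i: "i \<in> A"
          have "act t (act (inv t \<otimes> h) (r i)) = act (t \<otimes> (inv t \<otimes> h)) (r i)"
            using act_mult[OF HG[OF t] HG[OF m] less.prems(3)[OF i]] by simp
          also have "t \<otimes> (inv t \<otimes> h) = h"
            using HG[OF t] HG[OF h] by (simp add: G.m_assoc[symmetric])
          finally show "act t (k' i * act (inv t \<otimes> h) (r i)) = act t (k' i) * act h (r i)"
            using actD(3)[OF HG[OF t] k'L[OF i] actD(1)[OF HG[OF m] less.prems(3)[OF i]]] by simp
        qed
        finally show ?thesis using k'H[OF m] actD(6)[OF HG[OF t]] by simp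
      qed
      have cH: "(\<Sum>i\<in>A. c t i * act h (r i)) = 0" if "t \<in> H" "h \<in> H" for t h
        using tH[OF that] k'H[OF that(2)] by (simp add: c_def left_diff_distrib sum_subtractf)
      have c1: "c t i1 = 0" if "t \<in> H" for t
        using k1(1) actD(7)[OF HG[OF that]] by (simp add: c_def k'_def)
      have cG: "(\<Sum>i\<in>A. c t i * act g (r i)) = 0" if "t \<in> H" "g \<in> carrier G" for t g
        by (rule IH[OF cL[OF that(1)] cH[OF that(1)] i1 c1[OF that(1)] that(2)])
      have "(\<Sum>i\<in>A. k' i * act g (r i)) = 0"
      proof (cases "\<exists>t\<in>H. \<exists>i\<in>A. c t i \<noteq> 0")
        case True
        then obtain t i2 where t: "t \<in> H" "i2 \<in> A" "c t i2 \<noteq> 0" by blast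
        \<comment> \<open>A multiple of the shorter relation removes the term \<open>i2\<close>.
          Both resulting relations have a vanishing coefficient and extend to \<open>G\<close> by
          induction.\<close>
        define l where "l i = k' i - k' i2 / c t i2 * c t i" for i
        have lL: "l i \<in> L" if "i \<in> A" for i
          unfolding l_def by (intro LD(4,7,8) k'L cL t that)
        have split: "(\<Sum>i\<in>A. l i * act h (r i)) = (\<Sum>i\<in>A. k' i * act h (r i)) - k' i2 / c t i2 * (\<Sum>i\<in>A. c t i * act h (r i))" for h
          by (simp add: l_def left_diff_distrib sum_subtractf sum_distrib_left mult.assoc)
        have lH: "(\<Sum>i\<in>A. l i * act h (r i)) = 0" if "h \<in> H" for h
          unfolding split using k'H[OF that] cH[OF t(1) that] by simp
        have "l i2 = 0" using t(3) by (simp add: l_def)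
        from IH[OF lL lH t(2) this less.prems(5)] have "(\<Sum>i\<in>A. l i * act g (r i)) = 0" by simp
        then show ?thesis unfolding split using cG[OF t(1) less.prems(5)] by simp
      next
        case False
        \<comment> \<open>The coefficients now lie in \<open>E\<close> and are fixed by
          \<open>g\<close>, so the relation at \<open>g\<close> is \<open>g\<close> applied to the
          relation at the unit.\<close>
        then have k'E: "k' i \<in> E" if "i \<in> A" for i
          using fixed[OF k'L[OF that]] that by (auto simp: c_def)
        have "(\<Sum>i\<in>A. k' i * r i) = (\<Sum>i\<in>A. k' i * act \<one> (r i))"
          using less.prems(3) by (simp add: act_one)
        also have "\<dots> = 0" by (rule k'H[OF subgroup.one_closed[OF H]])
        finally have 0: "(\<Sum>i\<in>A. k' i * r i) = 0" .
        have "act g (\<Sum>i\<in>A. k' i * r i) = (\<Sum>i\<in>A. act g (k' i * r i))"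
          by (rule actD(13)[OF less.prems(5)]) (intro LD(4) k'L less.prems(3))
        also have "\<dots> = (\<Sum>i\<in>A. k' i * act g (r i))"
          using actD(3)[OF less.prems(5) k'L less.prems(3)] actD(5)[OF less.prems(5) k'E]
          by (intro sum.cong refl) simp
        finally show ?thesis unfolding 0 using actD(6)[OF less.prems(5)] by simp
      qed
      then show ?thesis unfolding scale by simp
    qed simp
  qed
qed

text \<open>Functions on \<open>G\<close> of the shape treated by \<open>artin_relation\<close>.
  They form a ring, and vanishing on \<open>H\<close> implies vanishing on \<open>G\<close>
  (\<open>dense_subgroup\<close>).\<close>

definition regular :: "('g \<Rightarrow> 'a) \<Rightarrow> bool" where
  "regular \<Theta> \<longleftrightarrow> (\<exists>ps. set ps \<subseteq> L \<times> L \<and> (\<forall>g\<in>carrier G. \<Theta> g = (\<Sum>(k, r)\<leftarrow>ps. k * act g r)))"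

lemma regular_cong: "regular \<Theta> \<Longrightarrow> (\<And>g. g \<in> carrier G \<Longrightarrow> \<Theta>' g = \<Theta> g) \<Longrightarrow> regular \<Theta>'"
  unfolding regular_def by simp

lemma regular_const: "k \<in> L \<Longrightarrow> regular (\<lambda>_. k)"
  unfolding regular_def by (rule exI[of _ "[(k, 1)]"]) (simp add: actD(7) LD(2))

lemma regular_act: "r \<in> L \<Longrightarrow> regular (\<lambda>g. act g r)"
  unfolding regular_def by (rule exI[of _ "[(1, r)]"]) (simp add: LD(2))

lemma regular_add: "regular \<Theta> \<Longrightarrow> regular \<Theta>' \<Longrightarrow> regular (\<lambda>g. \<Theta> g + \<Theta>' g)"
proof -
  assume "regular \<Theta>" "regular \<Theta>'"
  then obtain ps qs where "set ps \<subseteq> L \<times> L" "\<forall>g\<in>carrier G. \<Theta> g = (\<Sum>(k, r)\<leftarrow>ps. k * act g r)"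
    "set qs \<subseteq> L \<times> L" "\<forall>g\<in>carrier G. \<Theta>' g = (\<Sum>(k, r)\<leftarrow>qs. k * act g r)"
    unfolding regular_def by blast
  then show ?thesis unfolding regular_def by (intro exI[of _ "ps @ qs"]) simp
qed

lemma regular_sum: "(\<And>i. i \<in> A \<Longrightarrow> regular (\<Theta> i)) \<Longrightarrow> regular (\<lambda>g. \<Sum>i\<in>A. \<Theta> i g)"
  by (induction A rule: infinite_finite_induct) (auto intro: regular_const LD(1) regular_add)

lemma regular_mult: "regular \<Theta> \<Longrightarrow> regular \<Theta>' \<Longrightarrow> regular (\<lambda>g. \<Theta> g * \<Theta>' g)"
proof -
  assume "regular \<Theta>" "regular \<Theta>'"
  then obtain ps qs where ps: "set ps \<subseteq> L \<times> L" "\<forall>g\<in>carrier G. \<Theta> g = (\<Sum>(k, r)\<leftarrow>ps. k * act g r)"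
    and qs: "set qs \<subseteq> L \<times> L" "\<forall>g\<in>carrier G. \<Theta>' g = (\<Sum>(k, r)\<leftarrow>qs. k * act g r)"
    unfolding regular_def by blast
  have single: "regular (\<lambda>g. (k * act g r) * \<Theta>' g)" if "k \<in> L" "r \<in> L" for k r
    unfolding regular_def
  proof (intro exI[of _ "map (\<lambda>(k', r'). (k * k', r * r')) qs"] conjI ballI)
    show "set (map (\<lambda>(k', r'). (k * k', r * r')) qs) \<subseteq> L \<times> L"
      using qs(1) that by (auto intro: LD(4))
    fix g assume g: "g \<in> carrier G"
    have "(k * act g r) * (\<Sum>(k, r)\<leftarrow>qs. k * act g r) = (\<Sum>(k', r')\<leftarrow>map (\<lambda>(k', r'). (k * k', r * r')) qs. k' * act g r')"
      using qs(1) by (induction qs) (auto simp: algebra_simps actD(3)[OF g] that)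
    then show "(k * act g r) * \<Theta>' g = (\<Sum>(k', r')\<leftarrow>map (\<lambda>(k', r'). (k * k', r * r')) qs. k' * act g r')"
      using qs(2) g by simp
  qed
  have "regular (\<lambda>g. (\<Sum>(k, r)\<leftarrow>ps. k * act g r) * \<Theta>' g)"
    using ps(1)
  proof (induction ps)
    case Nil
    then show ?case using regular_const[OF LD(1)] by simp
  next
    case (Cons p ps)
    then show ?case using regular_add[OF single[of "fst p" "snd p"] Cons.IH]
      by (cases p) (simp add: distrib_right)
  qed
  then show ?thesis by (rule regular_cong) (use ps(2) in simp)
qed

lemma regular_diff: "regular \<Theta> \<Longrightarrow> regular \<Theta>' \<Longrightarrow> regular (\<lambda>g. \<Theta> g - \<Theta>' g)"
  using regular_add[OF _ regular_mult[OF regular_const[of "-1"]], of \<Theta> \<Theta>'] LD(5)[OF LD(2)] by simp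

lemma regular_mprod:
  "(\<And>v. v \<in> J \<Longrightarrow> regular (\<lambda>g. X g v)) \<Longrightarrow> (\<And>v. v \<in> J \<Longrightarrow> regular (\<lambda>g. Y g v)) \<Longrightarrow> v \<in> J \<Longrightarrow>
    regular (\<lambda>g. mprod I (X g) (Y g) v)"
  unfolding mprod_def by (cases v) (auto intro!: regular_sum regular_mult)

lemma dense_subgroup:
  assumes "subgroup H G" "\<And>x. x \<in> L \<Longrightarrow> (\<And>h. h \<in> H \<Longrightarrow> act h x = x) \<Longrightarrow> x \<in> E"
    and "regular \<Theta>" "\<And>h. h \<in> H \<Longrightarrow> \<Theta> h = 0" "g \<in> carrier G"
  shows "\<Theta> g = 0"
proof -
  obtain ps where ps: "set ps \<subseteq> L \<times> L" "\<forall>g\<in>carrier G. \<Theta> g = (\<Sum>(k, r)\<leftarrow>ps. k * act g r)"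
    using assms(3) unfolding regular_def by blast
  have eq: "\<Theta> g = (\<Sum>i\<in>{..<length ps}. fst (ps ! i) * act g (snd (ps ! i)))" if "g \<in> carrier G" for g
    using ps(2) that by (simp add: sum_list_sum_nth case_prod_beta atLeast0LessThan)
  have psL: "fst (ps ! i) \<in> L" "snd (ps ! i) \<in> L" if "i < length ps" for i
    using subsetD[OF ps(1) nth_mem[OF that]] by (simp_all add: mem_Times_iff)
  have "(\<Sum>i\<in>{..<length ps}. fst (ps ! i) * act g (snd (ps ! i))) = 0"
  proof (rule artin_relation[OF assms(1)])
    show "x \<in> E" if "x \<in> L" "\<And>h. h \<in> H \<Longrightarrow> act h x = x" for x by (rule assms(2)[OF that])
    show "(\<Sum>i\<in>{..<length ps}. fst (ps ! i) * act h (snd (ps ! i))) = 0" if "h \<in> H" for h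
      using assms(4)[OF that] eq[OF subgroup.mem_carrier[OF assms(1) that]] by simp
  qed (simp_all add: psL assms(5))
  then show ?thesis using eq assms(5) by simp
qed

text \<open>The matrix \<open>U\<^sup>-\<^sup>1 g(U)\<close> of \<open>g\<close>. Its entries are
  constants, fixed by \<open>G\<close>, which turns the cocycle rule into multiplicativity
  (\<open>cocycle_mult\<close>).\<close>

definition cocycle :: "'g \<Rightarrow> 'n \<times> 'n \<Rightarrow> 'a" where
  "cocycle g = mprod I V (\<lambda>v. act g (U v))"

lemma D_act_U: "g \<in> carrier G \<Longrightarrow> v \<in> J \<Longrightarrow> D (act g (U v)) = mprod I B (\<lambda>v. act g (U v)) v"
proof -
  assume g: "g \<in> carrier G" and v: "v \<in> J"
  have BL: "w \<in> J \<Longrightarrow> B w \<in> L" for w using B E_L by blast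
  have "D (act g (U v)) = act g (mprod I B U v)"
    using actD(4)[OF g U_L[OF v]] DU[OF v] by simp
  also have "\<dots> = mprod I (\<lambda>v. act g (B v)) (\<lambda>v. act g (U v)) v"
    by (rule diff_aut_mprod[OF act[OF g] L_sub BL U_L v])
  also have "\<dots> = mprod I B (\<lambda>v. act g (U v)) v"
    by (rule mprod_cong[OF _ _ v]) (simp_all add: actD(5)[OF g B])
  finally show ?thesis .
qed

lemma cocycle_const: "g \<in> carrier G \<Longrightarrow> v \<in> J \<Longrightarrow> cocycle g v \<in> range cst"
proof -
  assume g: "g \<in> carrier G" and v: "v \<in> J"
  have "\<exists>A. \<forall>v\<in>J. act g (U v) = mprod I U (cm A) v \<and> mprod I V (\<lambda>v. act g (U v)) v = cst (A v)"
    by (rule constant_quotient[OF D_act_U[OF g]])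
  then obtain A where "\<forall>v\<in>J. act g (U v) = mprod I U (cm A) v \<and> mprod I V (\<lambda>v. act g (U v)) v = cst (A v)"
    by (elim exE)
  from bspec[OF this v] show ?thesis by (simp add: cocycle_def)
qed

lemma act_U: "v \<in> J \<Longrightarrow> act g (U v) = mprod I U (cocycle g) v"
proof -
  assume v: "v \<in> J"
  have "mprod I (mprod I U V) (\<lambda>v. act g (U v)) v = act g (U v)"
    by (rule mprod_one_left[OF finite_I UV v])
  then show ?thesis by (simp only: cocycle_def mprod_assoc)
qed

lemma cocycle_E: "g \<in> carrier G \<Longrightarrow> v \<in> J \<Longrightarrow> cocycle g v \<in> E"
proof -
  assume "g \<in> carrier G" "v \<in> J"
  from cocycle_const[OF this] obtain c where "cocycle g v = cst c" by (rule rangeE)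
  then show ?thesis by (simp only: cst_E)
qed

lemma cocycle_L: "g \<in> carrier G \<Longrightarrow> v \<in> J \<Longrightarrow> cocycle g v \<in> L"
  by (rule subsetD[OF E_L cocycle_E])

lemma cocycle_mult:
  assumes g: "g \<in> carrier G" and h: "h \<in> carrier G" and v: "v \<in> J"
  shows "cocycle (g \<otimes> h) v = mprod I (cocycle g) (cocycle h) v"
proof -
  have "act (g \<otimes> h) (U w) = mprod I U (mprod I (cocycle g) (cocycle h)) w" if w: "w \<in> J" for w
  proof -
    have "act (g \<otimes> h) (U w) = act g (mprod I U (cocycle h) w)"
      using act_mult[OF g h U_L[OF w]] act_U[OF w] by simp
    also have "\<dots> = mprod I (\<lambda>v. act g (U v)) (\<lambda>v. act g (cocycle h v)) w"
      by (rule diff_aut_mprod[OF act[OF g] L_sub U_L cocycle_L[OF h] w])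
    also have "\<dots> = mprod I (mprod I U (cocycle g)) (cocycle h) w"
      by (rule mprod_cong[OF _ _ w]) (simp_all add: actD(5)[OF g cocycle_E[OF h]] act_U)
    finally show ?thesis by (simp add: mprod_assoc)
  qed
  then have "cocycle (g \<otimes> h) v = mprod I V (mprod I U (mprod I (cocycle g) (cocycle h))) v"
    unfolding cocycle_def by (intro mprod_cong[OF _ _ v]) auto
  also have "\<dots> = mprod I (cocycle g) (cocycle h) v"
    unfolding mprod_assoc[of I V U, symmetric] by (rule mprod_one_left[OF finite_I VU v])
  finally show ?thesis .
qed

lemma eq_if_cocycle_eq:
  assumes g: "g \<in> carrier G" and h: "h \<in> carrier G" and eq: "\<And>v. v \<in> J \<Longrightarrow> act g (U v) = act h (U v)"
  shows "g = h"
proof (rule faithful[OF g h])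
  fix x assume "x \<in> L"
  then obtain P Q where x: "P \<in> polys E J" "Q \<in> polys E J" "Q U \<noteq> 0" "x = P U / Q U" by (rule frac_fieldE)
  have R: "act g (R U) = act h (R U)" if R: "R \<in> polys E J" for R
  proof -
    have "act g (R U) = R (\<lambda>v. act g (U v))"
      by (rule diff_aut_poly[OF act[OF g] L_sub E_L R U_L])
    also have "\<dots> = R (\<lambda>v. act h (U v))" by (rule poly_funs_cong[OF R]) (simp add: eq)
    also have "\<dots> = act h (R U)"
      by (rule diff_aut_poly[OF act[OF h] L_sub E_L R U_L, symmetric])
    finally show ?thesis .
  qed
  have PL: "P U \<in> L" "Q U \<in> L" using x polys_in_frac_field[OF E_sub] by blast+
  show "act g x = act h x"
    unfolding x(4) using actD(12)[OF g PL] actD(12)[OF h PL] R x by simp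
qed

text \<open>Coefficients from the whole ambient field are allowed here;
  \<open>zariski_closed_zero_locus\<close> later replaces them by complex ones.\<close>

definition zero_locus :: "(('n \<times> 'n \<Rightarrow> 'a) \<Rightarrow> 'a) set \<Rightarrow> 'g set" where
  "zero_locus FF = {g \<in> carrier G. \<forall>P\<in>FF. P (\<lambda>v. act g (U v)) = 0}"

definition fixer :: "'a set \<Rightarrow> 'g set" where
  "fixer X = {g \<in> carrier G. \<forall>x\<in>X. act g x = x}"

definition centralizer :: "'g set \<Rightarrow> 'g set" where
  "centralizer T = {g \<in> carrier G. \<forall>t\<in>T. g \<otimes> t = t \<otimes> g}"

section \<open>Fixers and centralizers as closed normal subgroups\<close>

lemma normalI:
  assumes "N \<subseteq> carrier G" "\<one> \<in> N" "\<And>g h. g \<in> N \<Longrightarrow> h \<in> N \<Longrightarrow> g \<otimes> h \<in> N" "\<And>g. g \<in> N \<Longrightarrow> inv g \<in> N"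
    "\<And>x g. x \<in> carrier G \<Longrightarrow> g \<in> N \<Longrightarrow> x \<otimes> g \<otimes> inv x \<in> N"
  shows "N \<lhd> G"
  unfolding G.normal_inv_iff using assms by (auto intro!: subgroup.intro)

lemma fixer_normal:
  assumes X: "X \<subseteq> L" and inv: "\<And>g x. g \<in> carrier G \<Longrightarrow> x \<in> X \<Longrightarrow> act g x \<in> X"
  shows "fixer X \<lhd> G"
proof (rule normalI)
  show "fixer X \<subseteq> carrier G" "\<one> \<in> fixer X" using X act_one by (auto simp: fixer_def)
  show "g \<otimes> h \<in> fixer X" if "g \<in> fixer X" "h \<in> fixer X" for g h
    using that X by (auto simp: fixer_def act_mult subset_iff)
  show "inv g \<in> fixer X" if g: "g \<in> fixer X" for g
  proof -
    have gc: "g \<in> carrier G" and gx: "\<And>x. x \<in> X \<Longrightarrow> act g x = x" using g by (auto simp: fixer_def)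
    have "act (inv g) x = x" if "x \<in> X" for x using act_inv(2)[OF gc, of x] gx[OF that] that X by auto
    then show ?thesis using gc by (simp add: fixer_def)
  qed
  fix x g assume x: "x \<in> carrier G" and g: "g \<in> fixer X"
  have gc: "g \<in> carrier G" and gx: "\<And>x. x \<in> X \<Longrightarrow> act g x = x" using g by (auto simp: fixer_def)
  have "act (x \<otimes> g \<otimes> inv x) y = y" if y: "y \<in> X" for y
  proof -
    have yL: "y \<in> L" using y X by blast
    have iy: "act (inv x) y \<in> X" using inv x y by blast
    then have "act (inv x) y \<in> L" using X by blast
    then have "act (x \<otimes> g \<otimes> inv x) y = act x (act g (act (inv x) y))"
      using x gc yL by (simp add: act_mult)
    then show ?thesis using gx[OF iy] act_inv(1)[OF x yL] by simp
  qed
  then show "x \<otimes> g \<otimes> inv x \<in> fixer X" using x gc by (simp add: fixer_def)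
qed

text \<open>For \<open>x = P U / Q U\<close> the condition \<open>act g x = x\<close> reads
  \<open>P (g U) * Q U = P U * Q (g U)\<close>, a polynomial condition on the entries of g
  U.\<close>

lemma fixer_closed:
  assumes X: "X \<subseteq> L"
  shows "\<exists>FF\<subseteq>polys UNIV J. fixer X = zero_locus FF"
proof -
  have "\<exists>R\<in>polys UNIV J. \<forall>g\<in>carrier G. act g x = x \<longleftrightarrow> R (\<lambda>v. act g (U v)) = 0" if "x \<in> X" for x
  proof -
    have "x \<in> L" using that X by blast
    then obtain P Q where x: "P \<in> polys E J" "Q \<in> polys E J" "Q U \<noteq> 0" "x = P U / Q U"
      by (rule frac_fieldE)
    have PL: "P U \<in> L" "Q U \<in> L" using x polys_in_frac_field[OF E_sub] by blast+
    show ?thesis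
    proof (rule bexI[of _ "\<lambda>y. P y * Q U - P U * Q y"], intro ballI)
      fix g assume g: "g \<in> carrier G"
      have ev: "act g (R U) = R (\<lambda>v. act g (U v))" if "R \<in> polys E J" for R
        by (rule diff_aut_poly[OF act[OF g] L_sub E_L that U_L])
      have "act g (Q U) \<noteq> 0" using actD(8)[OF g PL(2) LD(1)] actD(6)[OF g] x(3) by auto
      then show "act g x = x \<longleftrightarrow> P (\<lambda>v. act g (U v)) * Q U - P U * Q (\<lambda>v. act g (U v)) = 0"
        using x(3) unfolding x(4) actD(12)[OF g PL] ev[OF x(1)] ev[OF x(2)] by (simp add: field_simps)
    next
      show "(\<lambda>y. P y * Q U - P U * Q y) \<in> polys UNIV J"
        by (intro poly_funs_diff poly_funs.mult poly_funs.const poly_funs_mono[OF x(1)] poly_funs_mono[OF x(2)])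
           (auto simp: is_subfield_def)
    qed
  qed
  then obtain R where R: "\<And>x. x \<in> X \<Longrightarrow> R x \<in> polys UNIV J"
    "\<And>x g. x \<in> X \<Longrightarrow> g \<in> carrier G \<Longrightarrow> act g x = x \<longleftrightarrow> R x (\<lambda>v. act g (U v)) = 0" by metis
  show ?thesis
    by (rule exI[of _ "R ` X"]) (use R in \<open>auto simp: fixer_def zero_locus_def\<close>)
qed

lemma centralizer_normal:
  assumes T: "T \<subseteq> carrier G" and inv: "\<And>x t. x \<in> carrier G \<Longrightarrow> t \<in> T \<Longrightarrow> x \<otimes> t \<otimes> inv x \<in> T"
  shows "centralizer T \<lhd> G"
proof (rule normalI)
  show "centralizer T \<subseteq> carrier G" "\<one> \<in> centralizer T" using T by (auto simp: centralizer_def)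
  show "g \<otimes> h \<in> centralizer T" if "g \<in> centralizer T" "h \<in> centralizer T" for g h
  proof -
    have "g \<otimes> h \<otimes> t = t \<otimes> (g \<otimes> h)" if "t \<in> T" for t
    proof -
      have c: "g \<in> carrier G" "h \<in> carrier G" "t \<in> carrier G" "g \<otimes> t = t \<otimes> g" "h \<otimes> t = t \<otimes> h"
        using \<open>g \<in> centralizer T\<close> \<open>h \<in> centralizer T\<close> that T by (auto simp: centralizer_def)
      have "g \<otimes> h \<otimes> t = g \<otimes> (t \<otimes> h)" using c by (simp add: G.m_assoc)
      also have "\<dots> = g \<otimes> t \<otimes> h" using c(1-3) by (simp add: G.m_assoc)
      also have "\<dots> = t \<otimes> (g \<otimes> h)" unfolding c(4) using c(1-3) by (simp add: G.m_assoc)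
      finally show ?thesis .
    qed
    then show ?thesis using that by (auto simp: centralizer_def)
  qed
  show "inv g \<in> centralizer T" if g: "g \<in> centralizer T" for g
  proof -
    have "inv g \<otimes> t = t \<otimes> inv g" if t: "t \<in> T" for t
    proof -
      have c: "g \<in> carrier G" "t \<in> carrier G" "g \<otimes> t = t \<otimes> g" using g t T by (auto simp: centralizer_def)
      have "inv g \<otimes> t = inv g \<otimes> (t \<otimes> g) \<otimes> inv g" using c(1,2) by (simp add: G.m_assoc)
      also have "\<dots> = t \<otimes> inv g" using c(1,2) unfolding c(3)[symmetric] by (simp add: G.m_assoc[symmetric])
      finally show ?thesis .
    qed
    then show ?thesis using g by (auto simp: centralizer_def)
  qed
  fix x g assume x: "x \<in> carrier G" and g: "g \<in> centralizer T"
  have gc: "g \<in> carrier G" using g by (simp add: centralizer_def)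
  have "x \<otimes> g \<otimes> inv x \<otimes> t = t \<otimes> (x \<otimes> g \<otimes> inv x)" if t: "t \<in> T" for t
  proof -
    have tc: "t \<in> carrier G" using t T by blast
    define s where "s = inv x \<otimes> t \<otimes> x"
    have "s \<in> T" using inv[of "inv x" t] x t by (simp add: s_def)
    then have gs: "g \<otimes> s = s \<otimes> g" and sc: "s \<in> carrier G" using g T by (auto simp: centralizer_def)
    have t_eq: "t = x \<otimes> s \<otimes> inv x" using x tc by (simp add: s_def G.m_assoc[symmetric]) (simp add: G.m_assoc)
    have "x \<otimes> g \<otimes> inv x \<otimes> t = x \<otimes> (g \<otimes> s) \<otimes> inv x"
      unfolding t_eq using x gc sc by (simp add: G.m_assoc[symmetric]) (simp add: G.m_assoc)
    also have "\<dots> = t \<otimes> (x \<otimes> g \<otimes> inv x)"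
      unfolding t_eq gs using x gc sc by (simp add: G.m_assoc[symmetric]) (simp add: G.m_assoc)
    finally show ?thesis .
  qed
  then show "x \<otimes> g \<otimes> inv x \<in> centralizer T" using x gc by (simp add: centralizer_def)
qed

text \<open>\<open>g \<otimes> t\<close> sends U to g U times the matrix of \<open>t\<close>, and
  \<open>t \<otimes> g\<close> sends it to (t U) V (g U). For fixed \<open>t\<close> the equality of
  the two is linear in the entries of g U.\<close>

lemma centralizer_closed:
  assumes T: "T \<subseteq> carrier G"
  shows "\<exists>FF\<subseteq>polys UNIV J. centralizer T = zero_locus FF"
proof -
  define R where "R t v y = mprod I y (cocycle t) v - mprod I (mprod I (\<lambda>v. act t (U v)) V) y v" for t v y
  have R: "R t v \<in> polys UNIV J" if "v \<in> J" for t v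
    unfolding R_def by (intro poly_funs_diff mprod_polys polys_var poly_funs.const that) (auto simp: is_subfield_def)
  have eq: "g \<otimes> t = t \<otimes> g \<longleftrightarrow> (\<forall>v\<in>J. R t v (\<lambda>v. act g (U v)) = 0)" if g: "g \<in> carrier G" and "t \<in> T" for g t
  proof -
    have t: "t \<in> carrier G" using that T by blast
    have act2: "act (g \<otimes> h) (U v) = mprod I (\<lambda>v. act g (U v)) (cocycle h) v"
      if g: "g \<in> carrier G" and h: "h \<in> carrier G" and v: "v \<in> J" for g h v
    proof -
      have "act (g \<otimes> h) (U v) = mprod I U (mprod I (cocycle g) (cocycle h)) v"
        unfolding act_U[OF v] by (rule mprod_cong[OF _ _ v]) (simp_all add: cocycle_mult[OF g h])
      also have "\<dots> = mprod I (\<lambda>v. act g (U v)) (cocycle h) v"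
        unfolding mprod_assoc[symmetric] by (rule mprod_cong[OF _ _ v]) (simp_all add: act_U)
      finally show ?thesis .
    qed
    have "R t v (\<lambda>v. act g (U v)) = act (g \<otimes> t) (U v) - act (t \<otimes> g) (U v)" if v: "v \<in> J" for v
      unfolding R_def act2[OF g t v] act2[OF t g v] by (simp add: mprod_assoc cocycle_def)
    moreover have "g \<otimes> t = t \<otimes> g \<longleftrightarrow> (\<forall>v\<in>J. act (g \<otimes> t) (U v) = act (t \<otimes> g) (U v))"
      using eq_if_cocycle_eq[of "g \<otimes> t" "t \<otimes> g"] g t by auto
    ultimately show ?thesis by simp
  qed
  show ?thesis
  proof (intro exI[of _ "(\<lambda>(t, v). R t v) ` (T \<times> J)"] conjI)
    show "(\<lambda>(t, v). R t v) ` (T \<times> J) \<subseteq> polys UNIV J" using R by auto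
    show "centralizer T = zero_locus ((\<lambda>(t, v). R t v) ` (T \<times> J))"
      using eq unfolding centralizer_def zero_locus_def by auto
  qed
qed

lemma regular_cocycle: "v \<in> J \<Longrightarrow> regular (\<lambda>g. cocycle g v)"
  unfolding cocycle_def by (intro regular_mprod regular_const regular_act V_L U_L)

text \<open>The matrix of \<open>inv g\<close> is constant, so applying \<open>g\<close> to it
  changes nothing; the result is g(V) U, which is regular in \<open>g\<close>.\<close>

lemma regular_cocycle_inv: "v \<in> J \<Longrightarrow> regular (\<lambda>g. cocycle (inv g) v)"
proof -
  assume v: "v \<in> J"
  have "regular (\<lambda>g. mprod I (\<lambda>v. act g (V v)) U v)"
    by (intro regular_mprod regular_const regular_act V_L U_L v)
  then show ?thesis
  proof (rule regular_cong)
    fix g assume g: "g \<in> carrier G"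
    have "cocycle (inv g) v = act g (cocycle (inv g) v)"
      by (rule actD(5)[OF g cocycle_E[OF _ v], symmetric]) (simp add: g)
    also have "\<dots> = mprod I (\<lambda>v. act g (V v)) (\<lambda>v. act g (act (inv g) (U v))) v"
      unfolding cocycle_def by (rule diff_aut_mprod[OF act[OF g] L_sub V_L actD(1)[OF _ U_L] v]) (simp_all add: g)
    also have "\<dots> = mprod I (\<lambda>v. act g (V v)) U v"
      by (rule mprod_cong[OF _ _ v]) (simp_all add: act_inv(1)[OF g U_L])
    finally show "cocycle (inv g) v = mprod I (\<lambda>v. act g (V v)) U v" .
  qed
qed

text \<open>For an entry of \<open>U\<close>, n(g(U)) is n(U) times the matrix of \<open>g\<close>,
  since \<open>n\<close> fixes constants. Only polynomials in \<open>U\<close> are treated, because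
  quotients of regular functions need not be regular.\<close>

lemma regular_act_act:
  assumes n: "n \<in> carrier G" and R: "R \<in> polys E J"
  shows "regular (\<lambda>g. act n (act g (R U)))"
  using R
proof (induction rule: poly_funs.induct)
  case (const s)
  have "regular (\<lambda>_. s)" using const E_L by (intro regular_const) blast
  then show ?case by (rule regular_cong) (simp add: actD(5) n const)
next
  case (var v)
  have "regular (\<lambda>g. mprod I (\<lambda>v. act n (U v)) (cocycle g) v)"
    by (intro regular_mprod regular_const regular_cocycle actD(1)[OF n] U_L var)
  then show ?case
  proof (rule regular_cong)
    fix g assume g: "g \<in> carrier G"
    have "act n (act g (U v)) = mprod I (\<lambda>v. act n (U v)) (\<lambda>v. act n (cocycle g v)) v"
      unfolding act_U[OF var, of g] by (rule diff_aut_mprod[OF act[OF n] L_sub U_L cocycle_L[OF g] var])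
    also have "\<dots> = mprod I (\<lambda>v. act n (U v)) (cocycle g) v"
      by (rule mprod_cong[OF _ _ var]) (simp_all add: actD(5)[OF n cocycle_E[OF g]])
    finally show "act n (act g (U v)) = mprod I (\<lambda>v. act n (U v)) (cocycle g) v" .
  qed
next
  case (add f h)
  have L: "f U \<in> L" "h U \<in> L" using add polys_in_frac_field[OF E_sub] by blast+
  show ?case
    by (rule regular_cong[OF regular_add[OF add.IH]]) (simp add: actD(1,2) n L)
next
  case (mult f h)
  have L: "f U \<in> L" "h U \<in> L" using mult polys_in_frac_field[OF E_sub] by blast+
  show ?case
    by (rule regular_cong[OF regular_mult[OF mult.IH]]) (simp add: actD(1,3) n L)
qed

text \<open>With \<open>f\<close> written as a quotient and denominators cleared, the condition on
  \<open>g\<close> is the vanishing of a regular function.\<close>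

lemma orbit_fixed_dense:
  assumes H: "subgroup H G" and fixed: "\<And>x. x \<in> L \<Longrightarrow> (\<And>h. h \<in> H \<Longrightarrow> act h x = x) \<Longrightarrow> x \<in> E"
    and n: "n \<in> carrier G" and f: "f \<in> L" and "\<And>h. h \<in> H \<Longrightarrow> act n (act h f) = act h f" and g: "g \<in> carrier G"
  shows "act n (act g f) = act g f"
proof -
  obtain P Q where x: "P \<in> polys E J" "Q \<in> polys E J" "Q U \<noteq> 0" "f = P U / Q U"
    using f by (rule frac_fieldE)
  have PL: "P U \<in> L" "Q U \<in> L" using x polys_in_frac_field[OF E_sub] by blast+
  have Q0: "act g (Q U) \<noteq> 0" "act n (act g (Q U)) \<noteq> 0" if g: "g \<in> carrier G" for g
  proof -
    show "act g (Q U) \<noteq> 0" using actD(8)[OF g PL(2) LD(1)] actD(6)[OF g] x(3) by auto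
    then show "act n (act g (Q U)) \<noteq> 0"
      using actD(8)[OF n actD(1)[OF g PL(2)] LD(1)] actD(6)[OF n] by auto
  qed
  have eq: "act n (act g f) = act g f \<longleftrightarrow> act n (act g (P U)) * act g (Q U) - act g (P U) * act n (act g (Q U)) = 0"
    if g: "g \<in> carrier G" for g
    using Q0[OF g]
    unfolding x(4) actD(12)[OF g PL] actD(12)[OF n actD(1)[OF g PL(1)] actD(1)[OF g PL(2)]]
    by (simp add: field_simps)
  have "act n (act g (P U)) * act g (Q U) - act g (P U) * act n (act g (Q U)) = 0"
  proof (rule dense_subgroup[OF H, where g = g and
      \<Theta> = "\<lambda>g. act n (act g (P U)) * act g (Q U) - act g (P U) * act n (act g (Q U))"])
    show "regular (\<lambda>g. act n (act g (P U)) * act g (Q U) - act g (P U) * act n (act g (Q U)))"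
      by (intro regular_diff regular_mult regular_act_act regular_act n x PL)
    show "act n (act h (P U)) * act h (Q U) - act h (P U) * act n (act h (Q U)) = 0" if "h \<in> H" for h
      using eq[OF subgroup.mem_carrier[OF H that]] assms(5)[OF that] by simp
    show "x \<in> E" if "x \<in> L" "\<And>h. h \<in> H \<Longrightarrow> act h x = x" for x by (rule fixed[OF that])
  qed (rule g)
  then show ?thesis using eq[OF g] by simp
qed

text \<open>The matrix of \<open>g \<otimes> s \<otimes> inv g\<close> is regular in
  \<open>g\<close>, so \<open>dense_subgroup\<close> takes the commutation with \<open>t\<close>
  from \<open>H\<close> to all \<open>g\<close>.\<close>

lemma conj_commute_dense:
  assumes H: "subgroup H G" and fixed: "\<And>x. x \<in> L \<Longrightarrow> (\<And>h. h \<in> H \<Longrightarrow> act h x = x) \<Longrightarrow> x \<in> E"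
    and t: "t \<in> carrier G" and s: "s \<in> carrier G"
    and comm: "\<And>h. h \<in> H \<Longrightarrow> t \<otimes> (h \<otimes> s \<otimes> inv h) = h \<otimes> s \<otimes> inv h \<otimes> t" and g: "g \<in> carrier G"
  shows "t \<otimes> (g \<otimes> s \<otimes> inv g) = g \<otimes> s \<otimes> inv g \<otimes> t"
proof -
  have conj: "cocycle (g \<otimes> s \<otimes> inv g) v = mprod I (mprod I (cocycle g) (cocycle s)) (cocycle (inv g)) v"
    if g: "g \<in> carrier G" and v: "v \<in> J" for g v
  proof -
    have "cocycle (g \<otimes> s \<otimes> inv g) v = mprod I (cocycle (g \<otimes> s)) (cocycle (inv g)) v"
      by (rule cocycle_mult) (simp_all add: g s v)
    also have "\<dots> = mprod I (mprod I (cocycle g) (cocycle s)) (cocycle (inv g)) v"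
      by (rule mprod_cong[OF _ _ v]) (simp_all add: cocycle_mult g s)
    finally show ?thesis .
  qed
  have reg: "regular (\<lambda>g. cocycle (g \<otimes> s \<otimes> inv g) v)" if v: "v \<in> J" for v
  proof (rule regular_cong)
    show "regular (\<lambda>g. mprod I (mprod I (cocycle g) (cocycle s)) (cocycle (inv g)) v)"
      by (intro regular_mprod regular_cocycle regular_cocycle_inv regular_const cocycle_L s v)
  qed (simp add: conj v)
  have "cocycle (t \<otimes> (g \<otimes> s \<otimes> inv g)) v - cocycle (g \<otimes> s \<otimes> inv g \<otimes> t) v = 0" if v: "v \<in> J" for v
  proof (rule dense_subgroup[OF H, where g = g and
      \<Theta> = "\<lambda>g. cocycle (t \<otimes> (g \<otimes> s \<otimes> inv g)) v - cocycle (g \<otimes> s \<otimes> inv g \<otimes> t) v"])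
    show "x \<in> E" if "x \<in> L" "\<And>h. h \<in> H \<Longrightarrow> act h x = x" for x by (rule fixed[OF that])
    have "regular (\<lambda>g. mprod I (cocycle t) (cocycle (g \<otimes> s \<otimes> inv g)) v - mprod I (cocycle (g \<otimes> s \<otimes> inv g)) (cocycle t) v)"
      by (intro regular_diff regular_mprod reg regular_const cocycle_L t v)
    then show "regular (\<lambda>g. cocycle (t \<otimes> (g \<otimes> s \<otimes> inv g)) v - cocycle (g \<otimes> s \<otimes> inv g \<otimes> t) v)"
      by (rule regular_cong) (simp add: cocycle_mult t s v)
    show "cocycle (t \<otimes> (h \<otimes> s \<otimes> inv h)) v - cocycle (h \<otimes> s \<otimes> inv h \<otimes> t) v = 0" if "h \<in> H" for h
      using comm[OF that] by simp
  qed (rule g)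
  then have c: "cocycle (t \<otimes> (g \<otimes> s \<otimes> inv g)) v = cocycle (g \<otimes> s \<otimes> inv g \<otimes> t) v" if "v \<in> J" for v
    using that by simp
  show ?thesis
  proof (rule eq_if_cocycle_eq)
    show "act (t \<otimes> (g \<otimes> s \<otimes> inv g)) (U v) = act (g \<otimes> s \<otimes> inv g \<otimes> t) (U v)" if "v \<in> J" for v
      unfolding act_U[OF that] by (rule mprod_cong[OF _ _ that]) (simp_all add: c)
  qed (simp_all add: g s t)
qed

text \<open>\<open>H\<close>, \<open>T j\<close> and \<open>S j\<close> stand for the images in \<open>G\<close> of the automorphisms of a larger field that fix,
  respectively, \<open>E\<close>, the \<open>j\<close>-th field \<open>K\<^sub>j\<close>, and \<open>K\<^sub>1, \<dots>, K\<^sub>j\<close>.\<close>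

lemma trivial_image_if_simple:
  assumes simple: "\<And>N FF. N \<lhd> G \<Longrightarrow> FF \<subseteq> polys UNIV J \<Longrightarrow> N = zero_locus FF \<Longrightarrow> N = carrier G \<or> N = {\<one>}"
    and noncomm: "\<exists>g\<in>carrier G. \<exists>h\<in>carrier G. g \<otimes> h \<noteq> h \<otimes> g"
    and H: "subgroup H G" and fixed: "\<And>x. x \<in> L \<Longrightarrow> (\<And>h. h \<in> H \<Longrightarrow> act h x = x) \<Longrightarrow> x \<in> E"
    and S0: "S 0 = H" and S_H: "\<And>j. j \<le> k \<Longrightarrow> S j \<subseteq> H" and T_H: "\<And>j. j \<in> {1..k} \<Longrightarrow> T j \<subseteq> H"
    and S_conj: "\<And>j h s. j \<le> k \<Longrightarrow> h \<in> H \<Longrightarrow> s \<in> S j \<Longrightarrow> h \<otimes> s \<otimes> inv h \<in> S j"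
    and comm: "\<And>j s t. j < k \<Longrightarrow> s \<in> S j \<Longrightarrow> t \<in> T (Suc j) \<Longrightarrow> t \<otimes> s \<otimes> inv t \<otimes> inv s \<in> S (Suc j)"
    and f: "f \<in> L" "f \<notin> E" and S_f: "\<And>s. s \<in> S k \<Longrightarrow> act s f = f"
  shows "\<exists>j\<in>{1..k}. T j \<subseteq> {\<one>}"
proof -
  note HG = subgroup.mem_carrier[OF H]
  have simple_fixer: "fixer X = carrier G \<or> fixer X = {\<one>}"
    if X: "X \<subseteq> L" "\<And>g x. g \<in> carrier G \<Longrightarrow> x \<in> X \<Longrightarrow> act g x \<in> X" for X
    using fixer_closed[OF X(1)] simple[OF fixer_normal[OF X]] by blast
  have simple_centralizer: "centralizer W = carrier G \<or> centralizer W = {\<one>}"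
    if W: "W \<subseteq> carrier G" "\<And>x t. x \<in> carrier G \<Longrightarrow> t \<in> W \<Longrightarrow> x \<otimes> t \<otimes> inv x \<in> W" for W
    using centralizer_closed[OF W(1)] simple[OF centralizer_normal[OF W]] by blast
  have f_moved: "\<exists>h\<in>H. act h f \<noteq> f" using fixed[OF f(1)] f(2) by blast
  have Sk: "S k \<subseteq> {\<one>}"
  proof
    fix s assume s: "s \<in> S k"
    then have sH: "s \<in> H" using S_H by blast
    \<comment> \<open>The orbit is stable under all of \<open>G\<close>, so its fixer is closed and
      normal; it is proper because \<open>H\<close> moves \<open>f\<close>.\<close>
    define X where "X = (\<lambda>g. act g f) ` carrier G"
    have X: "X \<subseteq> L" using actD(1)[OF _ f(1)] by (auto simp: X_def)
    have X_inv: "act g x \<in> X" if g: "g \<in> carrier G" and x: "x \<in> X" for g x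
    proof -
      obtain h where h: "h \<in> carrier G" "x = act h f" using x by (auto simp: X_def)
      then have "act g x = act (g \<otimes> h) f" using act_mult[OF g h(1) f(1)] by simp
      then show ?thesis using g h(1) by (simp add: X_def)
    qed
    have "fixer X \<noteq> carrier G"
    proof
      assume eq: "fixer X = carrier G"
      obtain h where h: "h \<in> H" "act h f \<noteq> f" using f_moved by blast
      have "f \<in> X" unfolding X_def by (rule image_eqI[of _ _ \<one>]) (simp_all add: act_one f)
      then have "act h f = f" using eq HG[OF h(1)] by (auto simp: fixer_def)
      then show False using h(2) by simp
    qed
    then have one: "fixer X = {\<one>}" using simple_fixer[OF X X_inv] by blast
    \<comment> \<open>Equivalently, the conjugate of \<open>s\<close> by \<open>inv h\<close>, which
      again lies in \<open>S k\<close>, fixes \<open>f\<close>.\<close>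
    have sH_orbit: "act s (act h f) = act h f" if h: "h \<in> H" for h
    proof -
      have hc: "h \<in> carrier G" and sc: "s \<in> carrier G" by (rule HG[OF h], rule HG[OF sH])
      have "inv h \<otimes> s \<otimes> inv (inv h) \<in> S k"
        by (rule S_conj[OF order_refl subgroup.m_inv_closed[OF H h] s])
      then have "act (inv h \<otimes> s \<otimes> h) f = f" using S_f hc by simp
      then have "act h (act (inv h \<otimes> s \<otimes> h) f) = act h f" by simp
      moreover have "act h (act (inv h \<otimes> s \<otimes> h) f) = act (h \<otimes> (inv h \<otimes> s \<otimes> h)) f"
        by (rule act_mult[symmetric]) (simp_all add: hc sc f)
      moreover have "h \<otimes> (inv h \<otimes> s \<otimes> h) = s \<otimes> h" using hc sc by (simp add: G.m_assoc[symmetric])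
      ultimately show ?thesis using act_mult[OF sc hc f(1)] by simp
    qed
    have "act s (act g f) = act g f" if g: "g \<in> carrier G" for g
    proof (rule orbit_fixed_dense[OF H _ HG[OF sH] f(1) _ g])
      show "x \<in> E" if "x \<in> L" "\<And>h. h \<in> H \<Longrightarrow> act h x = x" for x by (rule fixed[OF that])
    qed (rule sH_orbit)
    then have "s \<in> fixer X" using HG[OF sH] by (auto simp: fixer_def X_def)
    then show "s \<in> {\<one>}" using one by simp
  qed
  have "\<not> S 0 \<subseteq> {\<one>}"
  proof
    assume "S 0 \<subseteq> {\<one>}"
    then show False using f_moved S0 act_one[OF f(1)] by auto
  qed
  define m where "m = (LEAST j. S j \<subseteq> {\<one>})"
  have m: "S m \<subseteq> {\<one>}" unfolding m_def by (rule LeastI[of _ k]) (rule Sk)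
  have mk: "m \<le> k" unfolding m_def by (rule Least_le) (rule Sk)
  have "m \<noteq> 0" using m \<open>\<not> S 0 \<subseteq> {\<one>}\<close> by auto
  then obtain j where j: "m = Suc j" by (cases m) auto
  have "\<not> S j \<subseteq> {\<one>}" using not_less_Least[of j "\<lambda>j. S j \<subseteq> {\<one>}"] j by (simp add: m_def)
  then obtain s where s: "s \<in> S j" "s \<noteq> \<one>" by blast
  show ?thesis
  proof (rule ccontr)
    assume no: "\<not> ?thesis"
    have jk: "j < k" "j \<le> k" "Suc j \<in> {1..k}" using mk j by auto
    then obtain t where t: "t \<in> T (Suc j)" "t \<noteq> \<one>" using no by blast
    have tc: "t \<in> carrier G" using HG T_H[OF jk(3)] t(1) by blast
    have Sc: "s \<in> carrier G" if "s \<in> S j" for s using HG S_H[OF jk(2)] that by blast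
    \<comment> \<open>\<open>S j\<close> is stable under conjugation by \<open>H\<close> only.
      Adding the conjugates under \<open>G\<close> makes the centralizer normal in \<open>G\<close>,
      and \<open>conj_commute_dense\<close> keeps \<open>t\<close> in it.\<close>
    define W where "W = {x \<otimes> s \<otimes> inv x | x s. x \<in> carrier G \<and> s \<in> S j}"
    have W: "W \<subseteq> carrier G" using Sc by (auto simp: W_def)
    have W_inv: "x \<otimes> w \<otimes> inv x \<in> W" if x: "x \<in> carrier G" and "w \<in> W" for x w
    proof -
      obtain y s where y: "w = y \<otimes> s \<otimes> inv y" "y \<in> carrier G" "s \<in> S j" using \<open>w \<in> W\<close> by (auto simp: W_def)
      have "x \<otimes> w \<otimes> inv x = (x \<otimes> y) \<otimes> s \<otimes> inv (x \<otimes> y)"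
        using x y Sc[OF y(3)] by (simp add: G.m_assoc G.inv_mult_group)
      then show ?thesis using x y unfolding W_def by blast
    qed
    have "t \<otimes> (x \<otimes> s' \<otimes> inv x) = x \<otimes> s' \<otimes> inv x \<otimes> t" if x: "x \<in> carrier G" and s': "s' \<in> S j" for x s'
    proof (rule conj_commute_dense[OF H _ tc Sc[OF s'] _ x])
      show "x \<in> E" if "x \<in> L" "\<And>h. h \<in> H \<Longrightarrow> act h x = x" for x by (rule fixed[OF that])
      fix h assume h: "h \<in> H"
      let ?r = "h \<otimes> s' \<otimes> inv h"
      have r: "?r \<in> S j" by (rule S_conj[OF jk(2) h s'])
      have "t \<otimes> ?r \<otimes> inv t \<otimes> inv ?r = \<one>" using comm[OF jk(1) r t(1)] m j by blast
      then have "t \<otimes> ?r \<otimes> inv t \<otimes> inv ?r \<otimes> ?r \<otimes> t = ?r \<otimes> t" using Sc[OF r] tc by simp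
      then show "t \<otimes> ?r = ?r \<otimes> t" using Sc[OF r] tc by (simp add: G.m_assoc)
    qed
    then have "t \<in> centralizer W" using tc by (auto simp: centralizer_def W_def)
    \<comment> \<open>The centralizer contains \<open>t\<close>, so it is everything and
      \<open>s\<close> is central. The center is then a nontrivial closed normal subgroup, hence all
      of \<open>G\<close>.\<close>
    then have cW: "centralizer W = carrier G" using simple_centralizer[OF W W_inv] t(2) by blast
    have "s \<in> W" unfolding W_def using s(1) Sc[OF s(1)]
      by (intro CollectI exI[of _ \<one>] exI[of _ s]) simp
    have "s \<otimes> x = x \<otimes> s" if "x \<in> carrier G" for x
    proof -
      have "x \<in> centralizer W" using cW that by simp
      then show ?thesis using \<open>s \<in> W\<close> by (simp add: centralizer_def)
    qed
    then have "s \<in> centralizer (carrier G)" using Sc[OF s(1)] by (simp add: centralizer_def)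
    then have "centralizer (carrier G) = carrier G"
      using simple_centralizer[of "carrier G"] s(2) by auto
    then show False using noncomm by (auto simp: centralizer_def)
  qed
qed

end

section \<open>Composita\<close>

text \<open>The compositum of the fields generated by \<open>U 0, \<dots>, U k\<close> is generated by the block diagonal matrix
  with blocks \<open>U b\<close> and \<open>transpose (V b)\<close>. Adding the dual blocks makes the entries of the inverse
  matrix polynomials in the entries of the matrix.\<close>

type_synonym index = "(nat \<times> bool) \<times> nat"

definition block :: "(nat \<times> bool \<Rightarrow> nat \<times> nat \<Rightarrow> 'a::comm_ring_1) \<Rightarrow> index \<times> index \<Rightarrow> 'a" where
  "block X = (\<lambda>((b, i), (c, j)). if b = c then X b (i, j) else 0)"

lemma mprod_block:
  assumes "finite T" "\<And>b. b \<in> T \<Longrightarrow> finite (I b)" "fst (fst v) \<in> T"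
  shows "mprod (Sigma T I) (block X) (block Y) v = block (\<lambda>b. mprod (I b) (X b) (Y b)) v"
proof -
  obtain x y where xy: "v = (x, y)" by (rule prod.exhaust)
  obtain b i where x: "x = (b, i)" by (rule prod.exhaust)
  obtain c j where y: "y = (c, j)" by (rule prod.exhaust)
  note v = xy[unfolded x y]
  have "mprod (Sigma T I) (block X) (block Y) v =
    (\<Sum>(d, l)\<in>Sigma T I. (if b = d then X b (i, l) else 0) * (if d = c then Y d (l, j) else 0))"
    unfolding mprod_def v prod.case by (rule sum.cong) (auto simp: block_def)
  also have "\<dots> = (\<Sum>d\<in>T. \<Sum>l\<in>I d. (if b = d then X b (i, l) else 0) * (if d = c then Y d (l, j) else 0))"
    using assms by (intro sum.Sigma[symmetric]) auto
  also have "\<dots> = (\<Sum>d\<in>{b}. \<Sum>l\<in>I d. (if b = d then X b (i, l) else 0) * (if d = c then Y d (l, j) else 0))"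
  proof (rule sum.mono_neutral_right)
    show "\<forall>d\<in>T - {b}. (\<Sum>l\<in>I d. (if b = d then X b (i, l) else 0) * (if d = c then Y d (l, j) else 0)) = 0"
    proof
      fix d assume "d \<in> T - {b}"
      then have "b \<noteq> d" by blast
      then show "(\<Sum>l\<in>I d. (if b = d then X b (i, l) else 0) * (if d = c then Y d (l, j) else 0)) = 0" by simp
    qed
  qed (use assms(1,3) v in auto)
  also have "\<dots> = block (\<lambda>b. mprod (I b) (X b) (Y b)) v"
    by (auto simp: block_def v mprod_def)
  finally show ?thesis .
qed

definition mtranspose :: "('n \<times> 'n \<Rightarrow> 'a) \<Rightarrow> 'n \<times> 'n \<Rightarrow> 'a" where
  "mtranspose X = (\<lambda>(i, j). X (j, i))"

lemma mprod_transpose: "mprod I (mtranspose X) (mtranspose Y) (i, j) = mprod I Y X (j, i)"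
  by (auto simp: mprod_def mtranspose_def mult.commute)

text \<open>Index 0 is meant for the field of \<open>f\<close>, the indices from 1 to
  \<open>k\<close> for the fields of the \<open>f\<^sub>i\<close>.\<close>

locale compositum = diff_field D cst
  for D :: "'a::field_char_0 \<Rightarrow> 'a" and cst :: "complex \<Rightarrow> 'a" +
  fixes F :: "'a set" and k :: nat and n :: "nat \<Rightarrow> nat" and B U V :: "nat \<Rightarrow> nat \<times> nat \<Rightarrow> 'a"
  assumes fm: "b \<le> k \<Longrightarrow> fundamental_matrix D cst F {..<n b} (B b) (U b) (V b)"
begin

definition T :: "(nat \<times> bool) set" where "T = {..k} \<times> UNIV"
definition I :: "index set" where "I = (SIGMA c:T. {..<n (fst c)})"
text \<open>By \<open>D_V\<close> the dual block \<open>mtranspose (V b)\<close> solves the system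
  with matrix \<open>- mtranspose (B b)\<close>.\<close>

definition Bb :: "index \<times> index \<Rightarrow> 'a" where
  "Bb = block (\<lambda>(b, s). if s then B b else (\<lambda>v. - mtranspose (B b) v))"
definition Ub :: "index \<times> index \<Rightarrow> 'a" where
  "Ub = block (\<lambda>(b, s). if s then U b else mtranspose (V b))"
definition Vb :: "index \<times> index \<Rightarrow> 'a" where
  "Vb = block (\<lambda>(b, s). if s then V b else mtranspose (U b))"

abbreviation "J \<equiv> I \<times> I"
abbreviation "L \<equiv> frac_field F J Ub"
abbreviation "K b \<equiv> frac_field F ({..<n b} \<times> {..<n b}) (U b)"

lemma F: "diff_subfield F"
  using fm[of 0] by (simp add: fundamental_matrix_def fundamental_matrix_axioms_def)

lemma F_sub: "is_subfield F" using F by (simp add: diff_subfield_def)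

lemma finite_I: "finite I" by (auto simp: I_def T_def)

lemma mprod_I: "v \<in> J \<Longrightarrow> mprod I (block X) (block Y) v = block (\<lambda>c. mprod {..<n (fst c)} (X c) (Y c)) v"
  unfolding I_def by (rule mprod_block) (auto simp: T_def)

lemma block_cong:
  assumes "\<And>c v. c \<in> T \<Longrightarrow> v \<in> {..<n (fst c)} \<times> {..<n (fst c)} \<Longrightarrow> X c v = Y c v" and "v \<in> J"
  shows "block X v = block Y v"
  using assms by (auto simp: block_def I_def)

lemma block_one: "v \<in> J \<Longrightarrow> block (\<lambda>_. mone) v = mone v"
  by (auto simp: block_def mone_def)

text \<open>The base may be any larger differential field: the same matrix is used over
  \<open>F\<close> and over the fields \<open>K j\<close>.\<close>

lemma fundamental_block:
  assumes E: "diff_subfield E" and FE: "F \<subseteq> E"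
  shows "fundamental_matrix D cst E I Bb Ub Vb"
proof (unfold_locales)
  show "diff_subfield E" by (rule E)
  show "finite I" by (rule finite_I)
  fix v assume v: "v \<in> J"
  have 0: "0 \<in> E" using E by (simp add: diff_subfield_def is_subfield_def)
  have blk: "b \<le> k" if "((b, s), i) \<in> I" for b s i using that by (auto simp: I_def T_def)
  note UVb = fundamental_matrix.UV[OF fm] and VUb = fundamental_matrix.VU[OF fm]
  show "mprod I Ub Vb v = mone v"
  proof -
    have "mprod I Ub Vb v = block (\<lambda>_. mone) v"
      unfolding Ub_def Vb_def mprod_I[OF v]
      by (rule block_cong[OF _ v])
         (auto simp: T_def UVb mprod_transpose VUb mone_def)
    then show ?thesis by (simp only: block_one[OF v])
  qed
  show "mprod I Vb Ub v = mone v"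
  proof -
    have "mprod I Vb Ub v = block (\<lambda>_. mone) v"
      unfolding Ub_def Vb_def mprod_I[OF v]
      by (rule block_cong[OF _ v])
         (auto simp: T_def VUb mprod_transpose UVb mone_def)
    then show ?thesis by (simp only: block_one[OF v])
  qed
  show "Bb v \<in> E"
  proof -
    have "B b w \<in> E" if "b \<le> k" "w \<in> {..<n b} \<times> {..<n b}" for b w
      using fundamental_matrix.B[OF fm[OF that(1)] that(2)] FE by blast
    moreover have "- x \<in> E" if "x \<in> E" for x using that E by (simp add: diff_subfield_def is_subfield_def)
    ultimately show ?thesis using v 0 by (auto simp: Bb_def block_def I_def T_def mtranspose_def)
  qed
  show "D (Ub v) = mprod I Bb Ub v"
  proof -
    have "mprod I Bb Ub v = block (\<lambda>c v. D ((case c of (b, s) \<Rightarrow> if s then U b else mtranspose (V b)) v)) v"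
      unfolding Bb_def Ub_def mprod_I[OF v]
    proof (rule block_cong[OF _ v])
      fix c w assume c: "c \<in> T" and w: "w \<in> {..<n (fst c)} \<times> {..<n (fst c)}"
      obtain b s where cb: "c = (b, s)" by (rule prod.exhaust)
      obtain i j where wi: "w = (i, j)" by (rule prod.exhaust)
      note cw = cb wi
      have b: "b \<le> k" and ij: "(i, j) \<in> {..<n b} \<times> {..<n b}" "(j, i) \<in> {..<n b} \<times> {..<n b}"
        using c w by (auto simp: cw T_def)
      show "mprod {..<n (fst c)} (case c of (b, s) \<Rightarrow> if s then B b else (\<lambda>v. - mtranspose (B b) v))
          (case c of (b, s) \<Rightarrow> if s then U b else mtranspose (V b)) w =
        D ((case c of (b, s) \<Rightarrow> if s then U b else mtranspose (V b)) w)"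
      proof (cases s)
        case True
        then show ?thesis using fundamental_matrix.DU[OF fm[OF b] ij(1)] by (simp add: cw)
      next
        case False
        have "mprod {..<n b} (\<lambda>v. - mtranspose (B b) v) (mtranspose (V b)) (i, j) =
          - mprod {..<n b} (mtranspose (B b)) (mtranspose (V b)) (i, j)"
          by (simp add: mprod_def sum_negf)
        also have "\<dots> = D (V b (j, i))"
          using fundamental_matrix.D_V[OF fm[OF b] ij(2)] by (simp add: mprod_transpose)
        finally show ?thesis using False by (simp add: cw mtranspose_def)
      qed
    qed
    also have "\<dots> = D (Ub v)" by (simp add: Ub_def block_def split: prod.splits)
    finally show ?thesis by simp
  qed
qed

text \<open>Each entry of \<open>Vb\<close> is the transposed entry of the dual block of
  \<open>Ub\<close>, so a single variable is the polynomial sought.\<close>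

lemma Vb_polys: "v \<in> J \<Longrightarrow> \<exists>P\<in>polys E J. P Ub = Vb v"
proof -
  assume v: "v \<in> J"
  obtain x y where xy: "v = (x, y)" by (rule prod.exhaust)
  obtain b s i where x: "x = ((b, s), i)" by (cases x) auto
  obtain c t j where y: "y = ((c, t), j)" by (cases y) auto
  note v_eq = xy[unfolded x y]
  have "Vb v = (if b = c \<and> s = t then if s then V b (i, j) else U b (j, i) else 0)"
    unfolding v_eq by (simp add: Vb_def block_def mtranspose_def)
  moreover have "Ub (((c, \<not> t), j), ((b, \<not> s), i)) = (if b = c \<and> s = t then if s then V b (i, j) else U b (j, i) else 0)"
    by (cases s; cases t; cases "b = c") (simp_all add: Ub_def block_def mtranspose_def)
  ultimately have "Vb v = Ub (((c, \<not> t), j), ((b, \<not> s), i))" by (simp only:)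
  moreover have "(((c, \<not> t), j), ((b, \<not> s), i)) \<in> J" using v by (auto simp: v_eq I_def T_def)
  ultimately show ?thesis
    by (intro bexI[of _ "\<lambda>x. x (((c, \<not> t), j), ((b, \<not> s), i))"] polys_var) auto
qed

lemma diff_subfield_L: "diff_subfield L"
  by (rule fundamental_matrix.diff_subfield_L[OF fundamental_block[OF F subset_refl]])

lemma L_sub: "is_subfield L" using diff_subfield_L by (simp add: diff_subfield_def)

lemma F_L: "F \<subseteq> L" by (rule frac_field_base[OF F_sub])

lemma frac_field_L: "diff_subfield E \<Longrightarrow> F \<subseteq> E \<Longrightarrow> E \<subseteq> L \<Longrightarrow> frac_field E J Ub = L"
proof
  assume E: "diff_subfield E" "F \<subseteq> E" "E \<subseteq> L"
  show "frac_field E J Ub \<subseteq> L"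
    by (rule frac_field_subset[OF L_sub E(3)]) (rule frac_field_var[OF F_sub])
  show "L \<subseteq> frac_field E J Ub"
  proof
    fix x assume "x \<in> L"
    then obtain P Q where "P \<in> polys F J" "Q \<in> polys F J" "Q Ub \<noteq> 0" "x = P Ub / Q Ub" by (rule frac_fieldE)
    then show "x \<in> frac_field E J Ub"
      using poly_funs_mono[OF _ E(2)] by (intro frac_fieldI) auto
  qed
qed

lemma automorphism_moving:
  assumes E: "diff_subfield E" "F \<subseteq> E" "E \<subseteq> L" and z: "z \<in> L" "z \<notin> E"
  shows "\<exists>\<sigma>. diff_aut E L \<sigma> \<and> \<sigma> z \<noteq> z"
proof -
  interpret fm: fundamental_matrix D cst E I Bb Ub Vb by (rule fundamental_block[OF E(1,2)])
  have "\<exists>\<sigma>. diff_aut E (frac_field E J Ub) \<sigma> \<and> \<sigma> z \<noteq> z"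
    by (rule fm.automorphism_moving[OF Vb_polys]) (simp_all add: frac_field_L[OF E] z)
  then show ?thesis by (simp only: frac_field_L[OF E])
qed

lemma U_L: "b \<le> k \<Longrightarrow> v \<in> {..<n b} \<times> {..<n b} \<Longrightarrow> U b v \<in> L"
proof -
  assume b: "b \<le> k" and "v \<in> {..<n b} \<times> {..<n b}"
  then obtain i j where v: "v = (i, j)" "i < n b" "j < n b" by auto
  have "U b v = Ub (((b, True), i), ((b, True), j))" by (simp add: Ub_def block_def v)
  also have "\<dots> \<in> L" by (rule frac_field_var[OF F_sub]) (use b v in \<open>auto simp: I_def T_def\<close>)
  finally show ?thesis .
qed

lemma K_L: "b \<le> k \<Longrightarrow> K b \<subseteq> L"
  by (rule frac_field_subset[OF L_sub F_L]) (rule U_L)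

lemma diff_subfield_K: "b \<le> k \<Longrightarrow> diff_subfield (K b)"
  by (rule fundamental_matrix.diff_subfield_L[OF fm])

lemma F_K: "F \<subseteq> K b" by (rule frac_field_base[OF F_sub])

text \<open>Normality of Picard-Vessiot fields: \<open>\<sigma>\<close> sends \<open>U b\<close> to
  another solution of its system, which is \<open>U b\<close> times a constant matrix.\<close>

lemma diff_aut_K_into:
  assumes \<sigma>: "diff_aut F L \<sigma>" and b: "b \<le> k" and x: "x \<in> K b"
  shows "\<sigma> x \<in> K b"
proof -
  interpret fm: fundamental_matrix D cst F "{..<n b}" "B b" "U b" "V b" by (rule fm[OF b])
  note \<sigma>D = diff_autD[OF \<sigma> L_sub]
  let ?J = "{..<n b} \<times> {..<n b}"
  have Ksub: "is_subfield (K b)" by (rule is_subfield_frac_field[OF F_sub])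
  have BL: "w \<in> ?J \<Longrightarrow> B b w \<in> L" for w using fm.B F_L by blast
  have DU: "D (\<sigma> (U b v)) = mprod {..<n b} (B b) (\<lambda>v. \<sigma> (U b v)) v" if v: "v \<in> ?J" for v
  proof -
    have "D (\<sigma> (U b v)) = \<sigma> (mprod {..<n b} (B b) (U b) v)"
      using \<sigma>D(4)[OF U_L[OF b v]] fm.DU[OF v] by simp
    also have "\<dots> = mprod {..<n b} (\<lambda>v. \<sigma> (B b v)) (\<lambda>v. \<sigma> (U b v)) v"
      by (rule diff_aut_mprod[OF \<sigma> L_sub BL U_L[OF b] v])
    also have "\<dots> = mprod {..<n b} (B b) (\<lambda>v. \<sigma> (U b v)) v"
      by (rule mprod_cong[OF _ _ v]) (simp_all add: \<sigma>D(5)[OF fm.B])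
    finally show ?thesis .
  qed
  have "\<exists>A. \<forall>v\<in>?J. \<sigma> (U b v) = mprod {..<n b} (U b) (\<lambda>v. cst (A v)) v \<and>
    mprod {..<n b} (V b) (\<lambda>v. \<sigma> (U b v)) v = cst (A v)"
    by (rule fm.constant_quotient[OF DU])
  then obtain A where A: "\<forall>v\<in>?J. \<sigma> (U b v) = mprod {..<n b} (U b) (\<lambda>v. cst (A v)) v \<and>
    mprod {..<n b} (V b) (\<lambda>v. \<sigma> (U b v)) v = cst (A v)" by (elim exE)
  have \<sigma>U: "\<sigma> (U b v) \<in> K b" if v: "v \<in> ?J" for v
  proof -
    obtain i j where ij: "v = (i, j)" "i < n b" "j < n b" using v by auto
    have "\<sigma> (U b v) = (\<Sum>l<n b. U b (i, l) * cst (A (l, j)))"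
      using bspec[OF A v] by (simp add: ij mprod_def)
    also have "\<dots> \<in> K b"
    proof (intro is_subfield_sum[OF Ksub] is_subfieldD(4)[OF Ksub])
      fix l assume "l \<in> {..<n b}"
      then show "U b (i, l) \<in> K b" by (intro frac_field_var[OF F_sub]) (use ij in auto)
      show "cst (A (l, j)) \<in> K b" by (rule subsetD[OF F_K fm.cst_E])
    qed
    finally show ?thesis .
  qed
  obtain P Q where x: "P \<in> polys F ?J" "Q \<in> polys F ?J" "Q (U b) \<noteq> 0" "x = P (U b) / Q (U b)"
    using x by (rule frac_fieldE)
  have RK: "\<sigma> (R (U b)) \<in> K b" if R: "R \<in> polys F ?J" for R
  proof -
    have "\<sigma> (R (U b)) = R (\<lambda>v. \<sigma> (U b v))"
      by (rule diff_aut_poly[OF \<sigma> L_sub F_L R U_L[OF b]])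
    also have "\<dots> \<in> K b" by (rule poly_funs_in_subfield[OF Ksub R F_K \<sigma>U])
    finally show ?thesis .
  qed
  have PL: "R (U b) \<in> L" if "R \<in> polys F ?J" for R
    by (rule poly_funs_in_subfield[OF L_sub that F_L U_L[OF b]])
  have "\<sigma> x = \<sigma> (P (U b)) / \<sigma> (Q (U b))" unfolding x(4) by (rule \<sigma>D(12)[OF PL[OF x(1)] PL[OF x(2)]])
  then show ?thesis using is_subfieldD(8)[OF Ksub RK[OF x(1)] RK[OF x(2)]] by simp
qed

end

section \<open>Composition and inversion of differential automorphisms\<close>

context diff_field begin

lemma diff_aut_mono: "diff_aut E L \<sigma> \<Longrightarrow> F \<subseteq> E \<Longrightarrow> diff_aut F L \<sigma>"
  unfolding diff_aut_def by blast

lemma diff_aut_id: "diff_aut E L (\<lambda>x. x)"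
  by (simp add: diff_aut_def bij_betw_def inj_on_def)

lemma diff_aut_comp:
  assumes \<sigma>: "diff_aut E L \<sigma>" and \<tau>: "diff_aut E L \<tau>" and L: "is_subfield L"
  shows "diff_aut E L (\<lambda>x. \<sigma> (\<tau> x))"
proof -
  note \<sigma>D = diff_autD[OF \<sigma> L] and \<tau>D = diff_autD[OF \<tau> L]
  have D_L: "D x \<in> L" if "x \<in> L" "D ` L \<subseteq> L" for x using that by blast
  have "bij_betw (\<sigma> \<circ> \<tau>) L L"
    by (rule bij_betw_trans) (use \<sigma> \<tau> in \<open>auto simp: diff_aut_def\<close>)
  moreover have "D (\<sigma> (\<tau> x)) = \<sigma> (\<tau> (D x))" if "x \<in> L" for x
    using \<sigma>D(4)[OF \<tau>D(1)[OF that]] \<tau>D(4)[OF that] by simp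
  ultimately show ?thesis
    unfolding diff_aut_def comp_def by (simp add: \<sigma>D(2,3,5) \<tau>D(1,2,3,5))
qed

lemma diff_aut_inv_into:
  assumes \<sigma>: "diff_aut E L \<sigma>" and L: "is_subfield L" and "E \<subseteq> L" and DL: "D ` L \<subseteq> L"
  shows "diff_aut E L (inv_into L \<sigma>)"
    "x \<in> L \<Longrightarrow> \<sigma> (inv_into L \<sigma> x) = x" "x \<in> L \<Longrightarrow> inv_into L \<sigma> (\<sigma> x) = x"
proof -
  note \<sigma>D = diff_autD[OF \<sigma> L]
  have bij: "bij_betw \<sigma> L L" using \<sigma> by (simp add: diff_aut_def)
  let ?i = "inv_into L \<sigma>"
  have bi: "bij_betw ?i L L" by (rule bij_betw_inv_into[OF bij])
  have si: "\<sigma> (?i x) = x" if "x \<in> L" for x by (rule bij_betw_inv_into_right[OF bij that])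
  have li: "?i (\<sigma> x) = x" if "x \<in> L" for x by (rule bij_betw_inv_into_left[OF bij that])
  have iL: "?i x \<in> L" if "x \<in> L" for x using bi that by (auto simp: bij_betw_def)
  have eqI: "?i x = y" if "y \<in> L" "\<sigma> y = x" for x y using li that by blast
  note LD = is_subfieldD[OF L]
  have "D (?i x) = ?i (D x)" if x: "x \<in> L" for x
  proof (rule eqI[symmetric])
    show "D (?i x) \<in> L" using iL[OF x] DL by blast
    show "\<sigma> (D (?i x)) = D x" using \<sigma>D(4)[OF iL[OF x]] si[OF x] by simp
  qed
  moreover have "?i (x + y) = ?i x + ?i y" "?i (x * y) = ?i x * ?i y" if "x \<in> L" "y \<in> L" for x y
    using that by (intro eqI; simp add: LD iL \<sigma>D(2,3) si)+
  moreover have "?i x = x" if "x \<in> E" for x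
    by (rule eqI) (use that \<open>E \<subseteq> L\<close> \<sigma>D(5) in auto)
  ultimately show "diff_aut E L ?i" using bi by (simp add: diff_aut_def)
  show "x \<in> L \<Longrightarrow> \<sigma> (?i x) = x" "x \<in> L \<Longrightarrow> ?i (\<sigma> x) = x" by (rule si, assumption) (rule li)
qed

end

text \<open>\<open>full\<close> lets the restriction to \<open>K 0\<close> of any automorphism of
  \<open>L\<close> be an element of \<open>G\<close>. \<open>f_generated\<close> says through
  subfields that \<open>f\<close> lies in the field generated by
  \<open>K 1, ..., K k\<close>.\<close>

locale simple_galois_action = compositum D cst F k n B U V +
    act: galois_action D cst F "{..<n 0}" "B 0" "U 0" "V 0" G act
  for D :: "'a::field_char_0 \<Rightarrow> 'a" and cst :: "complex \<Rightarrow> 'a"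
    and F k n and B U V :: "nat \<Rightarrow> nat \<times> nat \<Rightarrow> 'a" and G :: "('g, 'm) monoid_scheme" (structure)
    and act :: "'g \<Rightarrow> 'a \<Rightarrow> 'a" +
  fixes f :: 'a
  assumes full: "\<And>\<tau>. diff_aut F (K 0) \<tau> \<Longrightarrow> \<exists>g\<in>carrier G. \<forall>x\<in>K 0. act g x = \<tau> x"
    and simple: "\<And>N FF. N \<lhd> G \<Longrightarrow> FF \<subseteq> polys UNIV ({..<n 0} \<times> {..<n 0}) \<Longrightarrow>
      N = act.zero_locus FF \<Longrightarrow> N = carrier G \<or> N = {\<one>}"
    and noncomm: "\<exists>g\<in>carrier G. \<exists>h\<in>carrier G. g \<otimes> h \<noteq> h \<otimes> g"
    and f: "f \<in> K 0" "f \<notin> F"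
    and f_generated: "\<And>M. is_subfield M \<Longrightarrow> F \<subseteq> M \<Longrightarrow> (\<And>i. i \<in> {1..k} \<Longrightarrow> K i \<subseteq> M) \<Longrightarrow> f \<in> M"
begin

definition restricts :: "('a \<Rightarrow> 'a) \<Rightarrow> 'g \<Rightarrow> bool" where
  "restricts \<sigma> g \<longleftrightarrow> diff_aut F L \<sigma> \<and> g \<in> carrier G \<and> (\<forall>x\<in>K 0. act g x = \<sigma> x)"

definition image_fixing :: "'a set \<Rightarrow> 'g set" where
  "image_fixing X = {g. \<exists>\<sigma>. restricts \<sigma> g \<and> (\<forall>x\<in>X. \<sigma> x = x)}"

abbreviation inv_aut :: "('a \<Rightarrow> 'a) \<Rightarrow> 'a \<Rightarrow> 'a" where
  "inv_aut \<sigma> \<equiv> inv_into L \<sigma>"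

lemma D_L: "D ` L \<subseteq> L" using diff_subfield_L by (simp add: diff_subfield_def)

lemmas inv_aut = diff_aut_inv_into[OF _ L_sub F_L D_L]

lemma K0_L: "K 0 \<subseteq> L" by (rule K_L) simp

lemma restrictsD:
  assumes "restricts \<sigma> g"
  shows "diff_aut F L \<sigma>" "g \<in> carrier G" "x \<in> K 0 \<Longrightarrow> act g x = \<sigma> x"
  using assms by (simp_all add: restricts_def)

text \<open>\<open>K 0\<close> is mapped into itself by \<open>\<sigma>\<close> and by its inverse,
  so the restriction is an automorphism of \<open>K 0\<close>, and \<open>full\<close> supplies the
  group element.\<close>

lemma restriction_exists:
  assumes \<sigma>: "diff_aut F L \<sigma>"
  shows "\<exists>g. restricts \<sigma> g"
proof -
  note \<sigma>D = diff_autD[OF \<sigma> L_sub]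
  have into: "\<sigma> x \<in> K 0" if "x \<in> K 0" for x by (rule diff_aut_K_into[OF \<sigma> _ that]) simp
  have bij: "bij_betw \<sigma> (K 0) (K 0)"
    unfolding bij_betw_def
  proof
    show "inj_on \<sigma> (K 0)" by (rule inj_onI) (rule \<sigma>D(8)[OF subsetD[OF K0_L] subsetD[OF K0_L]])
    have "x \<in> \<sigma> ` K 0" if x: "x \<in> K 0" for x
    proof (rule image_eqI)
      show "inv_aut \<sigma> x \<in> K 0" by (rule diff_aut_K_into[OF inv_aut(1)[OF \<sigma>] _ x]) simp
      show "x = \<sigma> (inv_aut \<sigma> x)" using inv_aut(2)[OF \<sigma>, of x] K0_L x by auto
    qed
    then show "\<sigma> ` K 0 = K 0" using into by blast
  qed
  have "diff_aut F (K 0) \<sigma>"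
    unfolding diff_aut_def
  proof (intro conjI ballI bij)
    fix x y assume "x \<in> K 0" "y \<in> K 0"
    then have xy: "x \<in> L" "y \<in> L" using K0_L by blast+
    show "\<sigma> (x + y) = \<sigma> x + \<sigma> y" "\<sigma> (x * y) = \<sigma> x * \<sigma> y" using \<sigma>D(2,3)[OF xy] by simp_all
    show "D (\<sigma> x) = \<sigma> (D x)" by (rule \<sigma>D(4)[OF xy(1)])
  qed (rule \<sigma>D(5))
  from full[OF this] obtain g where "g \<in> carrier G" "\<forall>x\<in>K 0. act g x = \<sigma> x" by (elim bexE)
  then show ?thesis using \<sigma> by (auto simp: restricts_def)
qed

lemma restricts_comp:
  assumes "restricts \<sigma> g" "restricts \<tau> h"
  shows "restricts (\<lambda>x. \<sigma> (\<tau> x)) (g \<otimes> h)"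
  unfolding restricts_def
proof (intro conjI ballI)
  note s = restrictsD[OF assms(1)] and t = restrictsD[OF assms(2)]
  show "diff_aut F L (\<lambda>x. \<sigma> (\<tau> x))" by (rule diff_aut_comp[OF s(1) t(1) L_sub])
  show "g \<otimes> h \<in> carrier G" using s(2) t(2) by simp
  fix x assume x: "x \<in> K 0"
  have "\<tau> x \<in> K 0" by (rule diff_aut_K_into[OF t(1) _ x]) simp
  then show "act (g \<otimes> h) x = \<sigma> (\<tau> x)" using act.act_mult[OF s(2) t(2) x] s(3) t(3)[OF x] by simp
qed

lemma restricts_inv:
  assumes "restricts \<sigma> g"
  shows "restricts (inv_aut \<sigma>) (inv g)"
  unfolding restricts_def
proof (intro conjI ballI)
  note s = restrictsD[OF assms]
  show "diff_aut F L (inv_aut \<sigma>)" by (rule inv_aut(1)[OF s(1)])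
  show "inv g \<in> carrier G" using s(2) by simp
  fix x assume x: "x \<in> K 0"
  have i: "inv_aut \<sigma> x \<in> K 0" by (rule diff_aut_K_into[OF inv_aut(1)[OF s(1)] _ x]) simp
  have "act g (inv_aut \<sigma> x) = x" using s(3)[OF i] inv_aut(2)[OF s(1), of x] K0_L x by auto
  then show "act (inv g) x = inv_aut \<sigma> x" using act.act_inv(2)[OF s(2) i] by simp
qed

lemma restricts_one: "restricts (\<lambda>x. x) \<one>"
  unfolding restricts_def using diff_aut_id act.act_one by simp

lemma restricts_L: "restricts \<sigma> g \<Longrightarrow> x \<in> L \<Longrightarrow> \<sigma> (inv_aut \<sigma> x) = x"
  "restricts \<sigma> g \<Longrightarrow> x \<in> L \<Longrightarrow> inv_aut \<sigma> (\<sigma> x) = x"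
  using inv_aut(2,3) restrictsD(1) by simp_all

lemma restricts_K: "restricts \<sigma> g \<Longrightarrow> i \<le> k \<Longrightarrow> x \<in> K i \<Longrightarrow> \<sigma> x \<in> K i"
  using diff_aut_K_into restrictsD(1) by simp

lemma image_fixingI: "restricts \<sigma> g \<Longrightarrow> (\<And>x. x \<in> X \<Longrightarrow> \<sigma> x = x) \<Longrightarrow> g \<in> image_fixing X"
  unfolding image_fixing_def by blast

lemma image_fixingE:
  assumes "g \<in> image_fixing X"
  obtains \<sigma> where "restricts \<sigma> g" "\<forall>x\<in>X. \<sigma> x = x"
  using assms unfolding image_fixing_def by blast

lemma inv_aut_fixes: "restricts \<sigma> g \<Longrightarrow> x \<in> L \<Longrightarrow> \<sigma> x = x \<Longrightarrow> inv_aut \<sigma> x = x"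
  using restricts_L(2)[of \<sigma> g x] by simp

theorem K0_subset: "\<exists>i\<in>{1..k}. K 0 \<subseteq> K i"
proof -
  define H where "H = image_fixing {}"
  \<comment> \<open>For \<open>j = 0\<close> the union is empty, which gives
    \<open>S 0 = H\<close>.\<close>
  define S where "S j = image_fixing (\<Union>i\<in>{1..j}. K i)" for j
  define T where "T j = image_fixing (K j)" for j
  have "\<exists>j\<in>{1..k}. T j \<subseteq> {\<one>}"
  proof (rule act.trivial_image_if_simple[where H = H and S = S and T = T and k = k and f = f])
    show "N = carrier G \<or> N = {\<one>}" if "N \<lhd> G" "FF \<subseteq> polys UNIV ({..<n 0} \<times> {..<n 0})" "N = act.zero_locus FF" for N FF
      by (rule simple[OF that])
    show "\<exists>g\<in>carrier G. \<exists>h\<in>carrier G. g \<otimes> h \<noteq> h \<otimes> g" by (rule noncomm)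
    show "f \<in> K 0" "f \<notin> F" by (rule f)+
    show "S 0 = H" by (simp add: S_def H_def)
    show "S j \<subseteq> H" for j unfolding S_def H_def image_fixing_def by blast
    show "T j \<subseteq> H" for j unfolding T_def H_def image_fixing_def by blast
    show "subgroup H G"
    proof (rule act.G.subgroupI)
      show "H \<subseteq> carrier G" using restrictsD(2) by (auto simp: H_def image_fixing_def)
      show "H \<noteq> {}" using image_fixingI[OF restricts_one, of "{}"] by (auto simp: H_def)
      show "inv g \<in> H" if "g \<in> H" for g
        using that restricts_inv unfolding H_def image_fixing_def by blast
      show "g \<otimes> h \<in> H" if "g \<in> H" "h \<in> H" for g h
        using that restricts_comp unfolding H_def image_fixing_def by blast
    qed
    show "x \<in> F" if x: "x \<in> K 0" and fixed: "\<And>h. h \<in> H \<Longrightarrow> act h x = x" for x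
    proof (rule ccontr)
      assume "x \<notin> F"
      then have "\<exists>\<sigma>. diff_aut F L \<sigma> \<and> \<sigma> x \<noteq> x"
        using x K0_L by (intro automorphism_moving F F_L subset_refl) auto
      then obtain \<sigma> where \<sigma>: "diff_aut F L \<sigma>" "\<sigma> x \<noteq> x" by (elim exE conjE)
      from restriction_exists[OF \<sigma>(1)] obtain g where g: "restricts \<sigma> g" by (elim exE)
      then have "g \<in> H" unfolding H_def by (rule image_fixingI) simp
      then show False using fixed restrictsD(3)[OF g x] \<sigma>(2) by simp
    qed
    show "h \<otimes> s \<otimes> inv h \<in> S j" if "j \<le> k" "h \<in> H" "s \<in> S j" for j h s
    proof -
      obtain \<eta> where \<eta>: "restricts \<eta> h" using \<open>h \<in> H\<close> unfolding H_def by (rule image_fixingE)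
      obtain \<sigma> where \<sigma>: "restricts \<sigma> s" "\<forall>x\<in>(\<Union>i\<in>{1..j}. K i). \<sigma> x = x"
        using \<open>s \<in> S j\<close> unfolding S_def by (rule image_fixingE)
      have "restricts (\<lambda>x. \<eta> (\<sigma> (inv_aut \<eta> x))) (h \<otimes> s \<otimes> inv h)"
        by (rule restricts_comp[OF restricts_comp[OF \<eta> \<sigma>(1)] restricts_inv[OF \<eta>]])
      then show ?thesis unfolding S_def
      proof (rule image_fixingI)
        fix x assume "x \<in> (\<Union>i\<in>{1..j}. K i)"
        then obtain i where i: "i \<in> {1..j}" "x \<in> K i" by blast
        have ik: "i \<le> k" using i(1) \<open>j \<le> k\<close> by simp
        have "inv_aut \<eta> x \<in> K i" by (rule restricts_K[OF restricts_inv[OF \<eta>] ik i(2)])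
        then have "\<sigma> (inv_aut \<eta> x) = inv_aut \<eta> x" using \<sigma>(2) i(1) by blast
        moreover have "x \<in> L" using K_L[OF ik] i(2) by blast
        ultimately show "\<eta> (\<sigma> (inv_aut \<eta> x)) = x" using restricts_L(1)[OF \<eta>] by simp
      qed
    qed
    show "t \<otimes> s \<otimes> inv t \<otimes> inv s \<in> S (Suc j)" if "j < k" "s \<in> S j" "t \<in> T (Suc j)" for j s t
    proof -
      obtain \<tau> where \<tau>: "restricts \<tau> t" "\<forall>x\<in>K (Suc j). \<tau> x = x"
        using \<open>t \<in> T (Suc j)\<close> unfolding T_def by (rule image_fixingE)
      obtain \<sigma> where \<sigma>: "restricts \<sigma> s" "\<forall>x\<in>(\<Union>i\<in>{1..j}. K i). \<sigma> x = x"
        using \<open>s \<in> S j\<close> unfolding S_def by (rule image_fixingE)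
      have "restricts (\<lambda>x. \<tau> (\<sigma> (inv_aut \<tau> (inv_aut \<sigma> x)))) (t \<otimes> s \<otimes> inv t \<otimes> inv s)"
        by (rule restricts_comp[OF restricts_comp[OF restricts_comp[OF \<tau>(1) \<sigma>(1)] restricts_inv[OF \<tau>(1)]] restricts_inv[OF \<sigma>(1)]])
      then show ?thesis unfolding S_def
      proof (rule image_fixingI)
        fix x assume "x \<in> (\<Union>i\<in>{1..Suc j}. K i)"
        then obtain i where i: "i \<in> {1..Suc j}" "x \<in> K i" by blast
        have ik: "i \<le> k" using i(1) \<open>j < k\<close> by simp
        then have xL: "x \<in> L" using K_L[OF ik] i(2) by blast
        \<comment> \<open>On each of the fields one of \<open>\<sigma>\<close>,
          \<open>\<tau>\<close> is the identity and the other one preserves the field, so the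
          commutator is trivial there.\<close>
        show "\<tau> (\<sigma> (inv_aut \<tau> (inv_aut \<sigma> x))) = x"
        proof (cases "i = Suc j")
          case True
          then have sx: "inv_aut \<sigma> x \<in> K (Suc j)"
            using restricts_K[OF restricts_inv[OF \<sigma>(1)] ik i(2)] by simp
          then have "inv_aut \<tau> (inv_aut \<sigma> x) = inv_aut \<sigma> x"
            using K_L[of "Suc j"] \<open>j < k\<close> \<tau>(2) by (intro inv_aut_fixes[OF \<tau>(1)]) auto
          then show ?thesis using restricts_L(1)[OF \<sigma>(1) xL] \<tau>(2) i(2) True by simp
        next
          case False
          then have ij: "i \<in> {1..j}" using i(1) by simp
          then have "inv_aut \<sigma> x = x" using \<sigma>(2) i(2) xL by (intro inv_aut_fixes[OF \<sigma>(1)]) auto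
          moreover have "inv_aut \<tau> x \<in> K i" by (rule restricts_K[OF restricts_inv[OF \<tau>(1)] ik i(2)])
          then have "\<sigma> (inv_aut \<tau> x) = inv_aut \<tau> x" using \<sigma>(2) ij by blast
          ultimately show ?thesis using restricts_L(1)[OF \<tau>(1) xL] by simp
        qed
      qed
    qed
    show "act s f = f" if s: "s \<in> S k" for s
    proof -
      obtain \<sigma> where \<sigma>: "restricts \<sigma> s" "\<forall>x\<in>(\<Union>i\<in>{1..k}. K i). \<sigma> x = x"
        using s unfolding S_def by (rule image_fixingE)
      note \<sigma>D = diff_autD[OF restrictsD(1)[OF \<sigma>(1)] L_sub]
      \<comment> \<open>The fixed field of \<open>\<sigma>\<close> contains
        \<open>K 1, ..., K k\<close>, hence \<open>f\<close>.\<close>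
      define M where "M = {x \<in> L. \<sigma> x = x}"
      have "is_subfield M"
        unfolding is_subfield_def M_def using is_subfieldD[OF L_sub] by (auto simp: \<sigma>D(2,3,6,7,10,11))
      moreover have "F \<subseteq> M" using F_L \<sigma>D(5) by (auto simp: M_def)
      moreover have "K i \<subseteq> M" if "i \<in> {1..k}" for i
      proof
        fix x assume "x \<in> K i"
        then show "x \<in> M" using \<sigma>(2) that K_L[of i] by (auto simp: M_def)
      qed
      ultimately have "f \<in> M" by (rule f_generated)
      then show ?thesis using restrictsD(3)[OF \<sigma>(1) f(1)] by (simp add: M_def)
    qed
  qed
  then obtain j where j: "j \<in> {1..k}" "T j \<subseteq> {\<one>}" by (elim bexE)
  have jk: "j \<le> k" using j(1) by simp
  have "K 0 \<subseteq> K j"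
  proof
    fix x assume x: "x \<in> K 0"
    show "x \<in> K j"
    proof (rule ccontr)
      assume "x \<notin> K j"
      then have "\<exists>\<sigma>. diff_aut (K j) L \<sigma> \<and> \<sigma> x \<noteq> x"
        using x K0_L by (intro automorphism_moving diff_subfield_K[OF jk] F_K K_L[OF jk]) auto
      then obtain \<sigma> where \<sigma>: "diff_aut (K j) L \<sigma>" "\<sigma> x \<noteq> x" by (elim exE conjE)
      from restriction_exists[OF diff_aut_mono[OF \<sigma>(1) F_K]] obtain g where g: "restricts \<sigma> g" by (elim exE)
      then have "g \<in> T j" unfolding T_def
        by (rule image_fixingI) (rule diff_autD(5)[OF \<sigma>(1) L_sub])
      from subsetD[OF j(2) this] have "g = \<one>" by simp
      then show False using restrictsD(3)[OF g x] act.act_one[OF x] \<sigma>(2) by simp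
    qed
  qed
  then show ?thesis using j(1) by blast
qed

end

section \<open>Laurent expansion of meromorphic functions\<close>

text \<open>Expansion at \<open>z0\<close>, which may be a pole, embeds the field of meromorphic
  functions, given by an explicit carrier, into a field in the sense of type classes.\<close>

locale mero_expansion =
  fixes D :: "complex set" and z0 :: complex
  assumes D: "open D" "connected D" and z0: "z0 \<in> D"
begin

abbreviation "M \<equiv> mero_field D"

definition \<iota> :: "(complex \<Rightarrow> complex) \<Rightarrow> complex fls" where
  "\<iota> f = laurent_expansion f z0"

lemma mero_repr_carrier: "h meromorphic_on D \<Longrightarrow> mero_repr D h \<in> carrier M"
proof -
  assume h: "h meromorphic_on D"
  have "remove_sings h nicely_meromorphic_on D" by (rule remove_sings_nicely_meromorphic[OF h])
  moreover have "remove_sings h nicely_meromorphic_on D \<longleftrightarrow> mero_repr D h nicely_meromorphic_on D"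
  proof -
    have ev: "eventually (\<lambda>w. remove_sings h w = mero_repr D h w) (at z)" if "z \<in> D" for z
      using eventually_at_in_open'[OF D(1) that] by eventually_elim (simp add: mero_repr_def)
    have "remove_sings h meromorphic_on D \<longleftrightarrow> mero_repr D h meromorphic_on D"
      by (rule meromorphic_on_cong) (use ev in auto)
    moreover have "is_pole (remove_sings h) z \<longleftrightarrow> is_pole (mero_repr D h) z"
      "remove_sings h \<midarrow>z\<rightarrow> c \<longleftrightarrow> mero_repr D h \<midarrow>z\<rightarrow> c" "remove_sings h z = mero_repr D h z" if "z \<in> D" for z c
      using is_pole_cong[OF ev[OF that] refl] tendsto_cong[OF ev[OF that]] that
      by (auto simp: mero_repr_def)
    ultimately show ?thesis unfolding nicely_meromorphic_on_def by auto
  qed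
  ultimately show ?thesis by (simp add: mero_field_def) (simp add: mero_repr_def)
qed

lemma carrierD:
  assumes "f \<in> carrier M"
  shows "f nicely_meromorphic_on D" "f meromorphic_on D" "z \<notin> D \<Longrightarrow> f z = 0"
  using assms by (auto simp: mero_field_def nicely_meromorphic_on_def)

lemma \<iota>_expansion: "h meromorphic_on D \<Longrightarrow> (\<lambda>z. h (z0 + z)) has_laurent_expansion \<iota> h"
  unfolding \<iota>_def using meromorphic_on_imp_has_laurent_expansion z0 by blast

lemma \<iota>_eqI: "(\<lambda>z. h (z0 + z)) has_laurent_expansion F \<Longrightarrow> \<iota> h = F"
  unfolding \<iota>_def by (rule laurent_expansion_eqI)

lemma \<iota>_mero_repr: "h meromorphic_on D \<Longrightarrow> \<iota> (mero_repr D h) = \<iota> h"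
proof -
  assume h: "h meromorphic_on D"
  have "eventually (\<lambda>w. remove_sings h w = h w) (at z0)"
    by (intro eventually_remove_sings_eq_at meromorphic_on_isolated_singularity meromorphic_on_subset[OF h])
       (use z0 in auto)
  moreover have "eventually (\<lambda>w. w \<in> D) (at z0)" by (rule eventually_at_in_open'[OF D(1) z0])
  ultimately have "eventually (\<lambda>w. mero_repr D h w = h w) (at z0)"
    by eventually_elim (simp add: mero_repr_def)
  then show ?thesis unfolding \<iota>_def by (rule laurent_expansion_cong) simp
qed

text \<open>The difference vanishes near \<open>z0\<close>, hence off a sparse set as
  \<open>D\<close> is connected. The normalization of the representatives gives equality at the
  remaining points, with value 0 at poles.\<close>

lemma \<iota>_inj:
  assumes f: "f \<in> carrier M" and g: "g \<in> carrier M" and eq: "\<iota> f = \<iota> g"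
  shows "f = g"
proof -
  note fm = carrierD[OF f] and gm = carrierD[OF g]
  let ?h = "\<lambda>z. f z - g z"
  have hm: "?h meromorphic_on D" by (intro meromorphic_on_diff fm gm)
  have "(\<lambda>z. ?h (z0 + z)) has_laurent_expansion \<iota> f - \<iota> g"
    by (intro has_laurent_expansion_diff \<iota>_expansion fm gm)
  then have "eventually (\<lambda>z. ?h z = 0) (at z0)"
    using has_laurent_expansion_eventually_zero_iff[of ?h z0 "\<iota> f - \<iota> g"] eq by simp
  then have freq: "frequently (\<lambda>z. ?h z = 0) (at z0)" by (intro eventually_frequently) auto
  have "(\<forall>\<^sub>\<approx>x\<in>D. ?h x = 0) \<or> (\<forall>\<^sub>\<approx>x\<in>D. ?h x \<noteq> 0)"
    by (rule meromorphic_imp_constant_or_avoid[OF hm D])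
  moreover have "\<not> (\<forall>\<^sub>\<approx>x\<in>D. ?h x \<noteq> 0)"
    using freq z0 by (auto simp: eventually_cosparse_open_eq[OF D(1)] frequently_def)
  ultimately have ae: "\<forall>\<^sub>\<approx>x\<in>D. ?h x = 0" by blast
  have "f z = g z" if z: "z \<in> D" for z
  proof -
    have ev: "eventually (\<lambda>w. f w = g w) (at z)"
      using ae z by (auto simp: eventually_cosparse_open_eq[OF D(1)])
    have pole: "is_pole f z \<longleftrightarrow> is_pole g z" by (rule is_pole_cong[OF ev refl])
    show ?thesis
    proof (cases "is_pole f z")
      case True
      have "f z = 0" "g z = 0"
        using fm(1) gm(1) z True pole is_pole_def not_tendsto_and_filterlim_at_infinity at_neq_bot
        unfolding nicely_meromorphic_on_def by (metis)+
      then show ?thesis by simp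
    next
      case False
      then have "f \<midarrow>z\<rightarrow> f z" "g \<midarrow>z\<rightarrow> g z"
        using fm(1) gm(1) z pole unfolding nicely_meromorphic_on_def by blast+
      moreover have "f \<midarrow>z\<rightarrow> g z \<longleftrightarrow> g \<midarrow>z\<rightarrow> g z" by (rule tendsto_cong[OF ev])
      ultimately show ?thesis using LIM_unique by blast
    qed
  qed
  then show ?thesis using fm(3) gm(3) by (metis ext)
qed

lemma op_carrier [simp]:
  "f \<in> carrier M \<Longrightarrow> g \<in> carrier M \<Longrightarrow> f \<oplus>\<^bsub>M\<^esub> g \<in> carrier M"
  "f \<in> carrier M \<Longrightarrow> g \<in> carrier M \<Longrightarrow> f \<otimes>\<^bsub>M\<^esub> g \<in> carrier M"
  "\<zero>\<^bsub>M\<^esub> \<in> carrier M" "\<one>\<^bsub>M\<^esub> \<in> carrier M" "mero_const D c \<in> carrier M"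
  "f \<in> carrier M \<Longrightarrow> mero_deriv D f \<in> carrier M"
proof -
  have ops: "f \<oplus>\<^bsub>M\<^esub> g = mero_repr D (\<lambda>z. f z + g z)" "f \<otimes>\<^bsub>M\<^esub> g = mero_repr D (\<lambda>z. f z * g z)"
    "\<zero>\<^bsub>M\<^esub> = mero_repr D (\<lambda>_. 0)" "\<one>\<^bsub>M\<^esub> = mero_repr D (\<lambda>_. 1)" for f g
    by (simp_all add: mero_field_def)
  show "f \<in> carrier M \<Longrightarrow> g \<in> carrier M \<Longrightarrow> f \<oplus>\<^bsub>M\<^esub> g \<in> carrier M"
    "f \<in> carrier M \<Longrightarrow> g \<in> carrier M \<Longrightarrow> f \<otimes>\<^bsub>M\<^esub> g \<in> carrier M"
    "\<zero>\<^bsub>M\<^esub> \<in> carrier M" "\<one>\<^bsub>M\<^esub> \<in> carrier M" "mero_const D c \<in> carrier M"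
    "f \<in> carrier M \<Longrightarrow> mero_deriv D f \<in> carrier M"
    unfolding ops mero_const_def mero_deriv_def
    by (intro mero_repr_carrier meromorphic_intros carrierD; simp)+
qed

lemma \<iota>_ops [simp]:
  "f \<in> carrier M \<Longrightarrow> g \<in> carrier M \<Longrightarrow> \<iota> (f \<oplus>\<^bsub>M\<^esub> g) = \<iota> f + \<iota> g"
  "f \<in> carrier M \<Longrightarrow> g \<in> carrier M \<Longrightarrow> \<iota> (f \<otimes>\<^bsub>M\<^esub> g) = \<iota> f * \<iota> g"
  "\<iota> (mero_const D c) = fls_const c" "\<iota> \<zero>\<^bsub>M\<^esub> = 0" "\<iota> \<one>\<^bsub>M\<^esub> = 1"
  "f \<in> carrier M \<Longrightarrow> \<iota> (mero_deriv D f) = fls_deriv (\<iota> f)"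
proof -
  have ops: "f \<oplus>\<^bsub>M\<^esub> g = mero_repr D (\<lambda>z. f z + g z)" "f \<otimes>\<^bsub>M\<^esub> g = mero_repr D (\<lambda>z. f z * g z)"
    "\<zero>\<^bsub>M\<^esub> = mero_repr D (\<lambda>_. 0)" "\<one>\<^bsub>M\<^esub> = mero_repr D (\<lambda>_. 1)" for f g
    by (simp_all add: mero_field_def)
  have const: "\<iota> (mero_repr D (\<lambda>_. c)) = fls_const c" for c
    by (subst \<iota>_mero_repr) (auto intro!: \<iota>_eqI)
  show "\<iota> (mero_const D c) = fls_const c" "\<iota> \<zero>\<^bsub>M\<^esub> = 0" "\<iota> \<one>\<^bsub>M\<^esub> = 1"
    by (simp_all add: ops mero_const_def const)
  assume f: "f \<in> carrier M"
  note fm = carrierD[OF f]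
  {
    assume g: "g \<in> carrier M"
    note gm = carrierD[OF g]
    show "\<iota> (f \<oplus>\<^bsub>M\<^esub> g) = \<iota> f + \<iota> g" unfolding ops
      by (subst \<iota>_mero_repr) (intro meromorphic_intros \<iota>_eqI has_laurent_expansion_add \<iota>_expansion fm gm)+
    show "\<iota> (f \<otimes>\<^bsub>M\<^esub> g) = \<iota> f * \<iota> g" unfolding ops
      by (subst \<iota>_mero_repr) (intro meromorphic_intros \<iota>_eqI has_laurent_expansion_mult \<iota>_expansion fm gm)+
  }
  have "deriv (\<lambda>z. f (z0 + z)) = (\<lambda>z. deriv f (z0 + z))"
    using DERIV_shift[of f _ _ z0] by (simp add: deriv_def fun_eq_iff add.commute)
  then have "(\<lambda>z. deriv f (z0 + z)) has_laurent_expansion fls_deriv (\<iota> f)"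
    using has_laurent_expansion_deriv[OF \<iota>_expansion[OF fm(2)]] by simp
  then show "\<iota> (mero_deriv D f) = fls_deriv (\<iota> f)" unfolding mero_deriv_def
    by (subst \<iota>_mero_repr) (intro meromorphic_on_deriv fm \<iota>_eqI)+
qed

lemma inverse_exists:
  assumes f: "f \<in> carrier M"
  shows "\<exists>g\<in>carrier M. \<iota> g = inverse (\<iota> f)"
proof (rule bexI)
  note fm = carrierD[OF f]
  have inv: "(\<lambda>z. inverse (f z)) meromorphic_on D" by (intro meromorphic_on_inverse fm)
  show "mero_repr D (\<lambda>z. inverse (f z)) \<in> carrier M" by (rule mero_repr_carrier[OF inv])
  show "\<iota> (mero_repr D (\<lambda>z. inverse (f z))) = inverse (\<iota> f)"
    unfolding \<iota>_mero_repr[OF inv] by (intro \<iota>_eqI has_laurent_expansion_inverse \<iota>_expansion fm)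
qed

lemma uminus_exists:
  assumes f: "f \<in> carrier M"
  shows "\<exists>g\<in>carrier M. \<iota> g = - \<iota> f"
proof (rule bexI)
  show "mero_const D (-1) \<otimes>\<^bsub>M\<^esub> f \<in> carrier M" using f by simp
  show "\<iota> (mero_const D (-1) \<otimes>\<^bsub>M\<^esub> f) = - \<iota> f"
    using f by (simp flip: fls_const_uminus) (simp add: fls_eq_iff)
qed

text \<open>The axioms are pulled back from the Laurent series along the injective
  \<open>\<iota>\<close>; only closure and the existence of negatives are shown on
  functions.\<close>

lemma cring_M: "cring M"
proof (rule cringI)
  show "abelian_group M"
  proof (rule abelian_groupI)
    fix x assume x: "x \<in> carrier M"
    obtain y where "y \<in> carrier M" "\<iota> y = - \<iota> x" using uminus_exists[OF x] by blast
    then show "\<exists>y\<in>carrier M. y \<oplus>\<^bsub>M\<^esub> x = \<zero>\<^bsub>M\<^esub>"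
      using x by (intro bexI[of _ y] \<iota>_inj) simp_all
  qed (auto intro!: \<iota>_inj)
  show "Group.comm_monoid M"
    by (rule comm_monoidI) (auto intro!: \<iota>_inj)
  show "(x \<oplus>\<^bsub>M\<^esub> y) \<otimes>\<^bsub>M\<^esub> z = x \<otimes>\<^bsub>M\<^esub> z \<oplus>\<^bsub>M\<^esub> y \<otimes>\<^bsub>M\<^esub> z"
    if "x \<in> carrier M" "y \<in> carrier M" "z \<in> carrier M" for x y z
    using that by (intro \<iota>_inj) (simp_all add: distrib_right)
qed

lemma field_M: "Ring.field M"
proof (rule cring.cring_fieldI[OF cring_M])
  have "x \<in> Units M" if x: "x \<in> carrier M" "x \<noteq> \<zero>\<^bsub>M\<^esub>" for x
  proof -
    have "\<iota> x \<noteq> 0" using \<iota>_inj[of x "\<zero>\<^bsub>M\<^esub>"] x by auto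
    obtain y where "y \<in> carrier M" "\<iota> y = inverse (\<iota> x)" using inverse_exists[OF x(1)] by blast
    then have "y \<otimes>\<^bsub>M\<^esub> x = \<one>\<^bsub>M\<^esub>" "x \<otimes>\<^bsub>M\<^esub> y = \<one>\<^bsub>M\<^esub>" using x \<open>\<iota> x \<noteq> 0\<close>
      by (auto intro!: \<iota>_inj)
    then show ?thesis using \<open>y \<in> carrier M\<close> x by (auto simp: Units_def)
  qed
  moreover have "\<zero>\<^bsub>M\<^esub> \<notin> Units M"
  proof
    assume "\<zero>\<^bsub>M\<^esub> \<in> Units M"
    then obtain y where "y \<in> carrier M" "y \<otimes>\<^bsub>M\<^esub> \<zero>\<^bsub>M\<^esub> = \<one>\<^bsub>M\<^esub>" by (auto simp: Units_def)
    then show False using \<iota>_ops(2)[of y "\<zero>\<^bsub>M\<^esub>"] by simp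
  qed
  moreover have "Units M \<subseteq> carrier M" by (auto simp: Units_def)
  ultimately show "Units M = carrier M - {\<zero>\<^bsub>M\<^esub>}" by blast
qed

lemma \<iota>_a_inv: "f \<in> carrier M \<Longrightarrow> \<iota> (\<ominus>\<^bsub>M\<^esub> f) = - \<iota> f"
proof -
  assume f: "f \<in> carrier M"
  interpret cring M by (rule cring_M)
  have "\<iota> (f \<oplus>\<^bsub>M\<^esub> \<ominus>\<^bsub>M\<^esub> f) = 0" using f by (simp only: r_neg \<iota>_ops)
  then show ?thesis using f by (simp add: eq_neg_iff_add_eq_0 add.commute)
qed

lemma \<iota>_m_inv: "f \<in> carrier M \<Longrightarrow> f \<noteq> \<zero>\<^bsub>M\<^esub> \<Longrightarrow> \<iota> (inv\<^bsub>M\<^esub> f) = inverse (\<iota> f)"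
proof -
  assume f: "f \<in> carrier M" "f \<noteq> \<zero>\<^bsub>M\<^esub>"
  interpret Ring.field M by (rule field_M)
  have U: "f \<in> Units M" using f by (simp add: field_Units)
  have "\<iota> f * \<iota> (inv\<^bsub>M\<^esub> f) = \<iota> (f \<otimes>\<^bsub>M\<^esub> inv\<^bsub>M\<^esub> f)"
    by (rule \<iota>_ops(2)[symmetric, OF f(1) Units_inv_closed[OF U]])
  also have "\<dots> = 1" by (simp only: Units_r_inv[OF U] \<iota>_ops)
  finally show ?thesis by (rule inverse_unique[symmetric])
qed

end

interpretation fls: diff_field "fls_deriv :: complex fls \<Rightarrow> complex fls" fls_const
proof
  show "fls_deriv (x + y) = fls_deriv x + fls_deriv y" for x y :: "complex fls" by simp
  show "fls_deriv (x * y) = fls_deriv x * y + x * fls_deriv y" for x y :: "complex fls"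
    by (simp add: add.commute)
  show "fls_const (a + b) = fls_const a + fls_const b" for a b :: complex by (simp add: fls_plus_const)
  show "fls_const (a * b) = fls_const a * fls_const b" for a b :: complex by simp
  show "fls_const 1 = (1 :: complex fls)" by simp
  show "fls_deriv x = 0 \<longleftrightarrow> x \<in> range fls_const" for x :: "complex fls"
    by (metis fls_deriv_const fls_deriv_eq_0_iff rangeE rangeI)
qed

context mero_expansion begin

section \<open>Rational functions as Laurent series\<close>

definition \<pi> :: "complex poly \<Rightarrow> complex fls" where
  "\<pi> P = \<iota> (poly P)"

lemma poly_meromorphic: "poly P meromorphic_on D"
proof -
  have "poly P holomorphic_on UNIV"
    unfolding holomorphic_on_def field_differentiable_def by (intro ballI exI) (rule poly_DERIV)
  then have "poly P analytic_on UNIV" by (simp add: analytic_on_open)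
  then have "poly P analytic_on D" by (rule analytic_on_subset) simp
  then show ?thesis by (rule analytic_on_imp_meromorphic_on)
qed

lemma \<pi>_expansion: "(\<lambda>z. poly P (z0 + z)) has_laurent_expansion \<pi> P"
  unfolding \<pi>_def by (rule \<iota>_expansion[OF poly_meromorphic])

lemma \<pi>_eqI: "(\<lambda>z. poly P (z0 + z)) has_laurent_expansion F \<Longrightarrow> \<pi> P = F"
  unfolding \<pi>_def by (rule \<iota>_eqI)

lemma \<pi>_ops: "\<pi> (P + Q) = \<pi> P + \<pi> Q" "\<pi> (P * Q) = \<pi> P * \<pi> Q" "\<pi> (- P) = - \<pi> P"
  "\<pi> [:c:] = fls_const c" "fls_deriv (\<pi> P) = \<pi> (pderiv P)"
proof -
  show "\<pi> (P + Q) = \<pi> P + \<pi> Q"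
    by (rule \<pi>_eqI) (use has_laurent_expansion_add[OF \<pi>_expansion[of P] \<pi>_expansion[of Q]] in simp)
  show "\<pi> (P * Q) = \<pi> P * \<pi> Q"
    by (rule \<pi>_eqI) (use has_laurent_expansion_mult[OF \<pi>_expansion[of P] \<pi>_expansion[of Q]] in simp)
  show "\<pi> (- P) = - \<pi> P"
    by (rule \<pi>_eqI) (use has_laurent_expansion_minus[OF \<pi>_expansion[of P]] in simp)
  show "\<pi> [:c:] = fls_const c" by (rule \<pi>_eqI) simp
  have "deriv (\<lambda>z. poly P (z0 + z)) = (\<lambda>z. poly (pderiv P) (z0 + z))"
  proof
    fix z
    have "((\<lambda>z. poly P (z0 + z)) has_field_derivative poly (pderiv P) (z0 + z) * (0 + 1)) (at z)"
      by (intro DERIV_chain2[OF poly_DERIV] DERIV_add DERIV_const DERIV_ident)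
    then show "deriv (\<lambda>z. poly P (z0 + z)) z = poly (pderiv P) (z0 + z)" by (simp add: DERIV_imp_deriv)
  qed
  then show "fls_deriv (\<pi> P) = \<pi> (pderiv P)"
    by (intro \<pi>_eqI[symmetric]) (use has_laurent_expansion_deriv[OF \<pi>_expansion[of P]] in simp)
qed

lemma \<pi>_0 [simp]: "\<pi> 0 = 0" "\<pi> 1 = 1"
  using \<pi>_ops(4)[of 0] \<pi>_ops(4)[of 1] by (simp_all add: one_pCons)

lemma \<pi>_eq_0_iff [simp]: "\<pi> P = 0 \<longleftrightarrow> P = 0"
proof
  assume 0: "\<pi> P = 0"
  have "eventually (\<lambda>z. poly P z = 0) (at z0)"
    using has_laurent_expansion_eventually_zero_iff[OF \<pi>_expansion[of P]] 0 by simp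
  then obtain r where r: "r > 0" "\<And>z. z \<noteq> z0 \<Longrightarrow> dist z z0 < r \<Longrightarrow> poly P z = 0"
    by (auto simp: eventually_at)
  show "P = 0"
  proof (rule ccontr)
    assume "P \<noteq> 0"
    then have "finite {z. poly P z = 0}" by (rule poly_roots_finite)
    moreover have "ball z0 r - {z0} \<subseteq> {z. poly P z = 0}" using r by (auto simp: dist_commute)
    ultimately have "finite (ball z0 r - {z0})" by (rule rev_finite_subset)
    then have "countable (ball z0 r)" by (simp add: countable_finite)
    then show False using uncountable_ball[OF r(1), of z0] by contradiction
  qed
qed simp

definition F :: "complex fls set" where "F = \<iota> ` rational_functions D"

lemma ratio_meromorphic: "(\<lambda>z. poly P z / poly Q z) meromorphic_on D"
  by (intro meromorphic_on_divide poly_meromorphic)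

lemma \<iota>_ratio: "Q \<noteq> 0 \<Longrightarrow> \<iota> (mero_repr D (\<lambda>z. poly P z / poly Q z)) = \<pi> P / \<pi> Q"
  unfolding \<iota>_mero_repr[OF ratio_meromorphic]
  by (intro \<iota>_eqI has_laurent_expansion_divide \<pi>_expansion)

lemma F_eq: "F = {\<pi> P / \<pi> Q | P Q. Q \<noteq> 0}"
proof -
  have "F = {\<iota> (mero_repr D (\<lambda>z. poly P z / poly Q z)) | P Q. Q \<noteq> 0}"
    unfolding F_def rational_functions_def by auto
  also have "\<dots> = {\<pi> P / \<pi> Q | P Q. Q \<noteq> 0}" by (intro Collect_cong ex_cong1) (auto simp: \<iota>_ratio)
  finally show ?thesis .
qed

lemma rational_carrier: "rational_functions D \<subseteq> carrier M"
proof
  fix f assume "f \<in> rational_functions D"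
  then obtain P Q where "f = mero_repr D (\<lambda>z. poly P z / poly Q z)"
    unfolding rational_functions_def by auto
  then show "f \<in> carrier M" by (simp only: mero_repr_carrier[OF ratio_meromorphic])
qed

lemma FI: "Q \<noteq> 0 \<Longrightarrow> x = \<pi> P / \<pi> Q \<Longrightarrow> x \<in> F"
  unfolding F_eq by blast

lemma FE:
  assumes "x \<in> F" obtains P Q where "Q \<noteq> 0" "x = \<pi> P / \<pi> Q"
  using assms unfolding F_eq by blast

lemma zero_F: "0 \<in> F"
  by (rule FI[of 1 _ 0]) simp_all

lemma diff_subfield_F: "fls.diff_subfield F"
  unfolding fls.diff_subfield_def is_subfield_def
proof (intro conjI ballI subsetI)
  show "0 \<in> F" by (rule zero_F)
  show "1 \<in> F" by (rule FI[of 1 _ 1]) simp_all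
  show "x \<in> F" if "x \<in> range fls_const" for x
  proof -
    from that obtain c where "x = fls_const c" by (rule rangeE)
    then show ?thesis by (intro FI[of 1 _ "[:c:]"]) (simp_all add: \<pi>_ops)
  qed
next
  fix x y assume "x \<in> F" "y \<in> F"
  then obtain P Q P' Q' where x: "Q \<noteq> 0" "x = \<pi> P / \<pi> Q" and y: "Q' \<noteq> 0" "y = \<pi> P' / \<pi> Q'"
    by (elim FE)
  show "x + y \<in> F"
    by (rule FI[of "Q * Q'" _ "P * Q' + P' * Q"]) (use x y in \<open>simp_all add: \<pi>_ops add_frac_eq\<close>)
  show "x * y \<in> F"
    by (rule FI[of "Q * Q'" _ "P * P'"]) (use x y in \<open>simp_all add: \<pi>_ops\<close>)
next
  fix x assume "x \<in> F"
  then obtain P Q where x: "Q \<noteq> 0" "x = \<pi> P / \<pi> Q" by (elim FE)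
  show "- x \<in> F" by (rule FI[of Q _ "- P"]) (use x in \<open>simp_all add: \<pi>_ops\<close>)
  show "inverse x \<in> F"
  proof (cases "P = 0")
    case True
    then show ?thesis using x zero_F by simp
  next
    case False
    then show ?thesis using x by (intro FI[of P _ Q]) simp_all
  qed
next
  fix y assume "y \<in> fls_deriv ` F"
  then obtain x where "x \<in> F" "y = fls_deriv x" by blast
  then obtain P Q where x: "Q \<noteq> 0" "y = fls_deriv (\<pi> P / \<pi> Q)" by (elim FE) simp
  have nz: "\<pi> Q \<noteq> 0" using x(1) by simp
  have "y = (\<pi> (pderiv P) * \<pi> Q - \<pi> P * \<pi> (pderiv Q)) / (\<pi> Q)\<^sup>2"
    unfolding x(2) fls.D_divide[OF nz] \<pi>_ops(5) ..
  also have "\<dots> = \<pi> (pderiv P * Q + - (P * pderiv Q)) / \<pi> (Q * Q)"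
    by (simp only: \<pi>_ops(1,2,3) power2_eq_square diff_conv_add_uminus)
  finally show "y \<in> F" using x(1) by (intro FI[of "Q * Q"]) simp_all
qed

lemma F_sub: "is_subfield F" using diff_subfield_F by (simp add: fls.diff_subfield_def)

section \<open>Subfields and matrices of meromorphic functions under the expansion\<close>

lemma subfield_D:
  assumes "subfield K M"
  shows "K \<subseteq> carrier M" "\<zero>\<^bsub>M\<^esub> \<in> K" "\<one>\<^bsub>M\<^esub> \<in> K" "x \<in> K \<Longrightarrow> y \<in> K \<Longrightarrow> x \<oplus>\<^bsub>M\<^esub> y \<in> K"
    "x \<in> K \<Longrightarrow> y \<in> K \<Longrightarrow> x \<otimes>\<^bsub>M\<^esub> y \<in> K" "x \<in> K \<Longrightarrow> \<ominus>\<^bsub>M\<^esub> x \<in> K"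
    "x \<in> K \<Longrightarrow> x \<noteq> \<zero>\<^bsub>M\<^esub> \<Longrightarrow> inv\<^bsub>M\<^esub> x \<in> K"
proof -
  interpret Ring.field M by (rule field_M)
  note R = subringE[OF subfieldE(1)[OF assms]]
  show "K \<subseteq> carrier M" "\<zero>\<^bsub>M\<^esub> \<in> K" "\<one>\<^bsub>M\<^esub> \<in> K" by (rule R)+
  show "x \<in> K \<Longrightarrow> y \<in> K \<Longrightarrow> x \<oplus>\<^bsub>M\<^esub> y \<in> K" "x \<in> K \<Longrightarrow> y \<in> K \<Longrightarrow> x \<otimes>\<^bsub>M\<^esub> y \<in> K"
    "x \<in> K \<Longrightarrow> \<ominus>\<^bsub>M\<^esub> x \<in> K" by (rule R; assumption)+
  show "x \<in> K \<Longrightarrow> x \<noteq> \<zero>\<^bsub>M\<^esub> \<Longrightarrow> inv\<^bsub>M\<^esub> x \<in> K"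
    using subfield_m_inv(1)[OF assms, of x] by simp
qed

lemma is_subfield_image:
  assumes K: "subfield K M"
  shows "is_subfield (\<iota> ` K)"
  unfolding is_subfield_def
proof (intro conjI ballI)
  note KD = subfield_D[OF K]
  note Kc = subsetD[OF KD(1)]
  show "0 \<in> \<iota> ` K" by (rule image_eqI[OF _ KD(2)]) simp
  show "1 \<in> \<iota> ` K" by (rule image_eqI[OF _ KD(3)]) simp
  fix x assume "x \<in> \<iota> ` K"
  then obtain f where f: "f \<in> K" "x = \<iota> f" by blast
  show "- x \<in> \<iota> ` K" by (rule image_eqI[OF _ KD(6)[OF f(1)]]) (simp add: \<iota>_a_inv Kc f)
  show "inverse x \<in> \<iota> ` K"
  proof (cases "f = \<zero>\<^bsub>M\<^esub>")
    case True
    then show ?thesis using f by force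
  next
    case False
    show ?thesis by (rule image_eqI[OF _ KD(7)[OF f(1) False]]) (simp add: \<iota>_m_inv Kc f False)
  qed
  fix y assume "y \<in> \<iota> ` K"
  then obtain g where g: "g \<in> K" "y = \<iota> g" by blast
  show "x + y \<in> \<iota> ` K" by (rule image_eqI[OF _ KD(4)[OF f(1) g(1)]]) (simp add: Kc f g)
  show "x * y \<in> \<iota> ` K" by (rule image_eqI[OF _ KD(5)[OF f(1) g(1)]]) (simp add: Kc f g)
qed

text \<open>Membership in \<open>K\<close> is part of the induction, because \<open>\<iota>\<close>
  is known to respect the operations only on the carrier.\<close>

lemma generate_field_image:
  assumes K: "subfield K M" and sub: "is_subfield E" and H: "H \<subseteq> K" "\<iota> ` H \<subseteq> E" and x: "x \<in> generate_field M H"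
  shows "x \<in> K \<and> \<iota> x \<in> E"
  using x
proof (induction rule: generate_field.induct)
  case one
  then show ?case using subfield_D(3)[OF K] is_subfieldD(2)[OF sub] by simp
next
  case (incl h)
  then show ?case using H by blast
next
  case (a_inv h)
  then show ?case using subfield_D(6)[OF K] is_subfieldD(5)[OF sub] \<iota>_a_inv[OF subsetD[OF subfield_D(1)[OF K]]] by simp
next
  case (m_inv h)
  then show ?case using subfield_D(7)[OF K] is_subfieldD(6)[OF sub] \<iota>_m_inv[OF subsetD[OF subfield_D(1)[OF K]]] by simp
next
  case (eng_add x y)
  then show ?case using subfield_D(4)[OF K] is_subfieldD(3)[OF sub] subsetD[OF subfield_D(1)[OF K]] by simp
next
  case (eng_mult x y)
  then show ?case using subfield_D(5)[OF K] is_subfieldD(4)[OF sub] subsetD[OF subfield_D(1)[OF K]] by simp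
qed

definition mt :: "(complex \<Rightarrow> complex) mat \<Rightarrow> nat \<times> nat \<Rightarrow> complex fls" where
  "mt A v = \<iota> (A $$ v)"

lemma \<iota>_finsum:
  assumes K: "subfield K M" and "finite A" "\<And>i. i \<in> A \<Longrightarrow> f i \<in> K"
  shows "\<iota> (finsum (M\<lparr>carrier := K\<rparr>) f A) = (\<Sum>i\<in>A. \<iota> (f i))"
proof -
  interpret M: Ring.field M by (rule field_M)
  interpret R: Ring.ring "M\<lparr>carrier := K\<rparr>" by (rule M.subring_is_ring[OF subfieldE(1)[OF K]])
  note KD = subfield_D[OF K]
  show ?thesis using assms(2,3)
  proof (induction A rule: finite_induct)
    case empty
    then show ?case using R.finsum_empty[of f] by simp
  next
    case (insert a A)
    have c: "f \<in> A \<rightarrow> carrier (M\<lparr>carrier := K\<rparr>)" "f a \<in> carrier (M\<lparr>carrier := K\<rparr>)" using insert.prems by auto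
    have s: "finsum (M\<lparr>carrier := K\<rparr>) f A \<in> K" using R.finsum_closed[OF c(1)] by simp
    have "finsum (M\<lparr>carrier := K\<rparr>) f (insert a A) = f a \<oplus>\<^bsub>M\<^esub> finsum (M\<lparr>carrier := K\<rparr>) f A"
      using R.finsum_insert[OF insert.hyps(1,2) c] by simp
    then show ?case using insert s subsetD[OF KD(1)] by simp
  qed
qed

lemma subfield_carrier: "subfield (carrier M) M"
proof -
  interpret M: Ring.field M by (rule field_M)
  show ?thesis by (rule M.subfield_iff(1)) (simp_all add: field_M)
qed

lemma mat_monoid_carrierD:
  "A \<in> carrier (mat_monoid (M\<lparr>carrier := K\<rparr>) p) \<Longrightarrow> v \<in> {..<p} \<times> {..<p} \<Longrightarrow> A $$ v \<in> K"
  unfolding mat_monoid_def by (auto intro: elements_matI)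

lemma mt_mult:
  assumes K: "subfield K M" and A: "A \<in> carrier (mat_monoid (M\<lparr>carrier := K\<rparr>) p)"
    and B: "B \<in> carrier (mat_monoid (M\<lparr>carrier := K\<rparr>) p)" and v: "v \<in> {..<p} \<times> {..<p}"
  shows "mt (A \<otimes>\<^bsub>mat_monoid (M\<lparr>carrier := K\<rparr>) p\<^esub> B) v = mprod {..<p} (mt A) (mt B) v"
proof -
  obtain i j where ij: "v = (i, j)" "i < p" "j < p" using v by auto
  have AK: "A $$ (i, k) \<in> K" "B $$ (k, j) \<in> K" if "k < p" for k
    using mat_monoid_carrierD[OF A] mat_monoid_carrierD[OF B] ij that by auto
  have "mt (A \<otimes>\<^bsub>mat_monoid (M\<lparr>carrier := K\<rparr>) p\<^esub> B) v =
    \<iota> (finsum (M\<lparr>carrier := K\<rparr>) (\<lambda>k. A $$ (i, k) \<otimes>\<^bsub>M\<^esub> B $$ (k, j)) {..<p})"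
    using ij by (simp add: mt_def mat_monoid_def)
  also have "\<dots> = (\<Sum>k<p. \<iota> (A $$ (i, k) \<otimes>\<^bsub>M\<^esub> B $$ (k, j)))"
    by (rule \<iota>_finsum[OF K]) (auto intro: subfield_D(5)[OF K] AK)
  also have "\<dots> = (\<Sum>k<p. mt A (i, k) * mt B (k, j))"
    using AK subsetD[OF subfield_D(1)[OF K]] by (intro sum.cong) (simp_all add: mt_def)
  finally show ?thesis by (simp add: mprod_def ij)
qed

lemma mt_one: "v \<in> {..<p} \<times> {..<p} \<Longrightarrow> mt \<one>\<^bsub>mat_monoid (M\<lparr>carrier := K\<rparr>) p\<^esub> v = mone v"
  by (auto simp: mt_def mat_monoid_def mone_def)

lemma mt_inj:
  assumes "A \<in> carrier_mat p p" "B \<in> carrier_mat p p"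
    "\<And>v. v \<in> {..<p} \<times> {..<p} \<Longrightarrow> A $$ v \<in> carrier M" "\<And>v. v \<in> {..<p} \<times> {..<p} \<Longrightarrow> B $$ v \<in> carrier M"
    "\<And>v. v \<in> {..<p} \<times> {..<p} \<Longrightarrow> mt A v = mt B v"
  shows "A = B"
proof (rule eq_matI)
  fix i j assume "i < dim_row B" "j < dim_col B"
  then have v: "(i, j) \<in> {..<p} \<times> {..<p}" using assms(2) by auto
  show "A $$ (i, j) = B $$ (i, j)"
    by (rule \<iota>_inj[OF assms(3,4)[OF v]]) (use assms(5)[OF v] in \<open>simp add: mt_def\<close>)
qed (use assms in auto)

lemma fundamental_matrix_mt:
  assumes K: "subfield K M" and FK: "rational_functions D \<subseteq> K"
    and B: "B \<in> carrier_mat p p" "elements_mat B \<subseteq> rational_functions D"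
    and U: "fundamental_solution D p B K U"
    and V: "V \<in> carrier (mat_monoid (M\<lparr>carrier := K\<rparr>) p)"
      "V \<otimes>\<^bsub>mat_monoid (M\<lparr>carrier := K\<rparr>) p\<^esub> U = \<one>\<^bsub>mat_monoid (M\<lparr>carrier := K\<rparr>) p\<^esub>"
      "U \<otimes>\<^bsub>mat_monoid (M\<lparr>carrier := K\<rparr>) p\<^esub> V = \<one>\<^bsub>mat_monoid (M\<lparr>carrier := K\<rparr>) p\<^esub>"
  shows "fundamental_matrix fls_deriv fls_const F {..<p} (mt B) (mt U) (mt V)"
proof unfold_locales
  have U': "U \<in> carrier (mat_monoid (M\<lparr>carrier := K\<rparr>) p)"
    using U by (simp add: fundamental_solution_def Units_def)
  show "fls.diff_subfield F" by (rule diff_subfield_F)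
  show "finite {..<p}" by simp
  fix v assume v: "v \<in> {..<p} \<times> {..<p}"
  show "mt B v \<in> F" using B v by (auto simp: mt_def F_def)
  show "mprod {..<p} (mt U) (mt V) v = mone v"
    using mt_mult[OF K U' V(1) v] V(3) mt_one[OF v] by simp
  show "mprod {..<p} (mt V) (mt U) v = mone v"
    using mt_mult[OF K V(1) U' v] V(2) mt_one[OF v] by simp
  \<comment> \<open>Invertibility of \<open>U\<close> refers to matrices over \<open>K\<close>, the
    differential equation to matrices over the whole field; \<open>mt_mult\<close> serves for both
    through this identity.\<close>
  have cM: "M\<lparr>carrier := carrier M\<rparr> = M" by simp
  have Bc: "B \<in> carrier (mat_monoid (M\<lparr>carrier := carrier M\<rparr>) p)"
    using B rational_carrier unfolding mat_monoid_def by auto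
  have Uc: "U \<in> carrier (mat_monoid (M\<lparr>carrier := carrier M\<rparr>) p)"
    using U' subfield_D(1)[OF K] unfolding mat_monoid_def by auto
  have UM: "U $$ v \<in> carrier M" using mat_monoid_carrierD[OF Uc v] .
  have "map_mat (mero_deriv D) U $$ v = mero_deriv D (U $$ v)"
    using U' v by (auto simp: mat_monoid_def)
  then have "fls_deriv (mt U v) = mt (map_mat (mero_deriv D) U) v" using UM by (simp add: mt_def)
  also have "\<dots> = mt (B \<otimes>\<^bsub>mat_monoid M p\<^esub> U) v" using U by (simp add: fundamental_solution_def)
  also have "\<dots> = mprod {..<p} (mt B) (mt U) v"
    using mt_mult[OF subfield_carrier Bc Uc v] unfolding cM .
  finally show "fls_deriv (mt U v) = mprod {..<p} (mt B) (mt U) v" .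
qed

end

section \<open>Picard-Vessiot fields\<close>

definition mono_eval :: "((nat \<times> nat) \<Rightarrow>\<^sub>0 nat) \<Rightarrow> (nat \<times> nat \<Rightarrow> complex) \<Rightarrow> complex" where
  "mono_eval m A = (\<Prod>v\<in>Poly_Mapping.keys m. A v ^ Poly_Mapping.lookup m v)"

lemma mono_eval_superset:
  assumes "finite S" "Poly_Mapping.keys m \<subseteq> S"
  shows "mono_eval m A = (\<Prod>v\<in>S. A v ^ Poly_Mapping.lookup m v)"
  unfolding mono_eval_def using assms
  by (intro prod.mono_neutral_left) (auto simp: in_keys_iff)

lemma mono_eval_add: "mono_eval (m + m') A = mono_eval m A * mono_eval m' A"
proof -
  let ?S = "Poly_Mapping.keys m \<union> Poly_Mapping.keys m'"
  have "mono_eval (m + m') A = (\<Prod>v\<in>?S. A v ^ Poly_Mapping.lookup (m + m') v)"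
    using keys_add[of m m'] by (intro mono_eval_superset) auto
  also have "\<dots> = mono_eval m A * mono_eval m' A"
    by (simp add: mono_eval_superset[of ?S] lookup_add power_add prod.distrib)
  finally show ?thesis .
qed

lemma mat_poly_eval_superset:
  assumes "finite S" "Poly_Mapping.keys P \<subseteq> S"
  shows "mat_poly_eval P A = (\<Sum>m\<in>S. Poly_Mapping.lookup P m * mono_eval m (($$) A))"
  unfolding mat_poly_eval_def mono_eval_def using assms
  by (intro sum.mono_neutral_left) (auto simp: in_keys_iff)

lemma mat_poly_eval_add: "mat_poly_eval (P + Q) A = mat_poly_eval P A + mat_poly_eval Q A"
proof -
  let ?S = "Poly_Mapping.keys P \<union> Poly_Mapping.keys Q"
  have "mat_poly_eval (P + Q) A = (\<Sum>m\<in>?S. Poly_Mapping.lookup (P + Q) m * mono_eval m (($$) A))"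
    using keys_add[of P Q] by (intro mat_poly_eval_superset) auto
  also have "\<dots> = mat_poly_eval P A + mat_poly_eval Q A"
    by (simp add: mat_poly_eval_superset[of ?S] lookup_add distrib_right sum.distrib)
  finally show ?thesis .
qed

lemma mat_poly_eval_single: "mat_poly_eval (Poly_Mapping.single m c) A = c * mono_eval m (($$) A)"
  by (subst mat_poly_eval_superset[of "{m}"]) (auto simp: keys_single)

definition list_mono :: "(nat \<times> nat) list \<Rightarrow> ((nat \<times> nat) \<Rightarrow>\<^sub>0 nat)" where
  "list_mono l = sum_list (map (\<lambda>v. Poly_Mapping.single v 1) l)"

lemma keys_list_mono: "Poly_Mapping.keys (list_mono l) \<subseteq> set l"
proof (induction l)
  case (Cons v l)
  have "Poly_Mapping.keys (list_mono (v # l)) \<subseteq> Poly_Mapping.keys (Poly_Mapping.single v (1::nat)) \<union> Poly_Mapping.keys (list_mono l)"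
    unfolding list_mono_def list.map sum_list.Cons by (rule keys_add)
  then show ?case using Cons by (auto simp: keys_single)
qed (simp add: list_mono_def)

lemma mono_eval_list_mono: "mono_eval (list_mono l) A = prod_list (map A l)"
proof (induction l)
  case Nil
  then show ?case by (simp add: list_mono_def mono_eval_def)
next
  case (Cons v l)
  have "mono_eval (Poly_Mapping.single v 1) A = A v" by (simp add: mono_eval_def)
  then show ?case using Cons by (simp add: list_mono_def mono_eval_add)
qed

text \<open>The coefficients of a Laurent series separate points and are linear over the constants; they turn a
  polynomial condition over the Laurent series into polynomial conditions over \<open>\<complex>\<close>.\<close>

lemma mat_poly_of_const_poly:
  assumes "f \<in> fls.const_polys ({..<p} \<times> {..<p})"
  shows "\<exists>Q\<in>mat_polys p. \<forall>A. mat_poly_eval Q A = fls_nth (f (($$) A)) m"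
proof -
  obtain d where "f \<in> pw.span (monoms ({..<p} \<times> {..<p}) (\<lambda>v Y. fls_const (Y v)) d)"
    by (rule poly_funs_in_span_monoms[OF assms])
  then show ?thesis
  proof (induction f rule: pw.span_induct_alt)
    case base
    show ?case
      by (rule bexI[of _ 0]) (auto simp: mat_poly_eval_def mat_polys_def)
  next
    case (step c x z)
    from step(1) obtain l where l: "x = (\<lambda>Y. prod_list (map (\<lambda>v. fls_const (Y v)) l))"
      "set l \<subseteq> {..<p} \<times> {..<p}" by (auto simp: monoms_def)
    from step obtain Q where Q: "Q \<in> mat_polys p" "\<forall>A. mat_poly_eval Q A = fls_nth (z (($$) A)) m"
      by (elim bexE)
    have x_eq: "x Y = fls_const (prod_list (map Y l))" for Y
      unfolding l(1) by (induction l) simp_all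
    show ?case
    proof (intro bexI allI)
      let ?Q = "Poly_Mapping.single (list_mono l) (fls_nth c m) + Q"
      show "mat_poly_eval ?Q A = fls_nth (((\<lambda>t. c * x t) + z) (($$) A)) m" for A
        using Q(2) by (simp add: mat_poly_eval_add mat_poly_eval_single mono_eval_list_mono x_eq)
      have "Poly_Mapping.keys ?Q \<subseteq> {list_mono l} \<union> Poly_Mapping.keys Q"
        by (rule order_trans[OF keys_add]) (auto simp: keys_single split: if_splits)
      then show "?Q \<in> mat_polys p"
        using Q(1) keys_list_mono[of l] l(2) unfolding mat_polys_def by blast
    qed
  qed
qed

lemma subgroup_BijGroup_imp_group: "subgroup H (BijGroup S) \<Longrightarrow> group (BijGroup S\<lparr>carrier := H\<rparr>)"
  by (rule subgroup.subgroup_is_group[OF _ group_BijGroup])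

text \<open>\<open>U\<close> is a given fundamental solution, to which
  \<open>algebraic_subgroup\<close> refers; the one that generates \<open>K\<close> in
  \<open>picard_vessiot\<close> may be another.\<close>

locale pv_field = mero_expansion D z0 for D z0 +
  fixes p :: nat and B :: "(complex \<Rightarrow> complex) mat" and K :: "(complex \<Rightarrow> complex) set"
    and U V :: "(complex \<Rightarrow> complex) mat"
  assumes pv: "picard_vessiot D p B K" and fs: "fundamental_solution D p B K U"
    and V: "V \<in> carrier (mat_monoid (mero_field D\<lparr>carrier := K\<rparr>) p)"
      "V \<otimes>\<^bsub>mat_monoid (mero_field D\<lparr>carrier := K\<rparr>) p\<^esub> U = \<one>\<^bsub>mat_monoid (mero_field D\<lparr>carrier := K\<rparr>) p\<^esub>"
      "U \<otimes>\<^bsub>mat_monoid (mero_field D\<lparr>carrier := K\<rparr>) p\<^esub> V = \<one>\<^bsub>mat_monoid (mero_field D\<lparr>carrier := K\<rparr>) p\<^esub>"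
begin

abbreviation "J \<equiv> {..<p} \<times> {..<p}"
abbreviation "Mm \<equiv> mat_monoid (mero_field D\<lparr>carrier := K\<rparr>) p"

lemma K: "subfield K M" and FK: "rational_functions D \<subseteq> K" and DK: "mero_deriv D ` K \<subseteq> K"
  and B: "B \<in> carrier_mat p p" "elements_mat B \<subseteq> rational_functions D"
  using pv by (simp_all add: picard_vessiot_def)

lemma Kc: "x \<in> K \<Longrightarrow> x \<in> carrier M" using subfield_D(1)[OF K] by blast

lemma U: "U \<in> carrier Mm" using fs by (simp add: fundamental_solution_def Units_def)

sublocale fm: fundamental_matrix fls_deriv fls_const F "{..<p}" "mt B" "mt U" "mt V"
  by (rule fundamental_matrix_mt[OF K FK B fs V])

lemma F_image: "F \<subseteq> \<iota> ` K" using FK by (auto simp: F_def)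

lemma mt_image: "A \<in> carrier Mm \<Longrightarrow> v \<in> J \<Longrightarrow> mt A v \<in> \<iota> ` K"
  unfolding mt_def by (rule imageI[OF mat_monoid_carrierD])

text \<open>The generating solution \<open>U0\<close> is \<open>U\<close> times a constant matrix,
  so the entries of \<open>U\<close> generate the same field.\<close>

lemma image_eq: "\<iota> ` K = frac_field F J (mt U)"
proof
  show "frac_field F J (mt U) \<subseteq> \<iota> ` K"
    by (rule frac_field_subset[OF is_subfield_image[OF K] F_image mt_image[OF U]])
  obtain U0 where U0: "fundamental_solution D p B K U0"
    "K = generate_field M (rational_functions D \<union> elements_mat U0)"
    using pv unfolding picard_vessiot_def by blast
  then obtain V0 where V0: "V0 \<in> carrier Mm" "V0 \<otimes>\<^bsub>Mm\<^esub> U0 = \<one>\<^bsub>Mm\<^esub>" "U0 \<otimes>\<^bsub>Mm\<^esub> V0 = \<one>\<^bsub>Mm\<^esub>" "U0 \<in> carrier Mm"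
    unfolding fundamental_solution_def Units_def by blast
  interpret fm0: fundamental_matrix fls_deriv fls_const F "{..<p}" "mt B" "mt U0" "mt V0"
    by (rule fundamental_matrix_mt[OF K FK B U0(1) V0(1-3)])
  have "\<exists>A. \<forall>v\<in>J. mt U0 v = mprod {..<p} (mt U) (\<lambda>v. fls_const (A v)) v \<and>
    mprod {..<p} (mt V) (mt U0) v = fls_const (A v)"
    by (rule fm.constant_quotient[OF fm0.DU])
  then obtain A where A: "\<forall>v\<in>J. mt U0 v = mprod {..<p} (mt U) (\<lambda>v. fls_const (A v)) v \<and>
    mprod {..<p} (mt V) (mt U0) v = fls_const (A v)" by (elim exE)
  note sub = is_subfield_frac_field[OF F_sub, of J "mt U"]
  have U0L: "mt U0 v \<in> frac_field F J (mt U)" if v: "v \<in> J" for v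
  proof -
    have "mt U0 v = mprod {..<p} (mt U) (\<lambda>v. fls_const (A v)) v" using bspec[OF A v] by (rule conjunct1)
    also have "\<dots> \<in> frac_field F J (mt U)"
    proof -
      obtain i j where ij: "v = (i, j)" "i < p" "j < p" using v by auto
      have "mt U (i, l) \<in> frac_field F J (mt U)" if "l < p" for l
        by (rule frac_field_var[OF F_sub]) (use ij that in auto)
      moreover have "fls_const c \<in> frac_field F J (mt U)" for c
        using frac_field_base[OF F_sub] fm.cst_E by blast
      ultimately show ?thesis
        unfolding ij mprod_def prod.case
        by (intro is_subfield_sum[OF sub] is_subfieldD(4)[OF sub]) auto
    qed
    finally show ?thesis .
  qed
  have elK: "elements_mat U0 \<subseteq> K" using V0(4) by (auto simp: mat_monoid_def)
  have elL: "\<iota> ` elements_mat U0 \<subseteq> frac_field F J (mt U)"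
  proof
    fix y assume "y \<in> \<iota> ` elements_mat U0"
    then obtain i j where "i < dim_row U0" "j < dim_col U0" "y = \<iota> (U0 $$ (i, j))" by auto
    then show "y \<in> frac_field F J (mt U)"
      using U0L[of "(i, j)"] V0(4) by (auto simp: mat_monoid_def mt_def)
  qed
  have FL: "\<iota> ` rational_functions D \<subseteq> frac_field F J (mt U)"
    using frac_field_base[OF F_sub, of J "mt U"] by (simp add: F_def)
  show "\<iota> ` K \<subseteq> frac_field F J (mt U)"
  proof
    fix y assume "y \<in> \<iota> ` K"
    then obtain x where x: "x \<in> K" "y = \<iota> x" by blast
    have "x \<in> generate_field M (rational_functions D \<union> elements_mat U0)" using x(1) U0(2) by simp
    from generate_field_image[OF K sub _ _ this] show "y \<in> frac_field F J (mt U)"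
      using FK elK elL FL x(2) by (simp add: image_Un)
  qed
qed

section \<open>The differential Galois group acting on Laurent series\<close>

definition \<kappa> :: "complex fls \<Rightarrow> complex \<Rightarrow> complex" where
  "\<kappa> = inv_into K \<iota>"

lemma inj_K: "inj_on \<iota> K" using \<iota>_inj Kc by (auto simp: inj_on_def)

lemma \<kappa>_\<iota>: "x \<in> K \<Longrightarrow> \<kappa> (\<iota> x) = x"
  unfolding \<kappa>_def by (rule inv_into_f_f[OF inj_K])

lemma \<iota>_\<kappa>: "y \<in> \<iota> ` K \<Longrightarrow> \<iota> (\<kappa> y) = y"
  unfolding \<kappa>_def by (rule f_inv_into_f[where f = \<iota> and A = K])

lemma \<kappa>_K: "y \<in> \<iota> ` K \<Longrightarrow> \<kappa> y \<in> K"
  unfolding \<kappa>_def by (rule inv_into_into)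

abbreviation "G \<equiv> diff_galois_group D K"

definition act :: "((complex \<Rightarrow> complex) \<Rightarrow> complex \<Rightarrow> complex) \<Rightarrow> complex fls \<Rightarrow> complex fls" where
  "act \<sigma> y = \<iota> (\<sigma> (\<kappa> y))"

lemma act_\<iota>: "x \<in> K \<Longrightarrow> act \<sigma> (\<iota> x) = \<iota> (\<sigma> x)"
  by (simp add: act_def \<kappa>_\<iota>)

lemma carrier_G: "\<sigma> \<in> carrier G \<longleftrightarrow> \<sigma> \<in> extensional K \<and> bij_betw \<sigma> K K \<and>
    (\<forall>x\<in>K. \<forall>y\<in>K. \<sigma> (x \<oplus>\<^bsub>M\<^esub> y) = \<sigma> x \<oplus>\<^bsub>M\<^esub> \<sigma> y) \<and> (\<forall>x\<in>K. \<forall>y\<in>K. \<sigma> (x \<otimes>\<^bsub>M\<^esub> y) = \<sigma> x \<otimes>\<^bsub>M\<^esub> \<sigma> y) \<and>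
    \<sigma> \<one>\<^bsub>M\<^esub> = \<one>\<^bsub>M\<^esub> \<and> (\<forall>r\<in>rational_functions D. \<sigma> r = r) \<and> (\<forall>y\<in>K. \<sigma> (mero_deriv D y) = mero_deriv D (\<sigma> y))"
  unfolding diff_galois_group_def ring_iso_def Ring.ring_hom_def Bij_def
  by (auto simp: bij_betw_def)

lemma mult_G: "\<sigma> \<in> carrier G \<Longrightarrow> \<tau> \<in> carrier G \<Longrightarrow> \<sigma> \<otimes>\<^bsub>G\<^esub> \<tau> = compose K \<sigma> \<tau>"
  by (simp add: diff_galois_group_def BijGroup_def)

lemma one_K: "\<one>\<^bsub>M\<^esub> \<in> rational_functions D"
proof -
  have "\<one>\<^bsub>M\<^esub> = mero_repr D (\<lambda>z. poly 1 z / poly 1 z)" by (simp add: mero_field_def)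
  then show ?thesis unfolding rational_functions_def by (intro CollectI exI[of _ 1] conjI) auto
qed

lemma carrier_iff_diff_aut:
  assumes ext: "\<sigma> \<in> extensional K" and into: "\<And>x. x \<in> K \<Longrightarrow> \<sigma> x \<in> K"
  shows "\<sigma> \<in> carrier G \<longleftrightarrow> fls.diff_aut F (\<iota> ` K) (act \<sigma>)"
proof -
  note KD = subfield_D[OF K]
  have eqI: "\<iota> a = \<iota> b \<longleftrightarrow> a = b" if "a \<in> K" "b \<in> K" for a b using \<iota>_inj Kc that by blast
  have dK: "mero_deriv D x \<in> K" if "x \<in> K" for x using DK that by blast
  have "bij_betw (act \<sigma>) (\<iota> ` K) (\<iota> ` K) \<longleftrightarrow> bij_betw \<sigma> K K"
  proof -
    have "act \<sigma> ` \<iota> ` K = \<iota> ` \<sigma> ` K" by (auto simp: act_\<iota> image_image)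
    moreover have "\<iota> ` \<sigma> ` K = \<iota> ` K \<longleftrightarrow> \<sigma> ` K = K"
      using inj_on_image_eq_iff[OF inj_K, of "\<sigma> ` K" K] into by blast
    moreover have "inj_on (act \<sigma>) (\<iota> ` K) \<longleftrightarrow> inj_on \<sigma> K"
      unfolding inj_on_def by (auto simp: act_\<iota> eqI into)
    ultimately show ?thesis by (simp add: bij_betw_def)
  qed
  moreover have "(\<forall>x\<in>\<iota> ` K. \<forall>y\<in>\<iota> ` K. act \<sigma> (x + y) = act \<sigma> x + act \<sigma> y) \<longleftrightarrow>
    (\<forall>x\<in>K. \<forall>y\<in>K. \<sigma> (x \<oplus>\<^bsub>M\<^esub> y) = \<sigma> x \<oplus>\<^bsub>M\<^esub> \<sigma> y)"
  proof -
    have "act \<sigma> (\<iota> x + \<iota> y) = act \<sigma> (\<iota> x) + act \<sigma> (\<iota> y) \<longleftrightarrow> \<sigma> (x \<oplus>\<^bsub>M\<^esub> y) = \<sigma> x \<oplus>\<^bsub>M\<^esub> \<sigma> y"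
      if xy: "x \<in> K" "y \<in> K" for x y
    proof -
      have "act \<sigma> (\<iota> x + \<iota> y) = \<iota> (\<sigma> (x \<oplus>\<^bsub>M\<^esub> y))"
        using act_\<iota>[OF KD(4)[OF xy], of \<sigma>] xy Kc by simp
      moreover have "act \<sigma> (\<iota> x) + act \<sigma> (\<iota> y) = \<iota> (\<sigma> x \<oplus>\<^bsub>M\<^esub> \<sigma> y)"
        using xy into Kc by (simp add: act_\<iota>)
      ultimately show ?thesis using eqI[OF into[OF KD(4)[OF xy]] KD(4)[OF into into]] xy by simp
    qed
    then show ?thesis by auto
  qed
  moreover have "(\<forall>x\<in>\<iota> ` K. \<forall>y\<in>\<iota> ` K. act \<sigma> (x * y) = act \<sigma> x * act \<sigma> y) \<longleftrightarrow>
    (\<forall>x\<in>K. \<forall>y\<in>K. \<sigma> (x \<otimes>\<^bsub>M\<^esub> y) = \<sigma> x \<otimes>\<^bsub>M\<^esub> \<sigma> y)"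
  proof -
    have "act \<sigma> (\<iota> x * \<iota> y) = act \<sigma> (\<iota> x) * act \<sigma> (\<iota> y) \<longleftrightarrow> \<sigma> (x \<otimes>\<^bsub>M\<^esub> y) = \<sigma> x \<otimes>\<^bsub>M\<^esub> \<sigma> y"
      if xy: "x \<in> K" "y \<in> K" for x y
    proof -
      have "act \<sigma> (\<iota> x * \<iota> y) = \<iota> (\<sigma> (x \<otimes>\<^bsub>M\<^esub> y))"
        using act_\<iota>[OF KD(5)[OF xy], of \<sigma>] xy Kc by simp
      moreover have "act \<sigma> (\<iota> x) * act \<sigma> (\<iota> y) = \<iota> (\<sigma> x \<otimes>\<^bsub>M\<^esub> \<sigma> y)"
        using xy into Kc by (simp add: act_\<iota>)
      ultimately show ?thesis using eqI[OF into[OF KD(5)[OF xy]] KD(5)[OF into into]] xy by simp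
    qed
    then show ?thesis by auto
  qed
  moreover have "(\<forall>x\<in>\<iota> ` K. fls_deriv (act \<sigma> x) = act \<sigma> (fls_deriv x)) \<longleftrightarrow>
    (\<forall>y\<in>K. \<sigma> (mero_deriv D y) = mero_deriv D (\<sigma> y))"
  proof -
    have "fls_deriv (act \<sigma> (\<iota> x)) = act \<sigma> (fls_deriv (\<iota> x)) \<longleftrightarrow> \<sigma> (mero_deriv D x) = mero_deriv D (\<sigma> x)"
      if x: "x \<in> K" for x
    proof -
      have "act \<sigma> (fls_deriv (\<iota> x)) = \<iota> (\<sigma> (mero_deriv D x))"
        using act_\<iota>[OF dK[OF x], of \<sigma>] Kc[OF x] by simp
      moreover have "fls_deriv (act \<sigma> (\<iota> x)) = \<iota> (mero_deriv D (\<sigma> x))"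
        using Kc[OF into[OF x]] by (simp add: act_\<iota> x)
      ultimately show ?thesis using eqI[OF into[OF dK[OF x]] dK[OF into[OF x]]] by auto
    qed
    then show ?thesis by auto
  qed
  moreover have "(\<forall>x\<in>F. act \<sigma> x = x) \<longleftrightarrow> (\<forall>r\<in>rational_functions D. \<sigma> r = r)"
  proof -
    have "act \<sigma> (\<iota> r) = \<iota> r \<longleftrightarrow> \<sigma> r = r" if "r \<in> rational_functions D" for r
      using that FK eqI[OF into] act_\<iota> by auto
    then show ?thesis by (auto simp: F_def)
  qed
  moreover have "(\<forall>r\<in>rational_functions D. \<sigma> r = r) \<Longrightarrow> \<sigma> \<one>\<^bsub>M\<^esub> = \<one>\<^bsub>M\<^esub>" using one_K by blast
  ultimately show ?thesis unfolding carrier_G fls.diff_aut_def using ext by blast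
qed

lemma \<sigma>_K: "\<sigma> \<in> carrier G \<Longrightarrow> x \<in> K \<Longrightarrow> \<sigma> x \<in> K"
  by (auto simp: carrier_G bij_betw_def)

lemma act_diff_aut: "\<sigma> \<in> carrier G \<Longrightarrow> fls.diff_aut F (\<iota> ` K) (act \<sigma>)"
  using carrier_iff_diff_aut[of \<sigma>] \<sigma>_K[of \<sigma>] by (simp add: carrier_G)

lemma act_compose: "\<sigma> \<in> carrier G \<Longrightarrow> \<tau> \<in> carrier G \<Longrightarrow> y \<in> \<iota> ` K \<Longrightarrow> act (compose K \<sigma> \<tau>) y = act \<sigma> (act \<tau> y)"
  by (auto simp: act_\<iota> compose_def \<sigma>_K)

lemma eq_if_act_eq:
  assumes "\<sigma> \<in> carrier G" "\<tau> \<in> carrier G" "\<And>y. y \<in> \<iota> ` K \<Longrightarrow> act \<sigma> y = act \<tau> y"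
  shows "\<sigma> = \<tau>"
proof (rule extensionalityI[of _ K])
  show "\<sigma> \<in> extensional K" "\<tau> \<in> extensional K" using assms by (simp_all add: carrier_G)
  fix x assume x: "x \<in> K"
  have "\<iota> (\<sigma> x) = \<iota> (\<tau> x)" using assms(3)[OF imageI[OF x]] x by (simp add: act_\<iota>)
  then show "\<sigma> x = \<tau> x" by (rule \<iota>_inj[rotated 2]) (use x \<sigma>_K Kc assms in auto)
qed

lemma automorphism_lift:
  assumes \<tau>: "fls.diff_aut F (\<iota> ` K) \<tau>"
  shows "\<exists>\<sigma>\<in>carrier G. \<forall>y\<in>\<iota> ` K. act \<sigma> y = \<tau> y"
proof -
  define \<sigma> where "\<sigma> = (\<lambda>x\<in>K. \<kappa> (\<tau> (\<iota> x)))"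
  note \<tau>D = fls.diff_autD[OF \<tau> is_subfield_image[OF K]]
  have into: "\<sigma> x \<in> K" if "x \<in> K" for x
    using \<kappa>_K[OF \<tau>D(1)[OF imageI[OF that]]] that by (simp add: \<sigma>_def)
  have eq: "act \<sigma> y = \<tau> y" if y: "y \<in> \<iota> ` K" for y
  proof -
    obtain x where x: "x \<in> K" "y = \<iota> x" using y by blast
    show ?thesis using x \<iota>_\<kappa>[OF \<tau>D(1)[OF y]] by (simp add: act_\<iota> \<sigma>_def)
  qed
  have D_image: "fls_deriv y \<in> \<iota> ` K" if y: "y \<in> \<iota> ` K" for y
  proof -
    obtain x where x: "x \<in> K" "y = \<iota> x" using y by blast
    have "mero_deriv D x \<in> K" using DK x(1) by blast
    then have "\<iota> (mero_deriv D x) \<in> \<iota> ` K" by (rule imageI)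
    then show ?thesis using x Kc by simp
  qed
  note sub = is_subfieldD[OF is_subfield_image[OF K]]
  have "fls.diff_aut F (\<iota> ` K) (act \<sigma>)"
    unfolding fls.diff_aut_def
  proof (intro conjI ballI)
    show "bij_betw (act \<sigma>) (\<iota> ` K) (\<iota> ` K)"
      using \<tau> bij_betw_cong[of "\<iota> ` K" "act \<sigma>" \<tau> "\<iota> ` K"] eq by (simp add: fls.diff_aut_def)
    fix x y assume xy: "x \<in> \<iota> ` K" "y \<in> \<iota> ` K"
    show "act \<sigma> (x + y) = act \<sigma> x + act \<sigma> y"
      unfolding eq[OF sub(3)[OF xy]] eq[OF xy(1)] eq[OF xy(2)] by (rule \<tau>D(2)[OF xy])
    show "act \<sigma> (x * y) = act \<sigma> x * act \<sigma> y"
      unfolding eq[OF sub(4)[OF xy]] eq[OF xy(1)] eq[OF xy(2)] by (rule \<tau>D(3)[OF xy])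
  next
    fix x assume x: "x \<in> \<iota> ` K"
    show "fls_deriv (act \<sigma> x) = act \<sigma> (fls_deriv x)"
      unfolding eq[OF x] eq[OF D_image[OF x]] by (rule \<tau>D(4)[OF x])
  next
    fix x assume x: "x \<in> F"
    show "act \<sigma> x = x" using eq[OF subsetD[OF F_image x]] \<tau>D(5)[OF x] by simp
  qed
  then have "\<sigma> \<in> carrier G" using carrier_iff_diff_aut[of \<sigma>] into by (simp add: \<sigma>_def)
  then show ?thesis using eq by blast
qed

text \<open>Composites and inverses are formed on Laurent series and lifted back by
  \<open>automorphism_lift\<close>; extensionality identifies the lift with the operation of
  \<open>BijGroup\<close>.\<close>

lemma group_G: "group G"
proof -
  let ?BG = "BijGroup K"
  have sub: "carrier G \<subseteq> Bij K" by (auto simp: carrier_G Bij_def)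
  interpret BG: group ?BG by (rule group_BijGroup)
  have bij: "\<sigma> \<in> carrier ?BG" if "\<sigma> \<in> carrier G" for \<sigma> using sub that by (auto simp: BijGroup_def)
  have mult: "\<sigma> \<otimes>\<^bsub>?BG\<^esub> \<tau> = compose K \<sigma> \<tau>" if "\<sigma> \<in> carrier G" "\<tau> \<in> carrier G" for \<sigma> \<tau>
    using that sub by (auto simp: BijGroup_def)
  note imK = is_subfield_image[OF K]
  have DL: "fls_deriv ` \<iota> ` K \<subseteq> \<iota> ` K"
  proof
    fix y assume "y \<in> fls_deriv ` \<iota> ` K"
    then obtain x where x: "x \<in> K" "y = fls_deriv (\<iota> x)" by blast
    have "mero_deriv D x \<in> K" using DK x(1) by blast
    then have "\<iota> (mero_deriv D x) \<in> \<iota> ` K" by (rule imageI)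
    then show "y \<in> \<iota> ` K" using x Kc by simp
  qed
  have comp: "compose K \<sigma> \<tau> \<in> carrier G" if st: "\<sigma> \<in> carrier G" "\<tau> \<in> carrier G" for \<sigma> \<tau>
  proof -
    have "fls.diff_aut F (\<iota> ` K) (\<lambda>y. act \<sigma> (act \<tau> y))"
      by (rule fls.diff_aut_comp[OF act_diff_aut[OF st(1)] act_diff_aut[OF st(2)] imK])
    from automorphism_lift[OF this] obtain \<rho> where \<rho>: "\<rho> \<in> carrier G" "\<forall>y\<in>\<iota> ` K. act \<rho> y = act \<sigma> (act \<tau> y)"
      by (elim bexE)
    have "compose K \<sigma> \<tau> = \<rho>"
    proof (rule extensionalityI[of _ K])
      show "compose K \<sigma> \<tau> \<in> extensional K" by (rule compose_extensional)
      show "\<rho> \<in> extensional K" using \<rho>(1) by (simp add: carrier_G)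
      fix x assume x: "x \<in> K"
      have "\<iota> (compose K \<sigma> \<tau> x) = \<iota> (\<rho> x)"
        using bspec[OF \<rho>(2) imageI[OF x]] x st by (simp add: act_\<iota> compose_def \<sigma>_K)
      then show "compose K \<sigma> \<tau> x = \<rho> x"
        by (rule \<iota>_inj[rotated 2]) (use x st \<rho>(1) \<sigma>_K Kc in \<open>simp_all add: compose_def\<close>)
    qed
    then show ?thesis using \<rho>(1) by simp
  qed
  have "subgroup (carrier G) ?BG"
  proof (rule BG.subgroupI)
    show "carrier G \<subseteq> carrier ?BG" using bij by blast
    from automorphism_lift[OF fls.diff_aut_id] show "carrier G \<noteq> {}" by blast
    show "\<sigma> \<otimes>\<^bsub>?BG\<^esub> \<tau> \<in> carrier G" if "\<sigma> \<in> carrier G" "\<tau> \<in> carrier G" for \<sigma> \<tau>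
      using comp[OF that] mult[OF that] by simp
    show "inv\<^bsub>?BG\<^esub> \<sigma> \<in> carrier G" if s: "\<sigma> \<in> carrier G" for \<sigma>
    proof -
      note inv = fls.diff_aut_inv_into[OF act_diff_aut[OF s] imK F_image DL]
      from automorphism_lift[OF inv(1)] obtain \<rho> where \<rho>: "\<rho> \<in> carrier G"
        "\<forall>y\<in>\<iota> ` K. act \<rho> y = inv_into (\<iota> ` K) (act \<sigma>) y" by (elim bexE)
      have "\<rho> (\<sigma> x) = x" if x: "x \<in> K" for x
      proof -
        have "\<iota> (\<rho> (\<sigma> x)) = act \<rho> (act \<sigma> (\<iota> x))" using x s by (simp add: act_\<iota> \<sigma>_K)
        also have "\<dots> = \<iota> x"
          using bspec[OF \<rho>(2), of "act \<sigma> (\<iota> x)"] inv(3)[OF imageI[OF x]] x s by (simp add: act_\<iota> \<sigma>_K)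
        finally show ?thesis by (rule \<iota>_inj[rotated 2]) (use x s \<rho>(1) \<sigma>_K Kc in simp_all)
      qed
      then have "compose K \<rho> \<sigma> = (\<lambda>x\<in>K. x)" by (auto simp: compose_def)
      then have "\<rho> \<otimes>\<^bsub>?BG\<^esub> \<sigma> = \<one>\<^bsub>?BG\<^esub>" using mult[OF \<rho>(1) s] by (simp add: BijGroup_def)
      then have "inv\<^bsub>?BG\<^esub> \<sigma> = \<rho>" by (rule BG.inv_equality[OF _ bij[OF s] bij[OF \<rho>(1)]])
      then show ?thesis using \<rho>(1) by simp
    qed
  qed
  moreover have "?BG\<lparr>carrier := carrier G\<rparr> = G" by (simp add: diff_galois_group_def)
  ultimately show ?thesis using subgroup_BijGroup_imp_group[of "carrier G" K] by simp
qed

lemma mt_V_image: "v \<in> J \<Longrightarrow> mt V v \<in> frac_field F J (mt U)"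
  using mt_image[OF V(1)] image_eq by simp

sublocale ga: galois_action fls_deriv fls_const F "{..<p}" "mt B" "mt U" "mt V" G act
proof (intro galois_action.intro galois_action_axioms.intro fm.fundamental_matrix_axioms group_G)
  show "mt V v \<in> frac_field F J (mt U)" if "v \<in> J" for v by (rule mt_V_image[OF that])
  show "fls.diff_aut F (frac_field F J (mt U)) (act \<sigma>)" if "\<sigma> \<in> carrier G" for \<sigma>
    using act_diff_aut[OF that] image_eq by simp
  show "act (\<sigma> \<otimes>\<^bsub>G\<^esub> \<tau>) x = act \<sigma> (act \<tau> x)"
    if "\<sigma> \<in> carrier G" "\<tau> \<in> carrier G" "x \<in> frac_field F J (mt U)" for \<sigma> \<tau> x
    using act_compose[OF that(1,2)] mult_G[OF that(1,2)] that(3) image_eq by simp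
  show "\<sigma> = \<tau>" if "\<sigma> \<in> carrier G" "\<tau> \<in> carrier G" "\<And>x. x \<in> frac_field F J (mt U) \<Longrightarrow> act \<sigma> x = act \<tau> x" for \<sigma> \<tau>
    by (rule eq_if_act_eq[OF that(1,2)]) (use that(3) image_eq in simp)
qed

section \<open>Matrix images of subgroups and their closedness\<close>

abbreviation entries :: "complex mat \<Rightarrow> nat \<times> nat \<Rightarrow> complex fls" where
  "entries A \<equiv> (\<lambda>v. fls_const (A $$ v))"

lemma mprod_entries:
  fixes A A' :: "complex mat"
  assumes A: "A \<in> carrier_mat p p" "A' \<in> carrier_mat p p" and v: "v \<in> J"
  shows "mprod {..<p} (entries A) (entries A') v = fls_const ((A * A') $$ v)"
proof -
  obtain i j where ij: "v = (i, j)" "i < p" "j < p" using v by auto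
  have "(A * A') $$ v = (\<Sum>k<p. A $$ (i, k) * A' $$ (k, j))"
    using A ij by (simp add: scalar_prod_def atLeast0LessThan)
  then show ?thesis by (simp add: mprod_def ij fls.cst_sum)
qed

lemma cocycle_eq:
  assumes \<sigma>: "\<sigma> \<in> carrier G" and v: "v \<in> J"
  shows "mt (V \<otimes>\<^bsub>Mm\<^esub> map_mat \<sigma> U) v = ga.cocycle \<sigma> v"
proof -
  have Uc: "U \<in> carrier_mat p p" and UK: "\<And>v. v \<in> J \<Longrightarrow> U $$ v \<in> K"
    using U mat_monoid_carrierD[OF U] by (simp_all add: mat_monoid_def)
  have \<sigma>U: "map_mat \<sigma> U \<in> carrier Mm"
    using U \<sigma>_K[OF \<sigma>] by (auto simp: mat_monoid_def)
  have "mt (map_mat \<sigma> U) w = act \<sigma> (mt U w)" if w: "w \<in> J" for w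
    using w Uc UK[OF w] by (auto simp: mt_def act_\<iota>)
  then show ?thesis
    unfolding mt_mult[OF K V(1) \<sigma>U v] ga.cocycle_def by (intro mprod_cong[OF _ _ v]) simp_all
qed

lemma m_inv_U: "inv\<^bsub>Mm\<^esub> U = V"
  unfolding m_inv_def
proof (rule the_equality)
  show "V \<in> carrier Mm \<and> U \<otimes>\<^bsub>Mm\<^esub> V = \<one>\<^bsub>Mm\<^esub> \<and> V \<otimes>\<^bsub>Mm\<^esub> U = \<one>\<^bsub>Mm\<^esub>" using V by blast
  fix W assume W: "W \<in> carrier Mm \<and> U \<otimes>\<^bsub>Mm\<^esub> W = \<one>\<^bsub>Mm\<^esub> \<and> W \<otimes>\<^bsub>Mm\<^esub> U = \<one>\<^bsub>Mm\<^esub>"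
  then have Wc: "W \<in> carrier Mm" by blast
  show "W = V"
  proof (rule mt_inj)
    show "W \<in> carrier_mat p p" "V \<in> carrier_mat p p" using Wc V(1) by (simp_all add: mat_monoid_def)
    show "W $$ v \<in> carrier M" "V $$ v \<in> carrier M" if "v \<in> J" for v
      using mat_monoid_carrierD[OF Wc that] mat_monoid_carrierD[OF V(1) that] Kc by blast+
    fix v assume v: "v \<in> J"
    have UW: "mprod {..<p} (mt U) (mt W) w = mone w" if "w \<in> J" for w
      using mt_mult[OF K U Wc that] mt_one[OF that] W by simp
    have "mt W v = mprod {..<p} (mprod {..<p} (mt V) (mt U)) (mt W) v"
      by (rule mprod_one_left[OF finite_lessThan fm.VU v, symmetric])
    also have "\<dots> = mt V v" unfolding mprod_assoc
      by (rule mprod_one_right[OF finite_lessThan UW v])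
    finally show "mt W v = mt V v" .
  qed
qed

lemma in_galois_image_iff:
  assumes N: "N \<subseteq> carrier G"
  shows "A \<in> galois_image D p K U N \<longleftrightarrow>
    A \<in> carrier_mat p p \<and> (\<exists>\<sigma>\<in>N. \<forall>v\<in>J. fls_const (A $$ v) = ga.cocycle \<sigma> v)"
proof -
  have "map_mat (mero_const D) A = V \<otimes>\<^bsub>Mm\<^esub> map_mat \<sigma> U \<longleftrightarrow> (\<forall>v\<in>J. fls_const (A $$ v) = ga.cocycle \<sigma> v)"
    if A: "A \<in> carrier_mat p p" and \<sigma>: "\<sigma> \<in> N" for \<sigma>
  proof -
    have \<sigma>c: "\<sigma> \<in> carrier G" using N \<sigma> by blast
    have \<sigma>U: "map_mat \<sigma> U \<in> carrier Mm" using U \<sigma>_K[OF \<sigma>c] by (auto simp: mat_monoid_def)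
    have mA: "mt (map_mat (mero_const D) A) v = fls_const (A $$ v)" if "v \<in> J" for v
      using that A by (auto simp: mt_def)
    let ?R = "V \<otimes>\<^bsub>Mm\<^esub> map_mat \<sigma> U"
    have R: "?R \<in> carrier_mat p p" by (simp add: mat_monoid_def)
    have RM: "?R $$ v \<in> carrier M" if v: "v \<in> J" for v
    proof -
      interpret Mf: Ring.field M by (rule field_M)
      interpret R: Ring.ring "M\<lparr>carrier := K\<rparr>" by (rule Mf.subring_is_ring[OF subfieldE(1)[OF K]])
      obtain i j where ij: "v = (i, j)" "i < p" "j < p" using v by auto
      have "(\<lambda>k. V $$ (i, k) \<otimes>\<^bsub>M\<^esub> map_mat \<sigma> U $$ (k, j)) \<in> {..<p} \<rightarrow> carrier (M\<lparr>carrier := K\<rparr>)"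
      proof (rule Pi_I)
        fix k assume k: "k \<in> {..<p}"
        have "V $$ (i, k) \<in> K" "map_mat \<sigma> U $$ (k, j) \<in> K"
          using mat_monoid_carrierD[OF V(1), of "(i, k)"] mat_monoid_carrierD[OF \<sigma>U, of "(k, j)"] ij k by simp_all
        then show "V $$ (i, k) \<otimes>\<^bsub>M\<^esub> map_mat \<sigma> U $$ (k, j) \<in> carrier (M\<lparr>carrier := K\<rparr>)"
          using subfield_D(5)[OF K] by simp
      qed
      from R.finsum_closed[OF this] show ?thesis
        using ij Kc by (simp add: mat_monoid_def)
    qed
    show ?thesis
    proof
      assume "map_mat (mero_const D) A = ?R"
      then show "\<forall>v\<in>J. fls_const (A $$ v) = ga.cocycle \<sigma> v" using mA cocycle_eq[OF \<sigma>c] by metis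
    next
      assume eq: "\<forall>v\<in>J. fls_const (A $$ v) = ga.cocycle \<sigma> v"
      show "map_mat (mero_const D) A = ?R"
      proof (rule mt_inj[OF _ R _ RM])
        show "map_mat (mero_const D) A \<in> carrier_mat p p" using A by simp
        show "map_mat (mero_const D) A $$ v \<in> carrier M" if "v \<in> J" for v using that A by auto
        show "mt (map_mat (mero_const D) A) v = mt ?R v" if "v \<in> J" for v
          using mA[OF that] cocycle_eq[OF \<sigma>c that] eq that by simp
      qed
    qed
  qed
  then show ?thesis unfolding galois_image_def Let_def m_inv_U by blast
qed

text \<open>The relations \<open>q\<close> between the entries of \<open>U\<close> are the equations
  of the Galois group itself: an invertible \<open>A\<close> satisfying them at U A is a
  specialization and yields an automorphism. \<open>FF\<close> adds the equations of the subset.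
  Laurent coefficients then turn all of these into complex polynomials in the entries of
  \<open>A\<close>.\<close>

lemma zariski_closed_zero_locus:
  assumes FF: "FF \<subseteq> polys UNIV J"
  shows "zariski_closed_GL p (galois_image D p K U (ga.zero_locus FF))"
proof -
  define q where "q = {R \<in> polys F J. R (mt U) = 0}"
  define X where "X A = mprod {..<p} (mt U) (entries A)" for A
  have NG: "ga.zero_locus FF \<subseteq> carrier G" by (auto simp: ga.zero_locus_def)
  have qU: "q \<subseteq> polys UNIV J" unfolding q_def using poly_funs_mono[OF _ subset_UNIV] by blast
  have actU: "act \<sigma> (mt U v) = X A v"
    if "\<And>v. v \<in> J \<Longrightarrow> fls_const (A $$ v) = ga.cocycle \<sigma> v" "v \<in> J" for \<sigma> A v
    unfolding X_def ga.act_U[OF that(2)] by (rule mprod_cong[OF _ _ that(2)]) (simp_all add: that(1))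
  have image: "A \<in> galois_image D p K U (ga.zero_locus FF) \<longleftrightarrow>
    A \<in> carrier_mat p p \<and> invertible_mat A \<and> (\<forall>P\<in>FF \<union> q. P (X A) = 0)" for A
  proof
    assume "A \<in> galois_image D p K U (ga.zero_locus FF)"
    then obtain \<sigma> where A: "A \<in> carrier_mat p p" and \<sigma>: "\<sigma> \<in> ga.zero_locus FF"
      and "\<forall>v\<in>J. fls_const (A $$ v) = ga.cocycle \<sigma> v"
      unfolding in_galois_image_iff[OF NG] by blast
    then have \<sigma>v: "\<And>v. v \<in> J \<Longrightarrow> fls_const (A $$ v) = ga.cocycle \<sigma> v" by blast
    have \<sigma>c: "\<sigma> \<in> carrier G" using \<sigma> NG by blast
    have PX: "P (\<lambda>v. act \<sigma> (mt U v)) = P (X A)" if "P \<in> polys UNIV J" for P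
      by (rule poly_funs_cong[OF that]) (rule actU[OF \<sigma>v])
    have "P (X A) = 0" if P: "P \<in> FF" for P
    proof -
      have "P (\<lambda>v. act \<sigma> (mt U v)) = 0" using \<sigma> P unfolding ga.zero_locus_def by blast
      then show ?thesis unfolding PX[OF subsetD[OF FF P]] .
    qed
    moreover have "P (X A) = 0" if P: "P \<in> q" for P
    proof -
      have Pq: "P \<in> polys F J" "P (mt U) = 0" using P by (simp_all add: q_def)
      have "P (\<lambda>v. act \<sigma> (mt U v)) = act \<sigma> (P (mt U))"
        by (rule fls.diff_aut_poly[OF ga.act[OF \<sigma>c] ga.L_sub ga.E_L Pq(1) ga.U_L, symmetric])
      then show ?thesis using PX[OF subsetD[OF qU P]] Pq(2) ga.actD(6)[OF \<sigma>c] by simp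
    qed
    moreover have "invertible_mat A"
    proof -
      interpret gG: group G by (rule group_G)
      \<comment> \<open>\<open>A\<close> is the matrix of \<open>\<sigma>\<close>; its inverse is
        built as the matrix of the inverse automorphism.\<close>
      let ?s = "inv\<^bsub>G\<^esub> \<sigma>"
      have sc: "?s \<in> carrier G" using \<sigma>c by simp
      have "\<exists>c. ga.cocycle ?s v = fls_const c" if "v \<in> J" for v using ga.cocycle_const[OF sc that] by blast
      then obtain c where c: "\<And>v. v \<in> J \<Longrightarrow> ga.cocycle ?s v = fls_const (c v)" by metis
      define A' where "A' = mat p p c"
      have A': "A' \<in> carrier_mat p p" by (simp add: A'_def)
      have cA': "fls_const (A' $$ v) = ga.cocycle ?s v" if "v \<in> J" for v using that c by (auto simp: A'_def)
      have one: "ga.cocycle \<one>\<^bsub>G\<^esub> v = mone v" if v: "v \<in> J" for v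
      proof -
        have "ga.cocycle \<one>\<^bsub>G\<^esub> v = mprod {..<p} (mt V) (mt U) v"
          unfolding ga.cocycle_def by (rule mprod_cong[OF _ _ v]) (simp_all add: ga.act_one ga.U_L)
        then show ?thesis using fm.VU[OF v] by simp
      qed
      have prod_eq: "mprod {..<p} (entries A) (entries A') v = mone v"
        "mprod {..<p} (entries A') (entries A) v = mone v" if v: "v \<in> J" for v
      proof -
        have "mprod {..<p} (entries A) (entries A') v = mprod {..<p} (ga.cocycle \<sigma>) (ga.cocycle ?s) v"
          by (rule mprod_cong[OF _ _ v]) (simp_all add: \<sigma>v cA')
        then show "mprod {..<p} (entries A) (entries A') v = mone v"
          using ga.cocycle_mult[OF \<sigma>c sc v] \<sigma>c one[OF v] by simp
        have "mprod {..<p} (entries A') (entries A) v = mprod {..<p} (ga.cocycle ?s) (ga.cocycle \<sigma>) v"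
          by (rule mprod_cong[OF _ _ v]) (simp_all add: \<sigma>v cA')
        then show "mprod {..<p} (entries A') (entries A) v = mone v"
          using ga.cocycle_mult[OF sc \<sigma>c v] \<sigma>c one[OF v] by simp
      qed
      have mone_const: "mone v = fls_const ((1\<^sub>m p :: complex mat) $$ v)" if "v \<in> J" for v
        using that by (auto simp: mone_def)
      have "A * A' = 1\<^sub>m p"
      proof (rule eq_matI)
        fix i j assume "i < dim_row (1\<^sub>m p :: complex mat)" "j < dim_col (1\<^sub>m p :: complex mat)"
        then have v: "(i, j) \<in> J" by simp
        show "(A * A') $$ (i, j) = 1\<^sub>m p $$ (i, j)"
          using prod_eq(1)[OF v] mprod_entries[OF A A' v] mone_const[OF v] by (simp only: fls.cst_eq_iff)
      qed (use A A' in simp_all)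
      moreover have "A' * A = 1\<^sub>m p"
      proof (rule eq_matI)
        fix i j assume "i < dim_row (1\<^sub>m p :: complex mat)" "j < dim_col (1\<^sub>m p :: complex mat)"
        then have v: "(i, j) \<in> J" by simp
        show "(A' * A) $$ (i, j) = 1\<^sub>m p $$ (i, j)"
          using prod_eq(2)[OF v] mprod_entries[OF A' A v] mone_const[OF v] by (simp only: fls.cst_eq_iff)
      qed (use A A' in simp_all)
      ultimately show ?thesis
        using A A' unfolding invertible_mat_def inverts_mat_def by (auto simp: square_mat.simps)
    qed
    ultimately show "A \<in> carrier_mat p p \<and> invertible_mat A \<and> (\<forall>P\<in>FF \<union> q. P (X A) = 0)"
      using A by blast
  next
    assume *: "A \<in> carrier_mat p p \<and> invertible_mat A \<and> (\<forall>P\<in>FF \<union> q. P (X A) = 0)"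
    then have A: "A \<in> carrier_mat p p" by blast
    obtain A' where A': "A * A' = 1\<^sub>m (dim_row A)" "A' * A = 1\<^sub>m (dim_row A')"
      using * unfolding invertible_mat_def inverts_mat_def by blast
    \<comment> \<open>\<open>inverts_mat\<close> does not prescribe the size of \<open>A'\<close>;
      it is read off from the two products.\<close>
    have dims: "dim_col A' = p" "dim_row A' = p"
      using arg_cong[OF A'(1), of dim_col] arg_cong[OF A'(2), of dim_col] A by simp_all
    then have A'c: "A' \<in> carrier_mat p p" by auto
    have inv: "mprod {..<p} (entries A) (entries A') v = mone v" "mprod {..<p} (entries A') (entries A) v = mone v"
      if v: "v \<in> J" for v
      using mprod_entries[OF A A'c v] mprod_entries[OF A'c A v] A' dims A v by (auto simp: mone_def)
    have "\<exists>\<tau>. fls.diff_aut F (frac_field F J (mt U)) \<tau> \<and> (\<forall>P\<in>polys F J. \<tau> (P (mt U)) = P (X A))"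
      unfolding X_def
    proof (rule fm.automorphism_of_specialization[where A = "($$) A" and A' = "($$) A'"])
      show "R (mprod {..<p} (mt U) (entries A)) = 0" if "R \<in> polys F J" "R (mt U) = 0" for R
      proof -
        have "R \<in> FF \<union> q" using that by (simp add: q_def)
        then show ?thesis using * unfolding X_def by blast
      qed
    qed (rule inv; assumption)+
    then obtain \<tau> where \<tau>: "fls.diff_aut F (frac_field F J (mt U)) \<tau>"
      "\<forall>P\<in>polys F J. \<tau> (P (mt U)) = P (X A)" by (elim exE conjE)
    have "\<exists>\<sigma>\<in>carrier G. \<forall>y\<in>\<iota> ` K. act \<sigma> y = \<tau> y"
      by (rule automorphism_lift) (simp only: image_eq \<tau>(1))
    then obtain \<sigma> where \<sigma>: "\<sigma> \<in> carrier G" "\<forall>y\<in>\<iota> ` K. act \<sigma> y = \<tau> y" by (elim bexE)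
    have aU: "act \<sigma> (mt U v) = X A v" if v: "v \<in> J" for v
      using bspec[OF \<sigma>(2) mt_image[OF U v]] bspec[OF \<tau>(2) polys_var[OF v]] by simp
    have "P (\<lambda>v. act \<sigma> (mt U v)) = 0" if P: "P \<in> FF" for P
    proof -
      have "P (\<lambda>v. act \<sigma> (mt U v)) = P (X A)" by (rule poly_funs_cong[OF subsetD[OF FF P]]) (rule aU)
      also have "\<dots> = 0" using * P by blast
      finally show ?thesis .
    qed
    then have "\<sigma> \<in> ga.zero_locus FF" using \<sigma>(1) by (simp add: ga.zero_locus_def)
    moreover have "fls_const (A $$ v) = ga.cocycle \<sigma> v" if v: "v \<in> J" for v
    proof -
      have "ga.cocycle \<sigma> v = mprod {..<p} (mt V) (mprod {..<p} (mt U) (entries A)) v"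
        unfolding ga.cocycle_def by (rule mprod_cong[OF _ _ v]) (simp_all add: aU X_def)
      also have "\<dots> = entries A v"
        unfolding mprod_assoc[symmetric] by (rule mprod_one_left[OF finite_lessThan fm.VU v])
      finally show ?thesis by simp
    qed
    ultimately show "A \<in> galois_image D p K U (ga.zero_locus FF)"
      unfolding in_galois_image_iff[OF NG] using A by blast
  qed
  \<comment> \<open>One complex polynomial for each condition and each Laurent coefficient; a series
    is zero exactly when all its coefficients are.\<close>
  define S where "S = {Q \<in> mat_polys p. \<exists>P\<in>FF \<union> q. \<exists>m. \<forall>A. mat_poly_eval Q A = fls_nth (P (X A)) m}"
  have "(\<forall>P\<in>FF \<union> q. P (X A) = 0) \<longleftrightarrow> (\<forall>Q\<in>S. mat_poly_eval Q A = 0)" for A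
  proof
    assume z: "\<forall>P\<in>FF \<union> q. P (X A) = 0"
    show "\<forall>Q\<in>S. mat_poly_eval Q A = 0"
    proof
      fix Q assume "Q \<in> S"
      then obtain P m where P: "P \<in> FF \<union> q" "\<forall>A. mat_poly_eval Q A = fls_nth (P (X A)) m"
        unfolding S_def by (elim CollectE conjE bexE exE)
      show "mat_poly_eval Q A = 0" using spec[OF P(2), of A] bspec[OF z P(1)] by simp
    qed
  next
    assume S: "\<forall>Q\<in>S. mat_poly_eval Q A = 0"
    show "\<forall>P\<in>FF \<union> q. P (X A) = 0"
    proof
      fix P assume P: "P \<in> FF \<union> q"
      then have PU: "P \<in> polys UNIV J" using FF qU by blast
      show "P (X A) = 0"
      proof (rule fls_eqI)
        fix m
        from mat_poly_of_const_poly[OF fm.polys_U_cm[OF PU], of m]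
        obtain Q where Q: "Q \<in> mat_polys p" "\<forall>A. mat_poly_eval Q A = fls_nth (P (X A)) m"
          unfolding X_def by (elim bexE)
        then have "Q \<in> S" unfolding S_def using P by blast
        from bspec[OF S this] show "fls_nth (P (X A)) m = fls_nth 0 m" using spec[OF Q(2), of A] by simp
      qed
    qed
  qed
  then have "galois_image D p K U (ga.zero_locus FF) =
    {A \<in> carrier_mat p p. invertible_mat A \<and> (\<forall>P\<in>S. mat_poly_eval P A = 0)}"
    using image by blast
  moreover have "S \<subseteq> mat_polys p" by (auto simp: S_def)
  ultimately show ?thesis unfolding zariski_closed_GL_def by blast
qed

lemma algebraic_subgroup_zero_locus:
  assumes "N \<lhd> G" "FF \<subseteq> polys UNIV J" "N = ga.zero_locus FF"
  shows "algebraic_subgroup D p K U N"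
  unfolding algebraic_subgroup_def
  using zariski_closed_zero_locus[OF assms(2)] normal_imp_subgroup[OF assms(1)] assms(3) by simp

end

theorem proposition1:
  fixes D :: "complex set"
    and f :: "complex \<Rightarrow> complex" and p :: nat and a :: "nat \<Rightarrow> complex \<Rightarrow> complex"
    and K\<^sub>f :: "(complex \<Rightarrow> complex) set" and U :: "(complex \<Rightarrow> complex) mat"
    and k :: nat and fs :: "nat \<Rightarrow> complex \<Rightarrow> complex" and ps :: "nat \<Rightarrow> nat"
    and as :: "nat \<Rightarrow> nat \<Rightarrow> complex \<Rightarrow> complex" and Ks :: "nat \<Rightarrow> (complex \<Rightarrow> complex) set"
  assumes "open D" and "connected D" and "D \<noteq> {}"
    and "linear_ode D p a" and "ode_solution D p a f" and "f \<noteq> \<zero>\<^bsub>mero_field D\<^esub>"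
    and "picard_vessiot D p (companion_mat D p a) K\<^sub>f" and "f \<in> K\<^sub>f"
    and "fundamental_solution D p (companion_mat D p a) K\<^sub>f U"
    and "\<And>i. i \<in> {1..k} \<Longrightarrow> linear_ode D (ps i) (as i)"
    and "\<And>i. i \<in> {1..k} \<Longrightarrow> ode_solution D (ps i) (as i) (fs i)"
    and "\<And>i. i \<in> {1..k} \<Longrightarrow> fs i \<noteq> \<zero>\<^bsub>mero_field D\<^esub>"
    and "\<And>i. i \<in> {1..k} \<Longrightarrow> picard_vessiot D (ps i) (companion_mat D (ps i) (as i)) (Ks i)"
    and "\<And>i. i \<in> {1..k} \<Longrightarrow> fs i \<in> Ks i"
    and "f \<in> generate_field (mero_field D) (rational_functions D \<union> fs ` {1..k})
           - rational_functions D"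
    and "\<exists>\<sigma>\<in>carrier (diff_galois_group D K\<^sub>f). \<exists>\<tau>\<in>carrier (diff_galois_group D K\<^sub>f).
           \<sigma> \<otimes>\<^bsub>diff_galois_group D K\<^sub>f\<^esub> \<tau> \<noteq> \<tau> \<otimes>\<^bsub>diff_galois_group D K\<^sub>f\<^esub> \<sigma>"
    and "\<And>N. N \<lhd> diff_galois_group D K\<^sub>f \<Longrightarrow> algebraic_subgroup D p K\<^sub>f U N \<Longrightarrow>
           N = carrier (diff_galois_group D K\<^sub>f) \<or> N = {\<one>\<^bsub>diff_galois_group D K\<^sub>f\<^esub>}"
  shows "\<exists>i\<in>{1..k}. K\<^sub>f \<subseteq> Ks i"
proof -
  obtain z0 where z0: "z0 \<in> D" using assms(3) by blast
  interpret mero_expansion D z0 by unfold_locales (use assms(1,2) z0 in auto)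
  \<comment> \<open>\<open>K\<^sub>f\<close> becomes index 0 of one family, as in
    \<open>compositum\<close>.\<close>
  define Kb where "Kb b = (if b = 0 then K\<^sub>f else Ks b)" for b
  define n where "n b = (if b = 0 then p else ps b)" for b
  define Bm where "Bm b = (if b = 0 then companion_mat D p a else companion_mat D (ps b) (as b))" for b
  have pvK: "picard_vessiot D (n b) (Bm b) (Kb b)" if "b \<le> k" for b
    using that assms(7) assms(13)[of b] by (simp add: Kb_def n_def Bm_def)
  \<comment> \<open>For index 0 the solution must be the given \<open>U\<close>, to which the
    hypothesis on algebraic subgroups refers; for the other indices any fundamental solution will
    do.\<close>
  have "\<exists>W W'. (b = 0 \<longrightarrow> W = U) \<and> pv_field D z0 (n b) (Bm b) (Kb b) W W'" if b: "b \<le> k" for b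
  proof -
    let ?M = "mat_monoid (mero_field D\<lparr>carrier := Kb b\<rparr>) (n b)"
    have "\<exists>W. (b = 0 \<longrightarrow> W = U) \<and> fundamental_solution D (n b) (Bm b) (Kb b) W"
    proof (cases "b = 0")
      case True
      then show ?thesis using assms(9) by (auto simp: Kb_def n_def Bm_def)
    next
      case False
      then show ?thesis using pvK[OF b] unfolding picard_vessiot_def by blast
    qed
    then obtain W where W: "b = 0 \<longrightarrow> W = U" "fundamental_solution D (n b) (Bm b) (Kb b) W" by blast
    then obtain W' where "W' \<in> carrier ?M" "W' \<otimes>\<^bsub>?M\<^esub> W = \<one>\<^bsub>?M\<^esub>" "W \<otimes>\<^bsub>?M\<^esub> W' = \<one>\<^bsub>?M\<^esub>"
      unfolding fundamental_solution_def Units_def by blast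
    then have "pv_field D z0 (n b) (Bm b) (Kb b) W W'"
      using pvK[OF b] W(2) mero_expansion_axioms by (intro pv_field.intro pv_field_axioms.intro)
    then show ?thesis using W(1) by blast
  qed
  then obtain W W' where W: "\<And>b. b \<le> k \<Longrightarrow> b = 0 \<longrightarrow> W b = U"
    "\<And>b. b \<le> k \<Longrightarrow> pv_field D z0 (n b) (Bm b) (Kb b) (W b) (W' b)" by metis
  have W0: "W 0 = U" using W(1)[of 0] by simp
  have image: "\<iota> ` Kb b = frac_field F ({..<n b} \<times> {..<n b}) (mt (W b))" if "b \<le> k" for b
    by (rule pv_field.image_eq[OF W(2)[OF that]])
  have Kc: "Kb b \<subseteq> carrier M" if "b \<le> k" for b using pv_field.Kc[OF W(2)[OF that]] by blast
  interpret K0: pv_field D z0 "n 0" "Bm 0" "Kb 0" "W 0" "W' 0" by (rule W(2)) simp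
  have G: "diff_galois_group D (Kb 0) = diff_galois_group D K\<^sub>f" by (simp add: Kb_def)
  have f_K: "f \<in> Kb 0" using assms(8) by (simp add: Kb_def)
  have simple: "N = carrier K0.G \<or> N = {\<one>\<^bsub>K0.G\<^esub>}"
    if "N \<lhd> K0.G" "FF \<subseteq> polys UNIV K0.J" "N = K0.ga.zero_locus FF" for N FF
  proof -
    have "algebraic_subgroup D p K\<^sub>f U N"
      using K0.algebraic_subgroup_zero_locus[OF that] by (simp add: Kb_def n_def W0)
    then show ?thesis using assms(17)[of N] that(1) unfolding G by blast
  qed
  have f_F: "\<iota> f \<notin> F"
  proof
    assume "\<iota> f \<in> F"
    then obtain r where r: "r \<in> rational_functions D" "\<iota> f = \<iota> r" by (auto simp: F_def)
    then have "f = r" using \<iota>_inj f_K Kc[of 0] rational_carrier by blast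
    then show False using r(1) assms(15) by simp
  qed
  have generated: "\<iota> f \<in> E" if E: "is_subfield E" "F \<subseteq> E" "\<And>i. i \<in> {1..k} \<Longrightarrow> frac_field F ({..<n i} \<times> {..<n i}) (mt (W i)) \<subseteq> E" for E
  proof -
    have gen: "f \<in> generate_field M (rational_functions D \<union> fs ` {1..k})" using assms(15) by simp
    have fsE: "\<iota> (fs i) \<in> E" if i: "i \<in> {1..k}" for i
    proof -
      have "\<iota> (fs i) \<in> \<iota> ` Kb i" using assms(14)[OF i] i by (simp add: Kb_def)
      then show ?thesis using image[of i] E(3)[OF i] i by auto
    qed
    have "x \<in> carrier M \<and> \<iota> x \<in> E" if "x \<in> generate_field M (rational_functions D \<union> fs ` {1..k})" for x
    proof (rule generate_field_image[OF subfield_carrier E(1) _ _ that])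
      have "fs i \<in> carrier M" if i: "i \<in> {1..k}" for i
        using assms(14)[OF i] Kc[of i] i by (auto simp: Kb_def)
      then show "rational_functions D \<union> fs ` {1..k} \<subseteq> carrier M" using rational_carrier by blast
      show "\<iota> ` (rational_functions D \<union> fs ` {1..k}) \<subseteq> E"
        using fsE E(2) by (auto simp: F_def)
    qed
    then show ?thesis using gen by blast
  qed
  interpret final: simple_galois_action fls_deriv fls_const F k n "\<lambda>b. mt (Bm b)" "\<lambda>b. mt (W b)" "\<lambda>b. mt (W' b)"
    K0.G K0.act "\<iota> f"
  proof (intro simple_galois_action.intro simple_galois_action_axioms.intro compositum.intro compositum_axioms.intro
      fls.diff_field_axioms K0.ga.galois_action_axioms)
    show "fundamental_matrix fls_deriv fls_const F {..<n b} (mt (Bm b)) (mt (W b)) (mt (W' b))" if "b \<le> k" for b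
    proof -
      interpret pv_field D z0 "n b" "Bm b" "Kb b" "W b" "W' b" by (rule W(2)[OF that])
      show ?thesis by (rule fm.fundamental_matrix_axioms)
    qed
    show "\<exists>g\<in>carrier K0.G. \<forall>x\<in>frac_field F ({..<n 0} \<times> {..<n 0}) (mt (W 0)). K0.act g x = \<tau> x"
      if "fls.diff_aut F (frac_field F ({..<n 0} \<times> {..<n 0}) (mt (W 0))) \<tau>" for \<tau>
      using K0.automorphism_lift[of \<tau>] that by (simp add: image[symmetric])
    show "N = carrier K0.G \<or> N = {\<one>\<^bsub>K0.G\<^esub>}"
      if "N \<lhd> K0.G" "FF \<subseteq> polys UNIV ({..<n 0} \<times> {..<n 0})" "N = K0.ga.zero_locus FF" for N FF
      by (rule simple[OF that])
    show "\<exists>g\<in>carrier K0.G. \<exists>h\<in>carrier K0.G. g \<otimes>\<^bsub>K0.G\<^esub> h \<noteq> h \<otimes>\<^bsub>K0.G\<^esub> g"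
      using assms(16) unfolding G .
    show "\<iota> f \<in> frac_field F ({..<n 0} \<times> {..<n 0}) (mt (W 0))"
      using image[of 0] f_K by auto
    show "\<iota> f \<notin> F" by (rule f_F)
    show "\<iota> f \<in> E" if "is_subfield E" "F \<subseteq> E"
      "\<And>i. i \<in> {1..k} \<Longrightarrow> frac_field F ({..<n i} \<times> {..<n i}) (mt (W i)) \<subseteq> E" for E
      by (rule generated[OF that])
  qed
  obtain i where i: "i \<in> {1..k}" "final.K 0 \<subseteq> final.K i" using final.K0_subset by (elim bexE)
  have ik: "i \<le> k" "i \<noteq> 0" using i(1) by auto
  have sub: "\<iota> ` K\<^sub>f \<subseteq> \<iota> ` Ks i"
    using i(2) image[of 0] image[OF ik(1)] ik(2) by (simp add: Kb_def)
  have "K\<^sub>f \<subseteq> Ks i"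
  proof
    fix x assume x: "x \<in> K\<^sub>f"
    then obtain y where y: "y \<in> Ks i" "\<iota> x = \<iota> y" using sub by blast
    have "x \<in> carrier M" using Kc[of 0] x by (auto simp: Kb_def)
    moreover have "y \<in> carrier M" using Kc[OF ik(1)] y(1) ik(2) by (auto simp: Kb_def)
    ultimately have "x = y" using \<iota>_inj y(2) by blast
    then show "x \<in> Ks i" using y(1) by simp
  qed
  then show ?thesis using i(1) by blast
qed

end
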